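(* Let $m$ be any positive integer. Let $G$ be a left-compressed extremal $3$-graph with $m$ edges satisfying $|E(G)\,\triangle\, E(C_{3,m})|\le 6$. Then $\lambda(G)\leq\lambda(C_{3,m})$.
   Context: $[n]=\{1,2,\ldots,n\}$; $V^{(3)}$ is the family of all $3$-subsets of $V$. A $3$-graph $G$ consists of a vertex set $V(G)$ and an edge set $E(G)\subseteq V(G)^{(3)}$; a triple $\{p,q,s\}$ is written $pqs$. A $3$-graph $G=([n],E)$ is left-compressed if $j_1j_2j_3\in E$ implies $i_1i_2i_3\in E$ for every triple $i_1i_2i_3$ with $i_p\le j_p$ for $p=1,2,3$. The Lagrangian of a $3$-graph $G$ on $[n]$ is $\lambda(G)=\max\{\sum_{pqs\in E(G)}x_px_qx_s : x_1+\cdots+x_n=1,\ x_j\ge 0 \text{ for all } j\}$. A $3$-graph $G$ with $m$ edges is extremal if $\lambda(G)=\max\{\lambda(H): H \text{ is a } 3\text{-graph with } m \text{ edges}\}$. Colex ordering on $3$-subsets of the positive integers $\mathbb{N}$: for distinct $A,B$, $A<B$ iff $\max(A\triangle B)\in B$, where $\triangle$ denotes symmetric difference. $C_{3,m}$ is the $3$-graph with $m$ edges whose edges are the first $m$ sets in the colex ordering of $\mathbb{N}^{(3)}$. *)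

theory Defs
  imports "HOL-Analysis.Analysis" "HOL-Library.Ramsey"
begin

record 'a hypergraph =
  verts :: "'a set"
  edges :: "'a set set"

definition three_graph :: "'a hypergraph \<Rightarrow> bool" where
  "three_graph G \<longleftrightarrow> finite (verts G) \<and> edges G \<subseteq> [verts G]\<^bsup>3\<^esup>"

text \<open>The triples need not be listed in increasing order: if \<open>i\<^sub>p \<le> j\<^sub>p\<close> for all \<open>p\<close>
  in some listing, then the same holds for the two increasing listings.\<close>

definition left_compressed :: "nat hypergraph \<Rightarrow> bool" where
  "left_compressed G \<longleftrightarrow>
     (\<forall>i1 i2 i3 j1 j2 j3. {j1, j2, j3} \<in> edges G \<and> {i1, i2, i3} \<in> [verts G]\<^bsup>3\<^esup> \<and>
        i1 \<le> j1 \<and> i2 \<le> j2 \<and> i3 \<le> j3 \<longrightarrow> {i1, i2, i3} \<in> edges G)"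

definition weightings :: "'a set \<Rightarrow> ('a \<Rightarrow> real) set" where
  "weightings V = {x. (\<forall>v\<in>V. 0 \<le> x v) \<and> (\<Sum>v\<in>V. x v) = 1}"

text \<open>The supremum is a maximum whenever the vertex set is nonempty: see
  \<open>lagrangian_attained\<close> and \<open>lagrangian_upper\<close> below.\<close>

definition lagrangian :: "'a hypergraph \<Rightarrow> real" where
  "lagrangian G = (SUP x\<in>weightings (verts G). \<Sum>e\<in>edges G. \<Prod>v\<in>e. x v)"

text \<open>Every finite 3-graph is isomorphic to one with vertices in \<open>nat\<close>, so it suffices to let
  the competitors range over \<open>nat hypergraph\<close>; their vertex sets are not bounded.\<close>

definition extremal :: "nat hypergraph \<Rightarrow> bool" where
  "extremal G \<longleftrightarrow> three_graph G \<and>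
     (\<forall>H :: nat hypergraph. three_graph H \<and> card (edges H) = card (edges G) \<longrightarrow>
        lagrangian H \<le> lagrangian G)"

definition colex_less :: "nat set \<Rightarrow> nat set \<Rightarrow> bool" where
  "colex_less A B \<longleftrightarrow> A \<noteq> B \<and> Max (sym_diff A B) \<in> B"

text \<open>The first \<open>m\<close> triples are those with fewer than \<open>m\<close> predecessors; a triple has only
  finitely many predecessors (\<open>finite_colex_predecessors\<close> below), so \<open>card\<close> is meaningful here.\<close>

definition colex_edges :: "nat \<Rightarrow> nat set set" where
  "colex_edges m = {B \<in> [{1..}]\<^bsup>3\<^esup>. card {A \<in> [{1..}]\<^bsup>3\<^esup>. colex_less A B} < m}"

definition colex_graph :: "nat \<Rightarrow> nat hypergraph" where
  "colex_graph m = \<lparr>verts = \<Union>(colex_edges m), edges = colex_edges m\<rparr>"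


lemma edge_value_le:
  assumes G: "three_graph G" and x: "x \<in> weightings (verts G)"
  shows "(\<Sum>e\<in>edges G. \<Prod>v\<in>e. x v) \<le> card (edges G)"
proof -
  have fin: "finite (verts G)" using G by (simp add: three_graph_def)
  have le1: "x v \<le> 1" if "v \<in> verts G" for v
    using member_le_sum[of v "verts G" x] that fin x by (auto simp: weightings_def)
  have "(\<Prod>v\<in>e. x v) \<le> 1" if "e \<in> edges G" for e
  proof (rule prod_le_1)
    fix v assume "v \<in> e"
    then have "v \<in> verts G" using that G by (auto simp: three_graph_def nsets_def)
    then show "0 \<le> x v \<and> x v \<le> 1" using le1 x by (auto simp: weightings_def)
  qed
  then show ?thesis using sum_bounded_above[of "edges G" "\<lambda>e. \<Prod>v\<in>e. x v" 1] by simp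
qed

lemma lagrangian_upper:
  assumes G: "three_graph G" and x: "x \<in> weightings (verts G)"
  shows "(\<Sum>e\<in>edges G. \<Prod>v\<in>e. x v) \<le> lagrangian G"
  unfolding lagrangian_def
  by (rule cSUP_upper[OF x]) (use edge_value_le[OF G] in \<open>auto intro!: bdd_aboveI2\<close>)

lemma lagrangian_attained:
  fixes G :: "'a hypergraph"
  assumes G: "three_graph G" and ne: "verts G \<noteq> {}"
  shows "\<exists>x\<in>weightings (verts G). lagrangian G = (\<Sum>e\<in>edges G. \<Prod>v\<in>e. x v)"
proof -
  let ?V = "verts G"
  let ?f = "\<lambda>x::'a \<Rightarrow> real. \<Sum>e\<in>edges G. \<Prod>v\<in>e. x v"
  let ?B = "PiE UNIV (\<lambda>v. if v \<in> ?V then {0..1} else {0}) :: ('a \<Rightarrow> real) set"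
  let ?K = "?B \<inter> {x. (\<Sum>v\<in>?V. x v) = 1}"
  have fin: "finite ?V" using G by (simp add: three_graph_def)
  have "compact ?B"
  proof -
    have "compactin (product_topology (\<lambda>_::'a. euclideanreal) UNIV) ?B"
      unfolding compactin_PiE by simp
    then show ?thesis
      by (simp only: euclidean_product_topology compactin_euclidean_iff)
  qed
  moreover have "closed {x::'a \<Rightarrow> real. (\<Sum>v\<in>?V. x v) = 1}"
    by (intro closed_Collect_eq continuous_intros continuous_on_product_coordinates)
  ultimately have K: "compact ?K" by (rule compact_Int_closed)
  obtain w where w: "w \<in> ?V" using ne by auto
  have "(\<lambda>v. if v = w then 1 else 0) \<in> ?K"
    using w fin by (auto simp: PiE_def)
  then have "?K \<noteq> {}" by blast
  moreover have "continuous_on ?K ?f"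
    by (rule continuous_on_subset[OF _ subset_UNIV])
       (intro continuous_intros continuous_on_product_coordinates)
  ultimately obtain x where x: "x \<in> ?K" and mx: "\<And>y. y \<in> ?K \<Longrightarrow> ?f y \<le> ?f x"
    using continuous_attains_sup[OF K, of ?f] by meson
  have xw: "x \<in> weightings ?V"
    using x by (fastforce simp: weightings_def PiE_def Pi_def split: if_splits)
  have le: "?f y \<le> ?f x" if y: "y \<in> weightings ?V" for y
  proof -
    let ?y = "\<lambda>v. if v \<in> ?V then y v else 0"
    have "y v \<le> 1" if "v \<in> ?V" for v
      using member_le_sum[of v ?V y] that fin y by (auto simp: weightings_def)
    then have "?y \<in> ?K" using y by (auto simp: weightings_def PiE_def)
    then have "?f ?y \<le> ?f x" by (rule mx)
    moreover have "?f ?y = ?f y"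
      using G by (intro sum.cong prod.cong) (auto simp: three_graph_def nsets_def)
    ultimately show ?thesis by simp
  qed
  have "lagrangian G \<le> ?f x"
    unfolding lagrangian_def by (rule cSUP_least) (use xw le in auto)
  with lagrangian_upper[OF G xw] xw show ?thesis by force
qed

lemma colex_less_Max_le:
  assumes "A \<in> [{1..}]\<^bsup>3\<^esup>" "B \<in> [{1..}]\<^bsup>3\<^esup>" "colex_less A B"
  shows "A \<subseteq> {1..Max B}"
proof
  fix a assume a: "a \<in> A"
  have fin: "finite A" "finite B" using assms by (auto simp: nsets_def)
  let ?M = "Max (sym_diff A B)"
  have M: "?M \<le> Max B" using assms fin by (auto simp: colex_less_def)
  have "a \<le> Max B"
  proof (cases "a \<in> B")
    case False
    then have "a \<le> ?M" using a fin by (intro Max_ge) auto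
    with M show ?thesis by simp
  qed (use fin in auto)
  then show "a \<in> {1..Max B}" using a assms by (auto simp: nsets_def)
qed

lemma finite_colex_predecessors:
  assumes "B \<in> [{1..}]\<^bsup>3\<^esup>"
  shows "finite {A \<in> [{1..}]\<^bsup>3\<^esup>. colex_less A B}"
proof (rule finite_subset)
  show "{A \<in> [{1..}]\<^bsup>3\<^esup>. colex_less A B} \<subseteq> Pow {1..Max B}"
    using colex_less_Max_le[OF _ assms] by blast
qed simp

end

theory Submission
  imports Defs
begin

text \<open>
  Let \<open>C\<close> be the colex segment with \<open>m\<close> edges, let \<open>n + 2\<close> be its largest vertex, and suppose
  \<open>\<lambda>(G) > \<lambda>(C)\<close>. As \<open>C\<close> contains every triple in \<open>{1..n + 1}\<close>, the value \<open>\<lambda>(G)\<close> also exceeds the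
  Lagrangian of that clique.

  \<^emph>\<open>Reduction to tail graphs.\<close> If an edge of \<open>G\<close> contained \<open>l - 1\<close> and \<open>l\<close> for some \<open>l > n + 2\<close>,
  then \<open>G\<close> would contain all triples \<open>{1, i, j}\<close> with \<open>j \<le> n + 3\<close>, and this is too much for a
  graph with as many edges as \<open>C\<close> and close to it. Hence weights beyond \<open>n + 2\<close> can be pushed
  down, and extremality then leaves no room for an edge outside \<open>{1..n + 2}\<close>. Closeness to \<open>C\<close>
  also forces every triple in \<open>{1..n}\<close> into \<open>G\<close>. So \<open>G\<close> is described by the set \<open>N\<close> of pairs
  missing in the link of \<open>n + 1\<close>, the set \<open>M \<supseteq> N\<close> of pairs missing in the link of \<open>n + 2\<close>, and
  the number \<open>b\<close> of edges \<open>{j, n + 1, n + 2}\<close>, which have \<open>j = 1, \<dots>, b\<close> (\<open>shifted_is_tail\<close>). The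
  segment \<open>C\<close> itself has \<open>N = M = {}\<close>, or lies inside such a graph.

  \<^emph>\<open>Optimal weights.\<close> Take a decreasing optimal weighting \<open>x\<close> of such a graph, write \<open>w\<close> and \<open>z\<close>
  for the last two weights and \<open>c\<close> for the sum of the first \<open>b\<close> ones. Moving all of \<open>z\<close> to the
  vertex \<open>n + 1\<close> gives a weighting of the clique on \<open>{1..n + 1}\<close>, which must be worse; this says
  \<open>w N(x) + z M(x) < w z c\<close>. The first order conditions for the pairs \<open>(n + 1, n + 2)\<close> and
  \<open>(1, n + 1)\<close> turn it into \<open>x 1 < w + z\<close> (\<open>first_lt_last_two\<close>) and \<open>card M < b\<close>
  (\<open>card_M_less\<close>). So the first \<open>n + 1\<close> weights differ by less than \<open>z\<close>, and since \<open>G\<close> and \<open>C\<close>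
  differ in at most three edges on either side, only few pairs \<open>(N, M)\<close> remain.

  \<^emph>\<open>Trading edges.\<close> The graph is brought to the form \<open>N = M = {}\<close> by trading edges, mostly
  \<open>{b, n + 1, n + 2}\<close>, for missing ones, at fixed number of edges and without lowering the
  Lagrangian (\<open>star_step\<close>, \<open>triangle_step\<close>, \<open>single_defect_step\<close>). Keeping the weights is not
  always enough, because the edge given up may weigh more than the one restored. In that case
  the weights of the few vertices concerned are reflected about their mean. The reflection keeps
  the sum and the sum of squares, so by Newton's identities it changes the sum over all triples
  only by the change in the sum of cubes, which is of third order, while it takes weight from
  the vertex that now lies in more missing triples than before. The bound \<open>x 1 < w + z\<close> is what
  makes the gain outweigh this loss. Two configurations do not fit this scheme: in
  \<open>full_triangle_step\<close> seven weights are replaced at once, and \<open>no_double_defect\<close> excludes the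
  last configuration because its first order conditions contradict the bounds above.
\<close>

section \<open>Values of 3-graphs\<close>

definition val :: "nat set set \<Rightarrow> (nat \<Rightarrow> real) \<Rightarrow> real" where
  "val E x = (\<Sum>e\<in>E. \<Prod>v\<in>e. x v)"

text \<open>Replacing one vertex by a smaller one generates the componentwise order of
  left-compressed graphs, and this form does not mention the vertex set.\<close>

definition shifted :: "nat set set \<Rightarrow> bool" where
  "shifted E \<longleftrightarrow> (\<forall>e\<in>E. \<forall>j\<in>e. \<forall>i. 1 \<le> i \<and> i < j \<and> i \<notin> e \<longrightarrow> insert i (e - {j}) \<in> E)"

text \<open>The vertex set is kept fixed so that graphs of different support can be compared by their
  edges alone.\<close>

abbreviation lag :: "nat \<Rightarrow> nat set set \<Rightarrow> real" where
  "lag t E \<equiv> lagrangian \<lparr>verts = {1..t}, edges = E\<rparr>"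

lemma val_mono:
  assumes "finite F" "E \<subseteq> F" "\<And>e v. e \<in> F \<Longrightarrow> v \<in> e \<Longrightarrow> 0 \<le> x v"
  shows "val E x \<le> val F x"
  unfolding val_def using assms by (intro sum_mono2 prod_nonneg) auto

lemma val_cong: "(\<And>e v. e \<in> E \<Longrightarrow> v \<in> e \<Longrightarrow> x v = y v) \<Longrightarrow> val E x = val E y"
  unfolding val_def by (intro sum.cong prod.cong) auto

lemma val_le_lag:
  assumes "E \<subseteq> [{1..t}]\<^bsup>3\<^esup>" "x \<in> weightings {1..t}"
  shows "val E x \<le> lag t E"
  using lagrangian_upper[of "\<lparr>verts = {1..t}, edges = E\<rparr>" x] assms
  by (simp add: three_graph_def val_def)

lemma lag_attained:
  assumes "E \<subseteq> [{1..t}]\<^bsup>3\<^esup>" "1 \<le> t"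
  obtains x where "x \<in> weightings {1..t}" "val E x = lag t E"
  using lagrangian_attained[of "\<lparr>verts = {1..t}, edges = E\<rparr>"] assms
  by (auto simp: three_graph_def val_def)

lemma nsets_nonneg: "x \<in> weightings V \<Longrightarrow> e \<in> [V]\<^bsup>k\<^esup> \<Longrightarrow> v \<in> e \<Longrightarrow> 0 \<le> x v"
  by (auto simp: weightings_def nsets_def)

lemma lag_mono:
  assumes "E \<subseteq> F" "F \<subseteq> [{1..t}]\<^bsup>3\<^esup>" "1 \<le> t"
  shows "lag t E \<le> lag t F"
proof -
  obtain x where x: "x \<in> weightings {1..t}" "val E x = lag t E"
    using lag_attained[of E t] assms by blast
  have "finite F" using assms(2) finite_imp_finite_nsets finite_subset by blast
  then have "val E x \<le> val F x"
    using assms nsets_nonneg[OF x(1), of _ 3] by (intro val_mono) blast+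
  then show ?thesis using x val_le_lag[OF assms(2) x(1)] by simp
qed

lemma nsets_insert_Suc:
  assumes "a \<notin> A"
  shows "[insert a A]\<^bsup>Suc k\<^esup> = [A]\<^bsup>Suc k\<^esup> \<union> insert a ` [A]\<^bsup>k\<^esup>"
proof (intro equalityI subsetI)
  fix e assume e: "e \<in> [insert a A]\<^bsup>Suc k\<^esup>"
  show "e \<in> [A]\<^bsup>Suc k\<^esup> \<union> insert a ` [A]\<^bsup>k\<^esup>"
  proof (cases "a \<in> e")
    case True
    then have "e = insert a (e - {a})" "e - {a} \<in> [A]\<^bsup>k\<^esup>"
      using e by (auto simp: nsets_def)
    then show ?thesis by blast
  qed (use e in \<open>auto simp: nsets_def\<close>)
next
  fix e assume "e \<in> [A]\<^bsup>Suc k\<^esup> \<union> insert a ` [A]\<^bsup>k\<^esup>"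
  then show "e \<in> [insert a A]\<^bsup>Suc k\<^esup>"
    using assms by (auto simp: nsets_def card_insert_if)
qed

lemma val_insert_image:
  assumes "finite F" "\<And>f. f \<in> F \<Longrightarrow> finite f \<and> a \<notin> f"
  shows "val (insert a ` F) x = x a * val F x"
proof -
  have "inj_on (insert a) F" 
    by (rule inj_onI) (metis assms(2) insert_ident)
  then have "val (insert a ` F) x = (\<Sum>f\<in>F. \<Prod>v\<in>insert a f. x v)"
    by (simp add: val_def sum.reindex)
  also have "\<dots> = (\<Sum>f\<in>F. x a * (\<Prod>v\<in>f. x v))" using assms by (intro sum.cong) auto
  finally show ?thesis by (simp add: val_def sum_distrib_left)
qed

lemma val_nsets_insert:
  assumes "finite A" "a \<notin> A"
  shows "val ([insert a A]\<^bsup>Suc k\<^esup>) x = val ([A]\<^bsup>Suc k\<^esup>) x + x a * val ([A]\<^bsup>k\<^esup>) x"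
proof -
  have fin: "finite ([A]\<^bsup>k\<^esup>)" "finite ([A]\<^bsup>Suc k\<^esup>)" using assms finite_imp_finite_nsets by blast+
  have disj: "[A]\<^bsup>Suc k\<^esup> \<inter> insert a ` [A]\<^bsup>k\<^esup> = {}" using assms by (auto simp: nsets_def)
  have "val ([insert a A]\<^bsup>Suc k\<^esup>) x = val ([A]\<^bsup>Suc k\<^esup>) x + val (insert a ` [A]\<^bsup>k\<^esup>) x"
    unfolding nsets_insert_Suc[OF assms(2)] unfolding val_def
    by (rule sum.union_disjoint) (use fin disj in auto)
  then show ?thesis
    using val_insert_image[OF fin(1), of a x] assms by (auto simp: nsets_def)
qed

lemma val_singleton_empty: "val {{}} x = 1"
  by (simp add: val_def)

text \<open>Only the power sums up to the third matter for the sum over all triples. This reduces the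
  effect of changing a few weights on a clique to an explicit computation.\<close>

lemma newton_identities:
  assumes "finite A"
  shows "val ([A]\<^bsup>1\<^esup>) x = (\<Sum>v\<in>A. x v)"
    and "2 * val ([A]\<^bsup>2\<^esup>) x = (\<Sum>v\<in>A. x v)^2 - (\<Sum>v\<in>A. x v ^ 2)"
    and "6 * val ([A]\<^bsup>3\<^esup>) x
           = (\<Sum>v\<in>A. x v)^3 - 3 * (\<Sum>v\<in>A. x v) * (\<Sum>v\<in>A. x v ^ 2) + 2 * (\<Sum>v\<in>A. x v ^ 3)"
proof -
  have "val ([A]\<^bsup>1\<^esup>) x = (\<Sum>v\<in>A. x v) \<and> 2 * val ([A]\<^bsup>2\<^esup>) x = (\<Sum>v\<in>A. x v)^2 - (\<Sum>v\<in>A. x v ^ 2)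
     \<and> 6 * val ([A]\<^bsup>3\<^esup>) x
           = (\<Sum>v\<in>A. x v)^3 - 3 * (\<Sum>v\<in>A. x v) * (\<Sum>v\<in>A. x v ^ 2) + 2 * (\<Sum>v\<in>A. x v ^ 3)"
    using assms
  proof (induction A)
    case empty
    have "[{}::nat set]\<^bsup>1\<^esup> = {}" "[{}::nat set]\<^bsup>2\<^esup> = {}" "[{}::nat set]\<^bsup>3\<^esup> = {}"
      by (auto simp: nsets_def)
    then show ?case by (simp add: val_def)
  next
    case (insert a A)
    have 1: "val ([insert a A]\<^bsup>1\<^esup>) x = val ([A]\<^bsup>1\<^esup>) x + x a"
      using val_nsets_insert[OF insert(1,2), of 0 x] by (simp add: val_singleton_empty)
    have 2: "val ([insert a A]\<^bsup>2\<^esup>) x = val ([A]\<^bsup>2\<^esup>) x + x a * val ([A]\<^bsup>1\<^esup>) x"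
      using val_nsets_insert[OF insert(1,2), of 1 x] by (simp add: numeral_2_eq_2)
    have 3: "val ([insert a A]\<^bsup>3\<^esup>) x = val ([A]\<^bsup>3\<^esup>) x + x a * val ([A]\<^bsup>2\<^esup>) x"
      using val_nsets_insert[OF insert(1,2), of 2 x] by (simp add: eval_nat_numeral)
    have e2: "2 * val ([A]\<^bsup>2\<^esup>) x = (\<Sum>v\<in>A. x v)^2 - (\<Sum>v\<in>A. x v ^ 2)" using insert by simp
    have e3: "6 * val ([A]\<^bsup>3\<^esup>) x = (\<Sum>v\<in>A. x v)^3 - 3 * (\<Sum>v\<in>A. x v) * (\<Sum>v\<in>A. x v ^ 2) + 2 * (\<Sum>v\<in>A. x v ^ 3)"
      using insert by simp
    have "2 * val ([insert a A]\<^bsup>2\<^esup>) x = (x a + (\<Sum>v\<in>A. x v))^2 - (x a ^ 2 + (\<Sum>v\<in>A. x v ^ 2))"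
      unfolding 2 using e2 insert by (simp add: power2_eq_square algebra_simps)
    moreover have "6 * val ([insert a A]\<^bsup>3\<^esup>) x
           = (x a + (\<Sum>v\<in>A. x v))^3 - 3 * (x a + (\<Sum>v\<in>A. x v)) * (x a ^ 2 + (\<Sum>v\<in>A. x v ^ 2))
             + 2 * (x a ^ 3 + (\<Sum>v\<in>A. x v ^ 3))"
    proof -
      have "6 * val ([insert a A]\<^bsup>3\<^esup>) x = 6 * val ([A]\<^bsup>3\<^esup>) x + 3 * x a * (2 * val ([A]\<^bsup>2\<^esup>) x)"
        unfolding 3 by simp
      then show ?thesis unfolding e2 e3 by (simp add: power2_eq_square power3_eq_cube algebra_simps)
    qed
    ultimately show ?case using insert 1 by simp
  qed
  then show "val ([A]\<^bsup>1\<^esup>) x = (\<Sum>v\<in>A. x v)"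
    and "2 * val ([A]\<^bsup>2\<^esup>) x = (\<Sum>v\<in>A. x v)^2 - (\<Sum>v\<in>A. x v ^ 2)"
    and "6 * val ([A]\<^bsup>3\<^esup>) x
           = (\<Sum>v\<in>A. x v)^3 - 3 * (\<Sum>v\<in>A. x v) * (\<Sum>v\<in>A. x v ^ 2) + 2 * (\<Sum>v\<in>A. x v ^ 3)" by auto
qed

lemma sum_fun_upd:
  fixes x :: "nat \<Rightarrow> real" and g :: "real \<Rightarrow> real"
  assumes "finite A"
  shows "(\<Sum>v\<in>A. g ((x(a := c)) v)) = (\<Sum>v\<in>A. g (x v)) + (if a \<in> A then g c - g (x a) else 0)"
proof (cases "a \<in> A")
  case True
  have "(\<Sum>v\<in>A. g ((x(a := c)) v)) = g c + (\<Sum>v\<in>A-{a}. g (x v))"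
    using sum.remove[OF assms True, of "\<lambda>v. g ((x(a := c)) v)"]
    by (auto intro: sum.cong)
  moreover have "(\<Sum>v\<in>A. g (x v)) = g (x a) + (\<Sum>v\<in>A-{a}. g (x v))"
    using sum.remove[OF assms True] by blast
  ultimately show ?thesis using True by simp
next
  case False
  then show ?thesis by (auto intro!: sum.cong)
qed

lemmas sum_upd = sum_fun_upd[where g = "\<lambda>r. r"] sum_fun_upd[where g = "\<lambda>r. r ^ 2"]
  sum_fun_upd[where g = "\<lambda>r. r ^ 3"]

lemma val_triples_transfer:
  fixes \<delta> :: real
  assumes "finite A" "i \<in> A" "j \<in> A" "i \<noteq> j"
  shows "val ([A]\<^bsup>3\<^esup>) (x(i := x i + \<delta>, j := x j - \<delta>))
           = val ([A]\<^bsup>3\<^esup>) x + \<delta> * (x j - x i - \<delta>) * ((\<Sum>v\<in>A. x v) - x i - x j)"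
proof -
  let ?s = "\<Sum>v\<in>A. x v" and ?s2 = "\<Sum>v\<in>A. x v ^ 2" and ?s3 = "\<Sum>v\<in>A. x v ^ 3"
  have "6 * val ([A]\<^bsup>3\<^esup>) (x(i := x i + \<delta>, j := x j - \<delta>)) = 
     6 * val ([A]\<^bsup>3\<^esup>) x + 6 * (\<delta> * (x j - x i - \<delta>) * (?s - x i - x j))"
    unfolding newton_identities(3)[OF assms(1)] sum_upd[OF assms(1)]
    using assms by (simp add: power2_eq_square power3_eq_cube algebra_simps)
  then show ?thesis by simp
qed

section \<open>Shifting and decreasing weights\<close>

definition link_without :: "nat set set \<Rightarrow> nat \<Rightarrow> nat \<Rightarrow> nat set set" where
  "link_without E i j = (\<lambda>e. e - {i}) ` {e \<in> E. i \<in> e \<and> j \<notin> e}"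

definition pair_link :: "nat set set \<Rightarrow> nat \<Rightarrow> nat \<Rightarrow> nat set set" where
  "pair_link E i j = (\<lambda>e. e - {i, j}) ` {e \<in> E. i \<in> e \<and> j \<in> e}"

text \<open>The value is linear in each weight; the four coefficients do not involve the weights of
  \<open>i\<close> and \<open>j\<close>.\<close>

lemma val_pair_split:
  assumes fin: "finite E" "\<And>e. e \<in> E \<Longrightarrow> finite e" and ij: "i \<noteq> j"
  shows "val E x = val {e \<in> E. i \<notin> e \<and> j \<notin> e} x + x i * val (link_without E i j) x
           + x j * val (link_without E j i) x + x i * x j * val (pair_link E i j) x"
proof -
  let ?N = "{e \<in> E. i \<notin> e \<and> j \<notin> e}" and ?I = "{e \<in> E. i \<in> e \<and> j \<notin> e}"
    and ?J = "{e \<in> E. j \<in> e \<and> i \<notin> e}" and ?B = "{e \<in> E. i \<in> e \<and> j \<in> e}"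
  have E: "E = (?N \<union> ?I) \<union> (?J \<union> ?B)" by blast
  have "val E x = (val ?N x + val ?I x) + (val ?J x + val ?B x)"
    using fin(1) unfolding val_def
    by (subst E, subst sum.union_disjoint; (subst sum.union_disjoint)?;
        (subst sum.union_disjoint)?; auto)
  moreover have single: "val {e \<in> E. a \<in> e \<and> b \<notin> e} x = x a * val (link_without E a b) x" for a b
  proof -
    have "{e \<in> E. a \<in> e \<and> b \<notin> e} = insert a ` link_without E a b"
      unfolding link_without_def by (auto simp: image_iff insert_absorb insert_Diff)
    moreover have "finite (link_without E a b)" using fin by (simp add: link_without_def)
    moreover have "finite f \<and> a \<notin> f" if "f \<in> link_without E a b" for f
      using that fin by (auto simp: link_without_def)
    ultimately show ?thesis by (simp add: val_insert_image)
  qed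
  moreover have "val ?B x = x i * x j * val (pair_link E i j) x"
  proof -
    have "?B = insert i ` insert j ` pair_link E i j"
    proof (intro equalityI subsetI)
      fix e assume e: "e \<in> ?B"
      then have "e = insert i (insert j (e - {i, j}))" by blast
      then show "e \<in> insert i ` insert j ` pair_link E i j"
        using e unfolding pair_link_def by blast
    next
      fix e assume "e \<in> insert i ` insert j ` pair_link E i j"
      then obtain e' where "e' \<in> ?B" "e = insert i (insert j (e' - {i, j}))"
        unfolding pair_link_def by blast
      moreover from this have "e = e'" by blast
      ultimately show "e \<in> ?B" by simp
    qed
    moreover have fp: "finite (pair_link E i j)" using fin by (simp add: pair_link_def)
    moreover have pf: "finite f \<and> j \<notin> f \<and> i \<notin> f" if "f \<in> pair_link E i j" for f
      using that fin by (auto simp: pair_link_def)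
    ultimately show ?thesis using ij
      by (subst \<open>?B = _\<close>, subst val_insert_image) (auto simp: val_insert_image)
  qed
  ultimately show ?thesis by (simp add: single)
qed

lemma val_fun_upd_notin: "(\<And>e. e \<in> E \<Longrightarrow> i \<notin> e) \<Longrightarrow> val E (x(i := c)) = val E x"
  by (rule val_cong) auto

lemma val_pair_update:
  assumes fin: "finite E" "\<And>e. e \<in> E \<Longrightarrow> finite e" and ij: "i \<noteq> j"
  shows "val E (x(i := a, j := c)) = val {e \<in> E. i \<notin> e \<and> j \<notin> e} x
           + a * val (link_without E i j) x + c * val (link_without E j i) x
           + a * c * val (pair_link E i j) x"
proof -
  have "val F (x(i := a, j := c)) = val F x" if "\<And>e. e \<in> F \<Longrightarrow> i \<notin> e \<and> j \<notin> e" for F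
    using that by (auto simp: val_fun_upd_notin)
  note upd = this
  have "val {e \<in> E. i \<notin> e \<and> j \<notin> e} (x(i := a, j := c)) = val {e \<in> E. i \<notin> e \<and> j \<notin> e} x"
    "val (link_without E i j) (x(i := a, j := c)) = val (link_without E i j) x"
    "val (link_without E j i) (x(i := a, j := c)) = val (link_without E j i) x"
    "val (pair_link E i j) (x(i := a, j := c)) = val (pair_link E i j) x"
    by (rule upd, force simp: link_without_def pair_link_def)+
  then show ?thesis
    using val_pair_split[OF fin ij, of "x(i := a, j := c)"] ij by simp
qed

text \<open>Exchanging \<open>j\<close> for \<open>i\<close> embeds the edges containing only \<open>j\<close> into those containing only
  \<open>i\<close>.\<close>

lemma shifted_link_mono:
  assumes E: "shifted E" "finite E" "\<And>e. e \<in> E \<Longrightarrow> finite e"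
    and ij: "1 \<le> i" "i < j" and x: "\<And>e v. e \<in> E \<Longrightarrow> v \<in> e \<Longrightarrow> 0 \<le> x v"
  shows "val (link_without E j i) x \<le> val (link_without E i j) x"
proof (rule val_mono)
  show "link_without E j i \<subseteq> link_without E i j"
  proof
    fix f assume "f \<in> link_without E j i"
    then obtain e where e: "e \<in> E" "j \<in> e" "i \<notin> e" "f = e - {j}" by (auto simp: link_without_def)
    then have "insert i (e - {j}) \<in> E" using E(1) ij by (auto simp: shifted_def)
    moreover have "f = insert i (e - {j}) - {i}" using e by auto
    ultimately show "f \<in> link_without E i j" using ij by (auto simp: link_without_def)
  qed
  show "finite (link_without E i j)" using E by (simp add: link_without_def)
  show "0 \<le> x v" if "f \<in> link_without E i j" "v \<in> f" for f v
    using that x by (auto simp: link_without_def)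
qed

lemma val_swap_ge:
  assumes E: "shifted E" "finite E" "\<And>e. e \<in> E \<Longrightarrow> finite e"
    and ij: "1 \<le> i" "i < j" and x: "\<And>e v. e \<in> E \<Longrightarrow> v \<in> e \<Longrightarrow> 0 \<le> x v" and le: "x i \<le> x j"
  shows "val E x \<le> val E (x(i := x j, j := x i))"
proof -
  have "0 \<le> (x j - x i) * (val (link_without E i j) x - val (link_without E j i) x)"
    using shifted_link_mono[OF E ij x] le by simp
  then show ?thesis
    using val_pair_split[OF E(2,3), of i j x] val_pair_update[OF E(2,3), of i j x "x j" "x i"] ij
    by (simp add: algebra_simps)
qed

lemma val_push_down_uncovered:
  assumes E: "shifted E" "finite E" "\<And>e. e \<in> E \<Longrightarrow> finite e"
    and ij: "1 \<le> i" "i < j" and x: "\<And>e v. e \<in> E \<Longrightarrow> v \<in> e \<Longrightarrow> 0 \<le> x v" and "0 \<le> x j"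
    and unc: "\<And>e. e \<in> E \<Longrightarrow> \<not> (i \<in> e \<and> j \<in> e)"
  shows "val E x \<le> val E (x(i := x i + x j, j := 0))"
proof -
  have "pair_link E i j = {}" using unc by (auto simp: pair_link_def)
  then have "val (pair_link E i j) x = 0" by (simp add: val_def)
  moreover have "0 \<le> x j * (val (link_without E i j) x - val (link_without E j i) x)"
    using shifted_link_mono[OF E ij x] \<open>0 \<le> x j\<close> by simp
  ultimately show ?thesis
    using val_pair_split[OF E(2,3), of i j x] val_pair_update[OF E(2,3), of i j x "x i + x j" 0] ij
    by (simp add: algebra_simps)
qed

lemma nsets_finite_edges:
  assumes "E \<subseteq> [{1..t::nat}]\<^bsup>3\<^esup>"
  shows "finite E" "e \<in> E \<Longrightarrow> finite e"
  using assms finite_imp_finite_nsets[of "{1..t}" 3] by (auto intro: finite_subset simp: nsets_def)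

lemma weightings_transfer:
  fixes t :: nat
  assumes x: "x \<in> weightings {1..t}" and ij: "i \<in> {1..t}" "j \<in> {1..t}" "i \<noteq> j"
    and ac: "0 \<le> a" "0 \<le> c" "a + c = x i + x j"
  shows "x(i := a, j := c) \<in> weightings {1..t}"
proof -
  have "(\<Sum>v\<in>{1..t}. (x(i := a, j := c)) v) = 1"
    unfolding sum_upd[OF finite_atLeastAtMost] using assms by (simp add: weightings_def)
  then show ?thesis using assms by (simp add: weightings_def)
qed

text \<open>Among the rearrangements of an optimal weighting that are optimal themselves, one that
  minimises \<open>\<Sum>v. v * x v\<close> has no inversion, since swapping an inversion would lower this sum and,
  by \<open>val_swap_ge\<close>, keep the weighting optimal.\<close>

lemma sorted_optimum:
  assumes E: "E \<subseteq> [{1..t}]\<^bsup>3\<^esup>" "shifted E" and t: "1 \<le> t"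
  obtains x where "x \<in> weightings {1..t}" "val E x = lag t E"
    "\<And>i j. 1 \<le> i \<Longrightarrow> i \<le> j \<Longrightarrow> j \<le> t \<Longrightarrow> x j \<le> x i"
proof -
  obtain x0 where x0: "x0 \<in> weightings {1..t}" "val E x0 = lag t E"
    using lag_attained[OF E(1) t] .
  define P where "P = {p. p permutes {1..t} \<and> x0 \<circ> p \<in> weightings {1..t} \<and> val E (x0 \<circ> p) = lag t E}"
  define h where "h p = (\<Sum>v\<in>{1..t}. real v * x0 (p v))" for p
  have "finite P" unfolding P_def by (rule finite_subset[OF _ finite_permutations[of "{1..t}"]]) auto
  moreover have "id \<in> P" using x0 by (simp add: P_def permutes_id)
  ultimately obtain p where p: "p \<in> P" and pmin: "\<And>q. q \<in> P \<Longrightarrow> h p \<le> h q"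
    using arg_min_if_finite[of P h] by (metis empty_iff not_le_imp_less)
  define x where "x = x0 \<circ> p"
  have x: "x \<in> weightings {1..t}" "val E x = lag t E" using p by (auto simp: P_def x_def)
  have "x j \<le> x i" if ij: "1 \<le> i" "i < j" "j \<le> t" for i j
  proof (rule ccontr)
    assume less: "\<not> x j \<le> x i"
    let ?q = "p \<circ> Transposition.transpose i j" and ?y = "x(i := x j, j := x i)"
    have y: "x0 \<circ> ?q = ?y" by (auto simp: x_def Transposition.transpose_def)
    have yw: "?y \<in> weightings {1..t}"
      using x(1) ij by (intro weightings_transfer) (auto simp: weightings_def)
    have "val E x \<le> val E ?y"
    proof (rule val_swap_ge[OF E(2) nsets_finite_edges[OF E(1)]])
      show "0 \<le> x v" if "e \<in> E" "v \<in> e" for e v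
        using nsets_nonneg[OF x(1)] E(1) that by blast
    qed (use less ij in auto)
    then have "val E ?y = lag t E" using val_le_lag[OF E(1) yw] x(2) by simp
    moreover have "?q permutes {1..t}"
      using p ij by (auto simp: P_def intro!: permutes_compose permutes_swap_id)
    ultimately have "?q \<in> P" using y yw by (simp add: P_def)
    then have "h p \<le> h ?q" by (rule pmin)
    moreover have "h ?q = h p - (real j - real i) * (x j - x i)"
    proof -
      have split: "(\<Sum>v\<in>{1..t}. g v) = g i + (g j + (\<Sum>v\<in>{1..t}-{i}-{j}. g v))" for g :: "nat \<Rightarrow> real"
        using ij sum.remove[of "{1..t}" i g] sum.remove[of "{1..t}-{i}" j g] by simp
      have "(\<Sum>v\<in>{1..t}-{i}-{j}. real v * ?y v) = (\<Sum>v\<in>{1..t}-{i}-{j}. real v * x v)"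
        by (intro sum.cong) auto
      then have "h ?q = real i * x j + (real j * x i + (\<Sum>v\<in>{1..t}-{i}-{j}. real v * x v))"
        using split[of "\<lambda>v. real v * ?y v"] ij
        unfolding h_def y[symmetric] by (simp add: x_def)
      moreover have "h p = real i * x i + (real j * x j + (\<Sum>v\<in>{1..t}-{i}-{j}. real v * x v))"
        using split[of "\<lambda>v. real v * x v"] by (simp add: h_def x_def)
      ultimately show ?thesis by (simp add: algebra_simps)
    qed
    moreover have "0 < (real j - real i) * (x j - x i)" using less ij by simp
    ultimately show False by simp
  qed
  then have "x j \<le> x i" if "1 \<le> i" "i \<le> j" "j \<le> t" for i j
    using that by (cases "i = j") auto
  then show ?thesis using that x by blast
qed

section \<open>Tail graphs\<close>

text \<open>The triples of \<open>{1..n + 2}\<close> that a graph containing \<open>[{1..n}]\<^bsup>3\<^esup>\<close> can lack: those through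
  \<open>n + 1\<close> only, through \<open>n + 2\<close> only, and through both.\<close>

definition tail_missing :: "nat \<Rightarrow> nat set set \<Rightarrow> nat set set \<Rightarrow> nat \<Rightarrow> nat set set" where
  "tail_missing n N M b =
     insert (n + 1) ` N \<union> insert (n + 2) ` M \<union> (\<lambda>j. {j, n + 1, n + 2}) ` {b<..n}"

definition tail :: "nat \<Rightarrow> nat set set \<Rightarrow> nat set set \<Rightarrow> nat \<Rightarrow> nat set set" where
  "tail n N M b = [{1..n + 2}]\<^bsup>3\<^esup> - tail_missing n N M b"

definition up_closed :: "nat \<Rightarrow> nat set set \<Rightarrow> bool" where
  "up_closed n U \<longleftrightarrow> (\<forall>f\<in>U. \<forall>i\<in>f. \<forall>j. i < j \<and> j \<le> n \<and> j \<notin> f \<longrightarrow> insert j (f - {i}) \<in> U)"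

text \<open>These conditions express that the tail graph is shifted. That \<open>M\<close> avoids \<open>{1..b}\<close> holds
  because an edge \<open>{p, n + 1, n + 2}\<close> with \<open>p \<le> b\<close> can be shifted to \<open>{p, q, n + 2}\<close> for every
  other \<open>q \<le> n\<close>.\<close>

definition admissible :: "nat \<Rightarrow> nat set set \<Rightarrow> nat set set \<Rightarrow> nat \<Rightarrow> bool" where
  "admissible n N M b \<longleftrightarrow>
     b \<le> n \<and> N \<subseteq> M \<and> M \<subseteq> [{b<..n}]\<^bsup>2\<^esup> \<and> up_closed n N \<and> up_closed n M"

lemma admissible_pairs:
  assumes "admissible n N M b"
  shows "finite N" "finite M" "N \<subseteq> [{b<..n}]\<^bsup>2\<^esup>" "M \<subseteq> [{b<..n}]\<^bsup>2\<^esup>"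
proof -
  have "finite ([{b<..n}]\<^bsup>2\<^esup>)" by (rule finite_imp_finite_nsets) simp
  then show "finite N" "finite M" "N \<subseteq> [{b<..n}]\<^bsup>2\<^esup>" "M \<subseteq> [{b<..n}]\<^bsup>2\<^esup>"
    using assms by (auto simp: admissible_def intro: finite_subset)
qed

lemma tail_missing_decomposition:
  assumes adm: "admissible n N M b"
  shows "finite (tail_missing n N M b)" "tail_missing n N M b \<subseteq> [{1..n + 2}]\<^bsup>3\<^esup>"
    "(insert (n + 1) ` N \<union> insert (n + 2) ` M) \<inter> (\<lambda>j. {j, n + 1, n + 2}) ` {b<..n} = {}"
    "insert (n + 1) ` N \<inter> insert (n + 2) ` M = {}"
    "inj_on (insert (n + 1)) N" "inj_on (insert (n + 2)) M"
    "inj_on (\<lambda>j. {j, n + 1, n + 2}) {b<..n}"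
    "\<And>f. f \<in> N \<Longrightarrow> finite f \<and> n + 1 \<notin> f" "\<And>f. f \<in> M \<Longrightarrow> finite f \<and> n + 2 \<notin> f"
proof -
  note pairs = admissible_pairs[OF adm]
  have M: "finite f" "f \<subseteq> {b<..n}" "card f = 2" if "f \<in> M" for f
    using that pairs(4) by (auto simp: nsets_def)
  have NM: "N \<subseteq> M" using adm by (simp add: admissible_def)
  have notin: "n + 1 \<notin> f" "n + 2 \<notin> f" if "f \<in> M" for f using M[OF that] by auto
  show "finite (tail_missing n N M b)" using pairs by (simp add: tail_missing_def)
  show "tail_missing n N M b \<subseteq> [{1..n + 2}]\<^bsup>3\<^esup>"
  proof
    fix e assume "e \<in> tail_missing n N M b"
    then consider f a where "f \<in> M" "a = n + 1 \<or> a = n + 2" "e = insert a f"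
      | j where "j \<in> {b<..n}" "e = {j, n + 1, n + 2}"
      using NM by (auto simp: tail_missing_def)
    then show "e \<in> [{1..n + 2}]\<^bsup>3\<^esup>"
    proof cases
      case 1
      then have "a \<notin> f" using notin by blast
      then have "card e = 3" using 1 M by simp
      moreover have "e \<subseteq> {1..n + 2}" using M[OF 1(1)] 1 by fastforce
      ultimately show ?thesis using 1 M by (simp add: nsets_def)
    qed (auto simp: nsets_def)
  qed
  show "(insert (n + 1) ` N \<union> insert (n + 2) ` M) \<inter> (\<lambda>j. {j, n + 1, n + 2}) ` {b<..n} = {}"
    using notin NM by fastforce
  show "insert (n + 1) ` N \<inter> insert (n + 2) ` M = {}"
    using notin NM by (fastforce)
  show "inj_on (insert (n + 1)) N" "inj_on (insert (n + 2)) M"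
    by (rule inj_onI, metis insert_ident notin NM subsetD)+
  show "inj_on (\<lambda>j. {j, n + 1, n + 2}) {b<..n}"
  proof (rule inj_onI)
    fix i j assume ij: "i \<in> {b<..n}" "{i, n + 1, n + 2} = {j, n + 1, n + 2}"
    then have "i \<in> {j, n + 1, n + 2}" by blast
    then show "i = j" using ij(1) by auto
  qed
  show "finite f \<and> n + 1 \<notin> f" if "f \<in> N" for f using that NM M notin by blast
  show "finite f \<and> n + 2 \<notin> f" if "f \<in> M" for f using that M notin by blast
qed

lemma tail_subset: "tail n N M b \<subseteq> [{1..n + 2}]\<^bsup>3\<^esup>"
  by (auto simp: tail_def)

lemma finite_triples: "finite ([{1..t::nat}]\<^bsup>3\<^esup>)"
  by (rule finite_imp_finite_nsets) simp

lemma val_tail: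
  assumes adm: "admissible n N M b"
  shows "val (tail n N M b) x = val ([{1..n + 2}]\<^bsup>3\<^esup>) x - x (n + 1) * val N x - x (n + 2) * val M x
           - x (n + 1) * x (n + 2) * (\<Sum>j\<in>{b<..n}. x j)"
proof -
  note dec = tail_missing_decomposition[OF adm]
  note pairs = admissible_pairs[OF adm]
  have "val (tail n N M b) x = val ([{1..n + 2}]\<^bsup>3\<^esup>) x - val (tail_missing n N M b) x"
    unfolding tail_def val_def using dec(1,2) finite_triples by (intro sum_diff) auto
  moreover have "val (tail_missing n N M b) x
      = val (insert (n + 1) ` N) x + val (insert (n + 2) ` M) x + val ((\<lambda>j. {j, n + 1, n + 2}) ` {b<..n}) x"
    unfolding tail_missing_def val_def using dec(3,4) pairs by (subst sum.union_disjoint, auto)+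
  moreover have "val ((\<lambda>j. {j, n + 1, n + 2}) ` {b<..n}) x = x (n + 1) * x (n + 2) * (\<Sum>j\<in>{b<..n}. x j)"
    unfolding val_def using dec(7)
    by (subst sum.reindex) (auto simp: sum_distrib_left mult_ac intro!: sum.cong)
  ultimately show ?thesis
    using val_insert_image[OF pairs(1) dec(8), of x] val_insert_image[OF pairs(2) dec(9), of x] by simp
qed

lemma card_tail:
  assumes adm: "admissible n N M b"
  shows "card (tail n N M b) + card N + card M + (n - b) = (n + 2) choose 3"
proof -
  note dec = tail_missing_decomposition[OF adm]
  note pairs = admissible_pairs[OF adm]
  have "card (tail_missing n N M b) = card N + card M + (n - b)"
    unfolding tail_missing_def using dec(3-7) pairs
    by (simp add: card_Un_disjoint card_image)
  moreover have "card (tail n N M b) = card ([{1..n + 2}]\<^bsup>3\<^esup>) - card (tail_missing n N M b)"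
    unfolding tail_def using dec by (simp add: card_Diff_subset)
  moreover have "card (tail_missing n N M b) \<le> card ([{1..n + 2}]\<^bsup>3\<^esup>)"
    using dec finite_triples by (intro card_mono) auto
  moreover have "card ([{1..n + 2}]\<^bsup>3\<^esup>) = (n + 2) choose 3"
    by (simp add: card_nsets)
  ultimately show ?thesis by linarith
qed

lemma shifted_tail:
  assumes adm: "admissible n N M b"
  shows "shifted (tail n N M b)"
  unfolding shifted_def
proof (intro ballI allI impI, elim conjE)
  fix e i j assume e: "e \<in> tail n N M b" and j: "j \<in> e" and i: "1 \<le> i" "i < j" "i \<notin> e"
  let ?f = "insert i (e - {j})"
  note pairs = admissible_pairs[OF adm]
  have e3: "e \<subseteq> {1..n + 2}" "finite e" "card e = 3" using e by (auto simp: tail_def nsets_def)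
  have jn: "j \<le> n + 2" using e3 j by auto
  have "?f \<subseteq> {1..n + 2}" using e3 i jn by auto
  moreover have "card ?f = 3" using e3 i j by (simp add: card_insert_if)
  ultimately have f: "?f \<in> [{1..n + 2}]\<^bsup>3\<^esup>" using e3 by (simp add: nsets_def)
  have undo: "insert j (?f - {i}) = e" using i j by auto
  have ij: "i \<in> ?f" "j \<notin> ?f" using i by auto
  have "?f \<notin> tail_missing n N M b"
  proof
    assume "?f \<in> tail_missing n N M b"
    moreover have "insert j (g - {i}) \<in> tail_missing n N M b"
      if g: "g \<in> tail_missing n N M b" "i \<in> g" "j \<notin> g" for g
    proof -
      have up: "insert j (f - {i}) \<in> U" if "U = N \<or> U = M" "f \<in> U" "i \<in> f" "j \<le> n" "j \<notin> f" for f U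
        using that adm i by (auto simp: admissible_def up_closed_def)
      have pair: "\<exists>p\<in>{b<..n}. f - {i} = {p}" if "f \<in> M" "i \<in> f" for f
      proof -
        have "card (f - {i}) = 1" "f - {i} \<subseteq> {b<..n}" using that pairs(4) by (auto simp: nsets_def)
        then show ?thesis by (metis card_1_singletonE insert_subset)
      qed
      have row: "{p, n + 1, n + 2} \<in> tail_missing n N M b" if "p \<in> {b<..n}" for p
        using that by (auto simp: tail_missing_def)
      have NM: "N \<subseteq> M" using adm by (simp add: admissible_def)
      have bd: "i \<le> n" "i > b" if "f \<in> M" "i \<in> f" for f
        using subsetD[OF pairs(4) that(1)] that(2) by (auto simp: nsets_def)
      from g(1) consider f where "f \<in> N" "g = insert (n + 1) f" | f where "f \<in> M" "g = insert (n + 2) f"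
        | l where "l \<in> {b<..n}" "g = {l, n + 1, n + 2}" by (auto simp: tail_missing_def)
      then show ?thesis
      proof cases
        case 1
        show ?thesis
        proof (cases "i = n + 1")
          case True
          then have "j = n + 2" "i \<notin> f" using jn i 1 NM bd by fastforce+
          then have "insert j (g - {i}) = insert (n + 2) f" using 1 True by auto
          then show ?thesis using 1 NM by (auto simp: tail_missing_def)
        next
          case False
          then have fi: "i \<in> f" "j \<notin> f" "f \<in> M" using g 1 NM by auto
          show ?thesis
          proof (cases "j \<le> n")
            case True
            then have "insert j (f - {i}) \<in> N" using up 1 fi by blast
            moreover have "insert j (g - {i}) = insert (n + 1) (insert j (f - {i}))" using 1 False by auto
            ultimately show ?thesis by (auto simp: tail_missing_def)
          next
            case gt: False
            then have "j = n + 2" using jn g 1 by auto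
            moreover obtain p where "p \<in> {b<..n}" "f - {i} = {p}" using pair fi by blast
            moreover have "insert j (g - {i}) = insert j (insert (n + 1) (f - {i}))" using 1 False by auto
            ultimately show ?thesis using row[of p] by (simp add: insert_commute)
          qed
        qed
      next
        case 2
        then have "i \<noteq> n + 2" using i jn by auto
        then have fi: "i \<in> f" "j \<notin> f" using g 2 by auto
        have eq: "insert j (g - {i}) = insert (n + 2) (insert j (f - {i}))" using 2 \<open>i \<noteq> n + 2\<close> by auto
        show ?thesis
        proof (cases "j \<le> n")
          case True
          then have "insert j (f - {i}) \<in> M" using up 2 fi by blast
          then show ?thesis unfolding eq by (auto simp: tail_missing_def)
        next
          case gt: False
          then have "j = n + 1" using jn g 2 by (cases "j = n + 2") auto
          moreover obtain p where "p \<in> {b<..n}" "f - {i} = {p}" using pair fi 2 by blast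
          ultimately show ?thesis unfolding eq using row[of p] by (simp add: insert_commute)
        qed
      next
        case 3
        then have "i = l" using g i jn by auto
        then have "insert j (g - {i}) = {j, n + 1, n + 2}" using 3 by auto
        moreover have "j \<in> {b<..n}" using 3 g jn i \<open>i = l\<close> by auto
        ultimately show ?thesis using row by simp
      qed
    qed
    ultimately have "e \<in> tail_missing n N M b" using ij undo by metis
    then show False using e by (simp add: tail_def)
  qed
  then show "?f \<in> tail n N M b" using f by (simp add: tail_def)
qed

lemma admissible_empty: "b \<le> n \<Longrightarrow> admissible n {} {} b"
  by (simp add: admissible_def up_closed_def)

lemma triples_subset_tail: "[{1..n + 1}]\<^bsup>3\<^esup> \<subseteq> tail n {} {} b"
proof
  fix e assume "e \<in> [{1..n + 1}]\<^bsup>3\<^esup>"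
  then have "n + 2 \<notin> e" "e \<in> [{1..n + 2}]\<^bsup>3\<^esup>" by (force simp: nsets_def)+
  then show "e \<in> tail n {} {} b" by (auto simp: tail_def tail_missing_def)
qed

section \<open>Optimal weightings of tail graphs\<close>

lemma first_order_condition:
  fixes \<alpha> \<beta> \<epsilon> :: real
  assumes "0 < \<epsilon>" and le: "\<And>\<delta>. \<bar>\<delta>\<bar> \<le> \<epsilon> \<Longrightarrow> \<alpha> * \<delta> + \<beta> * \<delta>\<^sup>2 \<le> 0"
  shows "\<alpha> = 0"
proof (rule ccontr)
  assume \<alpha>: "\<alpha> \<noteq> 0"
  \<comment> \<open>Small enough for the linear term to dominate.\<close>
  define r where "r = min \<epsilon> (\<bar>\<alpha>\<bar> / (2 * (\<bar>\<beta>\<bar> + 1)))"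
  have r: "0 < r" "r \<le> \<epsilon>" using assms(1) \<alpha> by (auto simp: r_def)
  have "r * (2 * (\<bar>\<beta>\<bar> + 1)) \<le> \<bar>\<alpha>\<bar>"
    using pos_le_divide_eq[of "2 * (\<bar>\<beta>\<bar> + 1)" r "\<bar>\<alpha>\<bar>"] by (simp add: r_def)
  moreover have "0 \<le> r * \<bar>\<beta>\<bar>" using r by simp
  ultimately have "\<bar>\<beta>\<bar> * r < \<bar>\<alpha>\<bar>" using r by (simp add: algebra_simps)
  then have "(\<bar>\<beta>\<bar> * r) * r < \<bar>\<alpha>\<bar> * r" using r by (intro mult_strict_right_mono) auto
  moreover have "- (\<bar>\<beta>\<bar> * r * r) \<le> \<beta> * r\<^sup>2"
    using r by (simp add: power2_eq_square abs_if)
  moreover have "\<alpha> * (sgn \<alpha> * r) + \<beta> * (sgn \<alpha> * r)\<^sup>2 \<le> 0"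
    using r \<alpha> by (intro le) (simp add: abs_mult)
  ultimately show False using \<alpha> by (simp add: power_mult_distrib sgn_if split: if_splits)
qed

text \<open>The last assumption is available in every comparison with an initial colex segment
  containing the clique on \<open>{1..n + 1}\<close>, since otherwise the comparison is immediate.\<close>

locale tail_optimum =
  fixes n N M b x
  assumes adm: "admissible n N M b" and n: "1 \<le> n"
    and wt: "x \<in> weightings {1..n + 2}"
    and opt: "val (tail n N M b) x = lag (n + 2) (tail n N M b)"
    and dec: "\<And>i j. 1 \<le> i \<Longrightarrow> i \<le> j \<Longrightarrow> j \<le> n + 2 \<Longrightarrow> x j \<le> x i"
    and beats: "lag (n + 2) ([{1..n + 1}]\<^bsup>3\<^esup>) < lag (n + 2) (tail n N M b)"
begin

abbreviation "head_weight \<equiv> \<Sum>j\<in>{1..b}. x j"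
abbreviation "mid_weight \<equiv> \<Sum>j\<in>{b<..n}. x j"

lemma b_le: "b \<le> n" using adm by (simp add: admissible_def)

lemma val_le_opt: "y \<in> weightings {1..n + 2} \<Longrightarrow> val (tail n N M b) y \<le> val (tail n N M b) x"
  unfolding opt by (rule val_le_lag[OF tail_subset])

lemma sum_all: "(\<Sum>v\<in>{1..n + 2}. x v) = 1" and nonneg: "v \<in> {1..n + 2} \<Longrightarrow> 0 \<le> x v"
  using wt by (auto simp: weightings_def)

lemma sum_split: "(\<Sum>v\<in>{1..n + 2}. x v) = head_weight + mid_weight + x (n + 1) + x (n + 2)"
proof -
  have "{1..n + 2} = ({1..b} \<union> {b<..n}) \<union> {n + 1, n + 2}" using b_le by auto
  moreover have "(\<Sum>v\<in>({1..b} \<union> {b<..n}) \<union> {n + 1, n + 2}. x v)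
      = (\<Sum>v\<in>{1..b} \<union> {b<..n}. x v) + (\<Sum>v\<in>{n + 1, n + 2}. x v)"
    using b_le by (intro sum.union_disjoint) auto
  moreover have "(\<Sum>v\<in>{1..b} \<union> {b<..n}. x v) = head_weight + mid_weight"
    by (intro sum.union_disjoint) auto
  ultimately show ?thesis by simp
qed

lemma pair_bounds: "f \<in> M \<Longrightarrow> finite f \<and> card f = 2 \<and> f \<subseteq> {b<..n}"
  using admissible_pairs[OF adm] by (auto simp: nsets_def)

lemma N_subset_M: "N \<subseteq> M" using adm by (simp add: admissible_def)

lemma val_N_nonneg: "0 \<le> val N x" and val_M_nonneg: "0 \<le> val M x"
proof -
  have "0 \<le> (\<Prod>v\<in>f. x v)" if "f \<in> M" for f
  proof (rule prod_nonneg)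
    fix v assume "v \<in> f"
    then have "v \<in> {b<..n}" using pair_bounds[OF that] by blast
    then show "0 \<le> x v" by (intro nonneg) auto
  qed
  then show "0 \<le> val N x" "0 \<le> val M x"
    using N_subset_M unfolding val_def by (auto intro!: sum_nonneg)
qed

text \<open>Move the weight of the last vertex to its predecessor. What remains is a weighting of the
  clique on \<open>{1..n + 1}\<close>, which by \<open>beats\<close> has a smaller value.\<close>

lemma shift_gain: "x (n + 1) * val N x + x (n + 2) * val M x < x (n + 1) * x (n + 2) * head_weight"
proof -
  let ?y = "x(n + 1 := x (n + 1) + x (n + 2), n + 2 := x (n + 2) - x (n + 2))"
  have yw: "?y \<in> weightings {1..n + 2}"
    using nonneg by (intro weightings_transfer[OF wt]) auto
  have top: "{1..n + 2} = insert (n + 2) {1..n + 1}" by auto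
  have "val ([{1..n + 2}]\<^bsup>3\<^esup>) ?y = val ([{1..n + 1}]\<^bsup>3\<^esup>) ?y"
    unfolding top using val_nsets_insert[of "{1..n + 1}" "n + 2" 2 ?y] by (simp add: eval_nat_numeral)
  also have "\<dots> \<le> lag (n + 2) ([{1..n + 1}]\<^bsup>3\<^esup>)"
    using yw by (intro val_le_lag nsets_mono) auto
  also have "\<dots> < val (tail n N M b) x" using beats opt by simp
  finally show ?thesis
    using val_triples_transfer[of "{1..n + 2}" "n + 1" "n + 2" x "x (n + 2)", unfolded sum_split]
    by (simp add: val_tail[OF adm] algebra_simps)
qed

lemma last_pos: "0 < x (n + 2)"
proof (rule ccontr)
  assume "\<not> 0 < x (n + 2)"
  then have "x (n + 2) = 0" using nonneg[of "n + 2"] by simp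
  moreover have "0 \<le> x (n + 1) * val N x" using nonneg[of "n + 1"] val_N_nonneg by simp
  ultimately show False using shift_gain by simp
qed

lemma pos: "v \<in> {1..n + 2} \<Longrightarrow> 0 < x v"
  using dec[of v "n + 2"] last_pos by simp

text \<open>For \<open>b = 0\<close> no edge contains both of the last two vertices, and \<open>shift_gain\<close> would read
  \<open>\<dots> < 0\<close>.\<close>

lemma b_ge: "1 \<le> b"
proof (rule ccontr)
  assume "\<not> 1 \<le> b"
  then have "head_weight = 0" by simp
  moreover have "0 \<le> x (n + 1) * val N x + x (n + 2) * val M x"
    using nonneg val_N_nonneg val_M_nonneg by (intro add_nonneg_nonneg mult_nonneg_nonneg) auto
  ultimately show False using shift_gain by simp
qed

lemma stationary:
  assumes ij: "i \<in> {1..n + 2}" "j \<in> {1..n + 2}" "i \<noteq> j"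
    and quad: "\<And>\<delta>. val (tail n N M b) (x(i := x i + \<delta>, j := x j - \<delta>))
                 = val (tail n N M b) x + \<alpha> * \<delta> + \<beta> * \<delta>\<^sup>2"
  shows "\<alpha> = 0"
proof (rule first_order_condition)
  show "0 < min (x i) (x j)" using ij pos by simp
  fix \<delta> assume "\<bar>\<delta>\<bar> \<le> min (x i) (x j)"
  then have "x(i := x i + \<delta>, j := x j - \<delta>) \<in> weightings {1..n + 2}"
    using ij by (intro weightings_transfer[OF wt]) auto
  then show "\<alpha> * \<delta> + \<beta> * \<delta>\<^sup>2 \<le> 0" using val_le_opt quad[of \<delta>] by fastforce
qed

lemma val_pairs_upd:
  assumes "i \<notin> {b<..n}"
  shows "val M (y(i := a)) = val M y" "val N (y(i := a)) = val N y"
  by (rule val_fun_upd_notin, use pair_bounds N_subset_M assms in blast)+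

text \<open>The pairs of \<open>M - N\<close> are those in the link of \<open>n + 1\<close> but not in the link of \<open>n + 2\<close>.\<close>

lemma last_two_stationary: "val M x - val N x = (x (n + 1) - x (n + 2)) * head_weight"
proof -
  have "(x (n + 2) - x (n + 1)) * head_weight - val N x + val M x = 0"
  proof (rule stationary[of "n + 1" "n + 2" _ "- head_weight"])
    fix \<delta>
    show "val (tail n N M b) (x(n + 1 := x (n + 1) + \<delta>, n + 2 := x (n + 2) - \<delta>))
      = val (tail n N M b) x + ((x (n + 2) - x (n + 1)) * head_weight - val N x + val M x) * \<delta> + - head_weight * \<delta>\<^sup>2"
      using val_triples_transfer[of "{1..n + 2}" "n + 1" "n + 2" x \<delta>, unfolded sum_split]
      by (simp add: val_tail[OF adm] val_pairs_upd sum_upd algebra_simps power2_eq_square)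
  qed auto
  then show ?thesis by (simp add: algebra_simps)
qed

text \<open>The right-hand side is the weight of the pairs in the link of \<open>1\<close> but not in the link of
  \<open>n + 1\<close>; conversely, the link of \<open>1\<close> lacks nothing, since \<open>b \<ge> 1\<close>.\<close>

lemma first_stationary:
  "(x 1 - x (n + 1)) * (1 - x 1 - x (n + 1)) = val N x + x (n + 2) * mid_weight"
proof -
  have 1: "1 \<notin> {b<..n}" using b_ge by auto
  have "(x (n + 1) - x 1) * (1 - x 1 - x (n + 1)) + val N x + x (n + 2) * mid_weight = 0"
  proof (rule stationary[of 1 "n + 1" _ "- (1 - x 1 - x (n + 1))"])
    fix \<delta>
    show "val (tail n N M b) (x(1 := x 1 + \<delta>, n + 1 := x (n + 1) - \<delta>))
      = val (tail n N M b) x + ((x (n + 1) - x 1) * (1 - x 1 - x (n + 1)) + val N x + x (n + 2) * mid_weight) * \<delta>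
        + - (1 - x 1 - x (n + 1)) * \<delta>\<^sup>2"
      using val_triples_transfer[of "{1..n + 2}" 1 "n + 1" x \<delta>] 1 n
      unfolding val_tail[OF adm] sum_all val_pairs_upd[OF 1]
      by (simp add: val_pairs_upd sum_upd algebra_simps power2_eq_square)
  qed (use n in auto)
  then show ?thesis by (simp add: algebra_simps)
qed

text \<open>The condition for the last two vertices eliminates \<open>M\<close> from \<open>shift_gain\<close>.\<close>

lemma val_N_small: "(x (n + 1) + x (n + 2)) * val N x < x (n + 2) ^ 2 * head_weight"
proof -
  have M: "val M x = val N x + (x (n + 1) - x (n + 2)) * head_weight" using last_two_stationary by simp
  show ?thesis using shift_gain unfolding M by (simp add: algebra_simps power2_eq_square)
qed

text \<open>The first order condition for \<open>1\<close> and \<open>n + 1\<close> expresses \<open>u = x 1 - x (n + 1) - x (n + 2)\<close>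
  through \<open>N\<close>, and \<open>val_N_small\<close> bounds \<open>N\<close>. The result is an inequality \<open>u * r < 0\<close> with
  \<open>r > 0\<close>.\<close>

lemma first_lt_last_two: "x 1 < x (n + 1) + x (n + 2)"
proof -
  let ?w = "x (n + 1)" and ?z = "x (n + 2)"
  define u where "u = x 1 - ?w - ?z"
  define D where "D = 1 - x 1 - ?w"
  have c1: "head_weight = x 1 + (\<Sum>j\<in>{1<..b}. x j)"
    using b_ge by (simp add: sum.head)
  have c0: "0 \<le> head_weight - x 1" unfolding c1 using b_le by (auto intro!: sum_nonneg nonneg)
  have r0: "0 \<le> mid_weight" by (auto intro!: sum_nonneg nonneg)
  have D: "D = (head_weight - x 1) + mid_weight + ?z" using sum_split sum_all by (simp add: D_def)
  have w: "0 < ?w" and z: "0 < ?z" using pos by auto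
  have "(u + ?z) * D = val N x + ?z * mid_weight" using first_stationary by (simp add: u_def D_def)
  then have "u * D = val N x - ?z * (head_weight - x 1) - ?z^2"
    unfolding D by (simp add: algebra_simps power2_eq_square)
  then have "u * D * (?w + ?z) = (val N x - ?z * (head_weight - x 1) - ?z^2) * (?w + ?z)" by simp
  also have "\<dots> = (?w + ?z) * val N x - (?w + ?z) * (?z * (head_weight - x 1) + ?z^2)"
    by (simp add: algebra_simps)
  also have "\<dots> < ?z^2 * head_weight - (?w + ?z) * (?z * (head_weight - x 1) + ?z^2)" using val_N_small by simp
  also have "\<dots> = ?z^2 * u - ?z * ?w * (head_weight - x 1)"
    by (simp add: u_def algebra_simps power2_eq_square)
  also have "\<dots> \<le> ?z^2 * u" using w z c0 by simp
  finally have "u * (D * (?w + ?z) - ?z^2) < 0" by (simp add: algebra_simps)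
  moreover have "?z^2 < D * (?w + ?z)"
  proof -
    have "?z * ?z < ?z * (?w + ?z)" using w z by simp
    also have "\<dots> \<le> D * (?w + ?z)" using D c0 r0 w z by (intro mult_right_mono) auto
    finally show ?thesis by (simp add: power2_eq_square)
  qed
  ultimately have "u < 0" by (simp add: mult_less_0_iff)
  then show ?thesis by (simp add: u_def)
qed

text \<open>Every pair in \<open>M\<close> contributes at least \<open>x (n + 1)\<^sup>2\<close> to \<open>val M x\<close>, while the first order
  condition and \<open>val_N_small\<close> bound \<open>val M x\<close> by less than \<open>b * x (n + 1)\<^sup>2\<close>; this uses that
  each of the first \<open>b\<close> weights is below \<open>x (n + 1) + x (n + 2)\<close>.\<close>

lemma card_M_less: "card M < b"
proof -
  let ?w = "x (n + 1)" and ?z = "x (n + 2)"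
  have w: "0 < ?w" and z: "0 < ?z" using pos by auto
  have "?w^2 \<le> (\<Prod>v\<in>f. x v)" if "f \<in> M" for f
  proof -
    have "(\<Prod>v\<in>f. ?w) \<le> (\<Prod>v\<in>f. x v)"
    proof (rule prod_mono)
      fix v assume "v \<in> f"
      then have "v \<in> {b<..n}" using pair_bounds[OF that] by blast
      then show "0 \<le> ?w \<and> ?w \<le> x v" using w dec[of v "n + 1"] by auto
    qed
    then show ?thesis using pair_bounds[OF that] by simp
  qed
  then have "card M * ?w^2 \<le> val M x"
    unfolding val_def using sum_bounded_below[of M "?w^2" "\<lambda>f. \<Prod>v\<in>f. x v"] by simp
  then have "card M * ?w^2 * (?w + ?z) \<le> val M x * (?w + ?z)"
    using w z by (intro mult_right_mono) auto
  also have "\<dots> = (?w + ?z) * val N x + (?w^2 - ?z^2) * head_weight"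
  proof -
    have M: "val M x = val N x + (?w - ?z) * head_weight" using last_two_stationary by simp
    show ?thesis unfolding M by (simp add: algebra_simps power2_eq_square)
  qed
  also have "\<dots> < ?w^2 * head_weight" using val_N_small by (simp add: algebra_simps)
  also have "\<dots> \<le> ?w^2 * (b * x 1)"
    using sum_bounded_above[of "{1..b}" x "x 1"] dec[of 1] b_le by (intro mult_left_mono) auto
  also have "\<dots> \<le> ?w^2 * (b * (?w + ?z))"
    using first_lt_last_two by (intro mult_left_mono) auto
  finally have "(?w^2 * (?w + ?z)) * card M < (?w^2 * (?w + ?z)) * b" by (simp add: mult_ac)
  then show ?thesis using w z by (simp add: mult_less_cancel_left)
qed

end

lemma tail_optimum_exists:
  assumes "admissible n N M b" "1 \<le> n"
    and "lag (n + 2) ([{1..n + 1}]\<^bsup>3\<^esup>) < lag (n + 2) (tail n N M b)"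
  obtains x where "tail_optimum n N M b x"
proof -
  obtain x where "x \<in> weightings {1..n + 2}" "val (tail n N M b) x = lag (n + 2) (tail n N M b)"
    "\<And>i j. 1 \<le> i \<Longrightarrow> i \<le> j \<Longrightarrow> j \<le> n + 2 \<Longrightarrow> x j \<le> x i"
    using sorted_optimum[OF tail_subset shifted_tail[OF assms(1)]] by auto
  then have "tail_optimum n N M b x" using assms by (intro tail_optimum.intro) auto
  then show ?thesis by (rule that)
qed

section \<open>Inequalities for a few weights\<close>

text \<open>The link of the last vertex, whose weight is \<open>z\<close>, induces on four vertices of weights
  \<open>p, y1, y2, w\<close> the claw with centre \<open>p\<close>. It is to be turned into the triangle avoiding the
  vertex of weight \<open>w\<close>. If \<open>p * w \<le> y1 * y2\<close> the weights stay; otherwise they are reflected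
  about their mean \<open>s / 2\<close> and the result is assigned in reverse order. The last conclusion says
  that the change in the sum over all triples makes up for the change in the missing pairs; the
  conclusions before it control how other vertices, adjacent to some of the four only, are
  affected.\<close>

lemma claw_to_triangle_weights:
  fixes p y1 y2 w z :: real
  assumes "w \<le> y2" "y2 \<le> y1" "y1 \<le> p" "0 \<le> w" "0 \<le> z" "p - w \<le> z" "p \<le> y1 + y2"
  obtains p' y1' y2' w' where "0 \<le> p'" "0 \<le> y1'" "0 \<le> y2'" "0 \<le> w'"
    "p' + y1' + y2' + w' = p + y1 + y2 + w"
    "p'^2 + y1'^2 + y2'^2 + w'^2 = p^2 + y1^2 + y2^2 + w^2"
    "w' \<le> w" "y2' + w' \<le> y2 + w" "y2' * w' \<le> y2 * w"
    "z * (w' * (p' + y1' + y2') - (y1 * y2 + y1 * w + y2 * w))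
       \<le> (p'^3 + y1'^3 + y2'^3 + w'^3 - (p^3 + y1^3 + y2^3 + w^3)) / 3"
proof (cases "p * w \<le> y1 * y2")
  case True
  then have "z * (p * w - y1 * y2) \<le> 0" using assms by (simp add: mult_nonneg_nonpos)
  then show ?thesis using assms by (intro that[of p y1 y2 w]) (auto simp: algebra_simps)
next
  case False
  \<comment> \<open>Twice the mean, so that \<open>s - _\<close> is the reflection.\<close>
  define s where "s = (p + y1 + y2 + w) / 2"
  have "0 \<le> (p - y1) * (p - y2)" using assms by simp
  then have "p * (y1 + y2) \<le> p * p + y1 * y2" by (simp add: algebra_simps)
  also have "\<dots> \<le> p * (p + w)" using False by (simp add: algebra_simps)
  finally have pw: "y1 + y2 \<le> p + w"
    using False assms by (smt (verit) mult_le_cancel_left mult_nonneg_nonneg mult_zero_left)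
  define a e q where "a = p - w" and "e = y1 - y2" and "q = p + w - y1 - y2"
  have q: "0 \<le> q" using pw by (simp add: q_def)
  have e: "0 \<le> e" "e \<le> a" "e \<le> 2 * p - y1 - y2" "0 \<le> a" "a \<le> z" using assms by (auto simp: e_def a_def)
  have gain: "a * q \<le> 4 * (y1 * y2 + y1 * w + y2 * w - (s - p) * (s + p))"
  proof -
    have "4 * (y1 * y2 + y1 * w + y2 * w - (s - p) * (s + p)) = a * q + (a * (2 * p - y1 - y2) - e * e)"
      by (simp add: s_def a_def q_def e_def field_simps power2_eq_square)
    moreover have "e * e \<le> a * (2 * p - y1 - y2)" using e by (intro mult_mono) auto
    ultimately show ?thesis by simp
  qed
  \<comment> \<open>For four deviations with sum 0, the sum of cubes is a product of three pairwise sums.\<close>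
  have loss: "((s - w)^3 + (s - y2)^3 + (s - y1)^3 + (s - p)^3 - (p^3 + y1^3 + y2^3 + w^3)) / 3
      = - (q * (a * a - e * e)) / 4"
    by (simp add: s_def a_def q_def e_def field_simps power3_eq_cube)
  have "q * (a * a - e * e) \<le> q * (z * a)"
    using q e by (intro mult_left_mono) (auto intro: order_trans[OF _ mult_right_mono[of a z a]])
  also have "\<dots> = z * (a * q)" by simp
  also have "\<dots> \<le> z * (4 * (y1 * y2 + y1 * w + y2 * w - (s - p) * (s + p)))"
    using gain assms by (intro mult_left_mono) auto
  finally have net: "z * ((s - p) * (s + p) - (y1 * y2 + y1 * w + y2 * w)) \<le> - (q * (a * a - e * e)) / 4"
    by (simp add: algebra_simps)
  have prod: "(s - y1) * (s - p) \<le> y2 * w"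
  proof -
    have "4 * (y2 * w - (s - y1) * (s - p)) = q * (p + y2 - y1 - w)"
      by (simp add: s_def q_def field_simps)
    moreover have "0 \<le> q * (p + y2 - y1 - w)" using q assms by simp
    ultimately have "0 \<le> 4 * (y2 * w - (s - y1) * (s - p))" by simp
    then show ?thesis by simp
  qed
  have "2 * s = p + y1 + y2 + w" by (simp add: s_def)
  then have s3: "s - w + (s - y2) + (s - y1) = s + p" by linarith
  show ?thesis
  proof (rule that[of "s - w" "s - y2" "s - y1" "s - p"])
    show "z * ((s - p) * (s - w + (s - y2) + (s - y1)) - (y1 * y2 + y1 * w + y2 * w))
      \<le> ((s - w)^3 + (s - y2)^3 + (s - y1)^3 + (s - p)^3 - (p^3 + y1^3 + y2^3 + w^3)) / 3"
      unfolding loss s3 by (rule net)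
    show "(s - y1) * (s - p) \<le> y2 * w" by (rule prod)
    show "(s - w)\<^sup>2 + (s - y2)\<^sup>2 + (s - y1)\<^sup>2 + (s - p)\<^sup>2 = p\<^sup>2 + y1\<^sup>2 + y2\<^sup>2 + w\<^sup>2"
      by (simp add: s_def field_simps power2_eq_square)
  qed (use assms pw in \<open>auto simp: s_def field_simps\<close>)
qed

text \<open>On six vertices of weights \<open>p, p, y, y, z, z\<close>, the four missing triples among the last
  four vertices are traded for the four triples containing the last two. As in the previous
  lemma the weights are reflected about their mean, here \<open>s / 2\<close>. The two sides of the final
  inequality agree to first order in the deviations from the mean. The second order part of
  their difference is nonnegative and dominates the third order part because \<open>p \<le> 2 * z\<close>.\<close>

lemma clique_to_star_weights:
  fixes p y z :: real
  assumes "z \<le> y" "y \<le> p" "0 \<le> z" "p \<le> 2 * z" "y * y \<le> z * p"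
  defines "s \<equiv> 2 * (p + y + z) / 3"
  shows "0 \<le> s - p" "s - p \<le> z" "0 \<le> s - y" "0 \<le> s - z"
    "2 * (s - z)^2 + 2 * (s - y)^2 + 2 * (s - p)^2 = 2 * p^2 + 2 * y^2 + 2 * z^2"
    "(s - p)^2 * (2 * (s - z) + 2 * (s - y)) - (2 * y^2 * z + 2 * z^2 * y)
       \<le> (2 * (s - z)^3 + 2 * (s - y)^3 + 2 * (s - p)^3 - (2 * p^3 + 2 * y^3 + 2 * z^3)) / 3"
proof -
  have y: "2 * y \<le> z + p"
  proof -
    have "(2 * y)^2 \<le> 4 * (z * p)" using assms by (simp add: power2_eq_square)
    also have "\<dots> \<le> (z + p)^2" using sum_squares_ge_zero[of "z - p" 0] by (simp add: power2_eq_square algebra_simps)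
    finally show ?thesis using assms by (intro power2_le_imp_le[of "2 * y"]) auto
  qed
  show "0 \<le> s - p" "s - p \<le> z" "0 \<le> s - y" "0 \<le> s - z"
    using assms y by (auto simp: s_def field_simps)
  show "2 * (s - z)^2 + 2 * (s - y)^2 + 2 * (s - p)^2 = 2 * p^2 + 2 * y^2 + 2 * z^2"
    by (simp add: s_def field_simps power2_eq_square)
  \<comment> \<open>Deviations from the mean; the claim is homogeneous of degree three in them and \<open>m\<close>.\<close>
  define m where "m = (p + y + z) / 3"
  define d where "d = p - m"
  define f where "f = y - m"
  define g where "g = z - m"
  have g: "g = - d - f" by (simp add: d_def f_def g_def m_def field_simps)
  have sgn: "0 \<le> d" "f \<le> 0" "g \<le> 0" "3 * d \<le> 2 * m"
    using assms y by (auto simp: d_def f_def g_def m_def field_simps)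
  have P: "0 \<le> f * g" using sgn by (simp add: mult_nonpos_nonpos)
  have "0 \<le> f * g * (2 * m - 3 * d)" "0 \<le> d^2 * (m - d)"
    using sgn P by auto
  then have net: "0 \<le> 2 * ((2 * (f * g) + d^2) * m - 3 * (f * g) * d - d^3)"
    by (simp add: algebra_simps power2_eq_square power3_eq_cube)
  have "p = m + d" "y = m + f" "z = m + g" "s = 2 * m" by (auto simp: d_def f_def g_def m_def s_def)
  note sub = this
  have "(2 * (s - z)^3 + 2 * (s - y)^3 + 2 * (s - p)^3 - (2 * p^3 + 2 * y^3 + 2 * z^3)) / 3
      - ((s - p)^2 * (2 * (s - z) + 2 * (s - y)) - (2 * y^2 * z + 2 * z^2 * y))
     = 2 * ((2 * (f * g) + d^2) * m - 3 * (f * g) * d - d^3)"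
    unfolding sub g by (simp add: field_simps power2_eq_square power3_eq_cube)
  then show "(s - p)^2 * (2 * (s - z) + 2 * (s - y)) - (2 * y^2 * z + 2 * z^2 * y)
       \<le> (2 * (s - z)^3 + 2 * (s - y)^3 + 2 * (s - p)^3 - (2 * p^3 + 2 * y^3 + 2 * z^3)) / 3"
    using net by linarith
qed

text \<open>Here the link of the last vertex misses a complete graph on four vertices of equal weight
  \<open>y\<close>, and it shall miss a star with six edges instead; three vertices of weight \<open>X = y + d\<close>
  take part. To leading order, optimal weights fall below a common value in proportion to the
  number of missing triples through a vertex. For the star this leads to \<open>y + 2 * d / 3\<close> for the
  six leaves and \<open>y - d\<close> for the centre. The equation is the first order condition between \<open>X\<close>
  and \<open>y\<close>.\<close>

lemma link_clique_to_star_weights: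
  fixes X y z :: real
  defines "d \<equiv> X - y"
  assumes d0: "0 \<le> d" and dz: "d \<le> z" and "0 \<le> y" and eq: "d * (1 - X - y) = 3 * y * z"
  shows "z * ((y - d) * (6 * (y + 2 * d / 3)) - 6 * y^2)
    \<le> (6 * (y + 2 * d / 3)^3 + (y - d)^3 - (3 * X^3 + 4 * y^3)) / 3
      - (6 * (y + 2 * d / 3)^2 + (y - d)^2 - (3 * X^2 + 4 * y^2)) / 2"
proof -
  have X: "X = y + d" by (simp add: d_def)
  let ?gain = "2 / 3 * y * d^2 - 20 / 27 * d^3 - d^2 / 3 + z * (2 * y * d + 4 * d^2)"
  have gain: "(6 * (y + 2 * d / 3)^3 + (y - d)^3 - (3 * X^3 + 4 * y^3)) / 3
      - (6 * (y + 2 * d / 3)^2 + (y - d)^2 - (3 * X^2 + 4 * y^2)) / 2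
      - z * ((y - d) * (6 * (y + 2 * d / 3)) - 6 * y^2) = ?gain"
    unfolding X by (simp add: field_simps power2_eq_square power3_eq_cube)
  have "d * (d * (1 - X - y)) = d * (3 * y * z)" using eq by simp
  then have "d^2 = 3 * (y * z * d) + 2 * (y * d^2) + d^3"
    unfolding X by (simp add: algebra_simps power2_eq_square power3_eq_cube)
  moreover have "?gain = 2 / 3 * (y * d^2) - 20 / 27 * d^3 - d^2 / 3 + 2 * (y * z * d) + 4 * (z * d^2)"
    by (simp add: algebra_simps)
  moreover have "0 \<le> y * z * d" using assms(4) d0 dz by simp
  moreover have "d^3 \<le> z * d^2"
    using mult_right_mono[OF dz, of "d^2"] by (simp add: power3_eq_cube power2_eq_square)
  moreover have "0 \<le> d^3" using d0 by simp
  ultimately have "0 \<le> ?gain" by linarith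
  then show ?thesis by (subst diff_ge_0_iff_ge[symmetric], subst gain)
qed

text \<open>The weights are scaled so that the last one is 1, and \<open>A\<close> is the sum of the weights
  between the first three vertices and the last five. The assumption \<open>T\<close> and \<open>X < 2\<close> give
  \<open>y * v < 3 / 2\<close>. When \<open>A \<ge> 1\<close>, the two first order conditions push \<open>y * v\<close> above this bound.
  When \<open>A = 0\<close> the margin is small: \<open>y\<close> is bounded below by \<open>1.37\<close>, hence \<open>X\<close> by \<open>1.82\<close>, and
  this contradicts \<open>K\<close>.\<close>

lemma no_double_defect_weights:
  fixes X A y v :: real
  assumes v: "v * (3 * X + A) = 3 * X + 2 * A"
    and y: "(y - v) * (3 * X + A + y) = 2 * y"
    and T: "4 * (y * v) < 3 * X"
    and K: "(2 - X) * (2 * X + A + 2 * y + v + 1) = 1 + 2 * X - 2 * (y * v)"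
    and X2: "X < 2" and A: "A = 0 \<or> 1 \<le> A" and v1: "1 \<le> v" "v \<le> y" "y \<le> X"
  shows False
proof -
  have X: "1 \<le> X" using v1 by simp
  have P: "y * v < 3 / 2" using T X2 by linarith
  have "y * 1 \<le> y * v" using v1 by (intro mult_left_mono) auto
  then have y15: "y < 3 / 2" using P by linarith
  define s where "s = 3 * X + A"
  have s: "0 < s" using X A by (auto simp: s_def)
  from A consider "A = 0" | "2 \<le> A" | "1 \<le> A" "A < 2" by linarith
  then show False
  proof cases
    case 1
    have "v = 1" using v X 1 by simp
    then have e: "(y - 1) * (3 * X + y) = 2 * y" using y 1 by simp
    have "2 * y \<le> (y - 1) * (6 + y)" unfolding e[symmetric] using v1 \<open>v = 1\<close> X2 by (intro mult_left_mono) auto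
    then have q: "6 \<le> y * y + 3 * y" by (simp add: algebra_simps)
    have y137: "137 / 100 \<le> y"
    proof (rule ccontr)
      assume "\<not> 137 / 100 \<le> y"
      then have "y * y \<le> 137 / 100 * (137 / 100)" "y \<le> 137 / 100" using v1 \<open>v = 1\<close>
        by - (rule mult_mono, linarith, linarith, linarith, linarith, linarith)
      then show False using q by simp
    qed
    then have X182: "182 / 100 \<le> X" using T \<open>v = 1\<close> by simp
    have "(2 - X) * (2 * X + 2 * y + 2) \<le> 18 / 100 * 9"
      using X182 X2 y15 y137 by (intro mult_mono) auto
    moreover have "1 + X / 2 < (2 - X) * (2 * X + 2 * y + 2)"
      using K T \<open>v = 1\<close> 1 by (simp add: algebra_simps)
    ultimately show False using X182 by simp
  next
    case 2
    have "5 / 4 \<le> v"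
    proof (rule ccontr)
      assume "\<not> 5 / 4 \<le> v"
      then have "v * (3 * X + A) < 5 / 4 * (3 * X + A)"
        using s unfolding s_def by (intro mult_strict_right_mono) auto
      then show False using v 2 X2 by simp
    qed
    then have "5 / 4 * (5 / 4) \<le> y * v" using v1 by (intro mult_mono) auto
    then show False using P by simp
  next
    case 3
    have v87: "8 / 7 \<le> v"
    proof (rule ccontr)
      assume "\<not> 8 / 7 \<le> v"
      then have "v * (3 * X + A) < 8 / 7 * (3 * X + A)"
        using s unfolding s_def by (intro mult_strict_right_mono) auto
      then show False using v 3 X2 by simp
    qed
    have "2 * y \<le> (y - v) * (19 / 2)"
      unfolding y[symmetric] using v1 X2 3 y15 by (intro mult_left_mono) auto
    then have "19 / 15 * v \<le> y" by simp
    then have "19 / 15 * (8 / 7) \<le> y" using v87 by simp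
    then have "19 / 15 * (8 / 7) * (8 / 7) \<le> y * v" using v87 by (intro mult_mono) auto
    then show False using P by simp
  qed
qed

section \<open>Trading edges between tail graphs\<close>

definition star :: "nat \<Rightarrow> nat \<Rightarrow> nat set set" where
  "star n r = (\<lambda>j. {j, n}) ` {r..<n}"

definition last_triangle :: "nat \<Rightarrow> nat set set" where
  "last_triangle n = {{n - 2, n - 1}, {n - 2, n}, {n - 1, n}}"

lemma val_star: "val (star n r) x = x n * (\<Sum>j\<in>{r..<n}. x j)"
proof -
  have "inj_on (\<lambda>j. {j, n}) {r..<n}" by (auto intro!: inj_onI simp: doubleton_eq_iff)
  then show ?thesis
    unfolding val_def star_def
    by (subst sum.reindex) (auto simp: sum_distrib_left mult_ac intro!: sum.cong)
qed

lemma card_star: "card (star n r) = n - r"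
proof -
  have "inj_on (\<lambda>j. {j, n}) {r..<n}" by (auto intro!: inj_onI simp: doubleton_eq_iff)
  then show ?thesis by (simp add: star_def card_image)
qed

lemma val_last_triangle:
  assumes "2 \<le> n"
  shows "val (last_triangle n) x = x (n - 2) * x (n - 1) + x (n - 2) * x n + x (n - 1) * x n"
proof -
  have d: "n - 2 \<noteq> n - 1" "n - 2 \<noteq> n" "n - 1 \<noteq> n" using assms by auto
  then show ?thesis unfolding val_def last_triangle_def by (simp add: doubleton_eq_iff)
qed

lemma up_closed_star: "up_closed n (star n r)"
  unfolding up_closed_def
proof (intro ballI allI impI, elim conjE)
  fix f i j assume f: "f \<in> star n r" "i \<in> f" and j: "i < j" "j \<le> n" "j \<notin> f"
  from f(1) obtain l where l: "l \<in> {r..<n}" "f = {l, n}" by (auto simp: star_def)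
  have "j \<noteq> n" using l j by blast
  then have "i = l" "j < n" using l f j by auto
  then have "insert j (f - {i}) = {j, n}" "j \<in> {r..<n}" using l j by auto
  then show "insert j (f - {i}) \<in> star n r" by (auto simp: star_def)
qed

lemma star_pairs: "b < r \<Longrightarrow> star n r \<subseteq> [{b<..n}]\<^bsup>2\<^esup>"
  by (auto simp: star_def nsets_def card_insert_if)

lemma star_mono: "r \<le> r' \<Longrightarrow> star n r' \<subseteq> star n r"
  by (auto simp: star_def)

lemma star_last: "1 \<le> n \<Longrightarrow> star n (n - 1) = {{n - 1, n}}"
proof -
  assume "1 \<le> n"
  then have "{n - 1..<n} = {n - 1}" by auto
  then show ?thesis by (simp add: star_def)
qed

lemma star_empty: "star n n = {}"
  by (simp add: star_def)

lemma admissible_star: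
  assumes "b < r" "r \<le> n" "r \<le> r'"
  shows "admissible n (star n r') (star n r) b"
  using assms star_pairs star_mono by (simp add: admissible_def up_closed_star)

lemma triples_gain:
  assumes "finite A" "(\<Sum>v\<in>A. y v) = (\<Sum>v\<in>A. x v)" "(\<Sum>v\<in>A. y v ^ 2) = (\<Sum>v\<in>A. x v ^ 2)"
  shows "val ([A]\<^bsup>3\<^esup>) y = val ([A]\<^bsup>3\<^esup>) x + ((\<Sum>v\<in>A. y v ^ 3) - (\<Sum>v\<in>A. x v ^ 3)) / 3"
proof -
  have "6 * val ([A]\<^bsup>3\<^esup>) y = 6 * val ([A]\<^bsup>3\<^esup>) x + 2 * ((\<Sum>v\<in>A. y v ^ 3) - (\<Sum>v\<in>A. x v ^ 3))"
    unfolding newton_identities(3)[OF assms(1)] assms(2,3) by simp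
  then show ?thesis by linarith
qed

lemma four_vertex_move:
  fixes x :: "nat \<Rightarrow> real"
  assumes x: "x \<in> weightings {1..t}"
    and d: "distinct [i, j, k, l]" "{i, j, k, l} \<subseteq> {1..t}"
    and nonneg: "0 \<le> p" "0 \<le> q" "0 \<le> r" "0 \<le> s"
    and s1: "p + q + r + s = x i + x j + x k + x l"
    and s2: "p^2 + q^2 + r^2 + s^2 = (x i)^2 + (x j)^2 + (x k)^2 + (x l)^2"
  defines "y \<equiv> x(i := p, j := q, k := r, l := s)"
  shows "y \<in> weightings {1..t}"
    and "val ([{1..t}]\<^bsup>3\<^esup>) y = val ([{1..t}]\<^bsup>3\<^esup>) x
           + (p^3 + q^3 + r^3 + s^3 - ((x i)^3 + (x j)^3 + (x k)^3 + (x l)^3)) / 3"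
proof -
  have in_t: "i \<in> {1..t}" "j \<in> {1..t}" "k \<in> {1..t}" "l \<in> {1..t}" using d(2) by auto
  have ne: "i \<noteq> j" "i \<noteq> k" "i \<noteq> l" "j \<noteq> k" "j \<noteq> l" "k \<noteq> l" using d(1) by auto
  have e1: "(\<Sum>v\<in>{1..t}. y v) = (\<Sum>v\<in>{1..t}. x v)"
    unfolding y_def sum_upd[OF finite_atLeastAtMost] using in_t ne s1 by simp
  have e2: "(\<Sum>v\<in>{1..t}. y v ^ 2) = (\<Sum>v\<in>{1..t}. x v ^ 2)"
    unfolding y_def sum_upd[OF finite_atLeastAtMost] using in_t ne s2 by simp
  have e3: "(\<Sum>v\<in>{1..t}. y v ^ 3) = (\<Sum>v\<in>{1..t}. x v ^ 3)
      + (p^3 + q^3 + r^3 + s^3 - ((x i)^3 + (x j)^3 + (x k)^3 + (x l)^3))"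
    unfolding y_def sum_upd[OF finite_atLeastAtMost] using in_t ne by simp
  show "y \<in> weightings {1..t}"
    using x nonneg e1 unfolding weightings_def by (auto simp: y_def)
  show "val ([{1..t}]\<^bsup>3\<^esup>) y = val ([{1..t}]\<^bsup>3\<^esup>) x
           + (p^3 + q^3 + r^3 + s^3 - ((x i)^3 + (x j)^3 + (x k)^3 + (x l)^3)) / 3"
    unfolding triples_gain[OF finite_atLeastAtMost e1 e2] e3 by simp
qed

context tail_optimum
begin

lemma lag_le_of_better:
  assumes "F \<subseteq> [{1..n + 2}]\<^bsup>3\<^esup>" "y \<in> weightings {1..n + 2}" "val (tail n N M b) x \<le> val F y"
  shows "lag (n + 2) (tail n N M b) \<le> lag (n + 2) F"
  using val_le_lag[OF assms(1,2)] assms(3) opt by simp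

end

text \<open>In the link of the last vertex, the vertices \<open>b, r, n, n + 1\<close> induce a claw with centre
  \<open>b\<close>, and the trade turns it into a triangle avoiding \<open>n + 1\<close>. Vertices strictly between \<open>b\<close>
  and \<open>r\<close> miss only \<open>n + 1\<close> among the four, those between \<open>r\<close> and \<open>n\<close> miss \<open>n\<close> and \<open>n + 1\<close>, and
  all others see all four of them. The possible missing triple \<open>{n - 1, n, n + 1}\<close> contains two
  of the four.\<close>

lemma star_step:
  assumes T: "tail_optimum n N (star n r) b x" and r: "b < r" "r < n"
    and N: "N = {} \<or> N = {{n - 1, n}} \<and> r + 2 \<le> n"
    and adm': "admissible n N (star n (r + 1)) (b - 1)"
  shows "lag (n + 2) (tail n N (star n r) b) \<le> lag (n + 2) (tail n N (star n (r + 1)) (b - 1))"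
proof -
  interpret tail_optimum n N "star n r" b x by (rule T)
  have b: "1 \<le> b" by (rule b_ge)
  let ?w = "x (n + 1)" and ?z = "x (n + 2)"
  have ord: "?w \<le> x n" "x n \<le> x r" "x r \<le> x b" using dec r b by auto
  have wz: "0 < ?w" "0 < ?z" "?z \<le> ?w" using pos dec by auto
  have bw: "x b - ?w \<le> ?z" using dec[of 1 b] b r first_lt_last_two by simp
  obtain p q u v where pos': "0 \<le> p" "0 \<le> q" "0 \<le> u" "0 \<le> v"
    and s1: "p + q + u + v = x b + x r + x n + ?w"
    and s2: "p^2 + q^2 + u^2 + v^2 = (x b)^2 + (x r)^2 + (x n)^2 + ?w^2"
    and v: "v \<le> ?w" and uv: "u + v \<le> x n + ?w" and uv': "u * v \<le> x n * ?w"
    and gain: "?z * (v * (p + q + u) - (x r * x n + x r * ?w + x n * ?w))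
       \<le> (p^3 + q^3 + u^3 + v^3 - ((x b)^3 + (x r)^3 + (x n)^3 + ?w^3)) / 3"
  proof (rule claw_to_triangle_weights[OF ord])
    show "x b \<le> x r + x n" using bw wz ord by linarith
  qed (use wz bw in auto)
  define y where "y = x(b := p, r := q, n := u, n + 1 := v)"
  have dist: "distinct [b, r, n, n + 1]" "{b, r, n, n + 1} \<subseteq> {1..n + 2}" using b r by auto
  have yw: "y \<in> weightings {1..n + 2}"
    and e3: "val ([{1..n + 2}]\<^bsup>3\<^esup>) y = val ([{1..n + 2}]\<^bsup>3\<^esup>) x
           + (p^3 + q^3 + u^3 + v^3 - ((x b)^3 + (x r)^3 + (x n)^3 + ?w^3)) / 3"
    unfolding y_def using four_vertex_move[OF wt dist pos' s1 s2] by auto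
  \<comment> \<open>The vertices that see some but not all of the four.\<close>
  define Qa where "Qa = (\<Sum>j\<in>{b<..<r}. x j)"
  define Qb where "Qb = (\<Sum>j\<in>{r<..<n}. x j)"
  have Q: "0 \<le> Qa" "0 \<le> Qb" unfolding Qa_def Qb_def using r by (auto intro!: sum_nonneg nonneg)
  have yv: "y b = p" "y r = q" "y n = u" "y (n + 1) = v" "y (n + 2) = ?z"
    using r by (auto simp: y_def)
  have Qa': "(\<Sum>j\<in>{b<..<r}. y j) = Qa" and Qb': "(\<Sum>j\<in>{r<..<n}. y j) = Qb"
    unfolding Qa_def Qb_def y_def using r by (auto intro!: sum.cong)
  have mid: "(\<Sum>j\<in>{b<..n}. g j) = (\<Sum>j\<in>{b<..<r}. g j) + g r + (\<Sum>j\<in>{r<..<n}. g j) + g n" for g :: "nat \<Rightarrow> real"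
  proof -
    have "{b<..n} = insert r (insert n ({b<..<r} \<union> {r<..<n}))" using r by auto
    moreover have "(\<Sum>j\<in>{b<..<r} \<union> {r<..<n}. g j) = (\<Sum>j\<in>{b<..<r}. g j) + (\<Sum>j\<in>{r<..<n}. g j)"
      by (intro sum.union_disjoint) auto
    ultimately show ?thesis using r by simp
  qed
  have mid': "(\<Sum>j\<in>{b - 1<..n}. y j) = p + (\<Sum>j\<in>{b<..n}. y j)"
  proof -
    have "{b - 1<..n} = insert b {b<..n}" using r b by auto
    then show ?thesis by (simp add: yv)
  qed
  have st: "(\<Sum>j\<in>{r..<n}. x j) = x r + Qb"
  proof -
    have "{r..<n} = insert r {r<..<n}" using r by auto
    then show ?thesis by (simp add: Qb_def)
  qed
  have st': "(\<Sum>j\<in>{r + 1..<n}. y j) = Qb"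
  proof -
    have "{r + 1..<n} = {r<..<n}" by auto
    then show ?thesis using Qb' by simp
  qed
  obtain k where k: "0 \<le> k" "val N x = k * x n" "val N y = k * u"
  proof (cases "N = {}")
    case True
    then show ?thesis using that[of 0] by (simp add: val_def)
  next
    case False
    then have NN: "N = {{n - 1, n}}" "r + 2 \<le> n" using N by auto
    have "y (n - 1) = x (n - 1)" "n - 1 \<noteq> n" using NN r by (auto simp: y_def)
    moreover have "0 \<le> x (n - 1)" using NN(2) r by (intro nonneg) auto
    ultimately show ?thesis using that[of "x (n - 1)"] NN(1) yv by (simp add: val_def)
  qed
  have "val (tail n N (star n r) b) x \<le> val (tail n N (star n (r + 1)) (b - 1)) y"
  proof -
    have "k * (u * v) \<le> k * (x n * ?w)" using k uv' by (intro mult_left_mono)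
    moreover have "?z * Qa * v \<le> ?z * Qa * ?w" using Q v wz by (intro mult_left_mono) auto
    moreover have "?z * Qb * (u + v) \<le> ?z * Qb * (x n + ?w)" using Q uv wz by (intro mult_left_mono) auto
    moreover have "val (tail n N (star n r) b) x = val ([{1..n + 2}]\<^bsup>3\<^esup>) x - ?w * (k * x n)
        - ?z * (x n * (x r + Qb)) - ?w * ?z * (Qa + x r + Qb + x n)"
      unfolding val_tail[OF adm] val_star st mid[of x] k(2) Qa_def Qb_def by simp
    moreover have "val (tail n N (star n (r + 1)) (b - 1)) y = val ([{1..n + 2}]\<^bsup>3\<^esup>) x
        + (p^3 + q^3 + u^3 + v^3 - ((x b)^3 + (x r)^3 + (x n)^3 + ?w^3)) / 3
        - v * (k * u) - ?z * (u * Qb) - v * ?z * (p + (Qa + q + Qb + u))"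
      unfolding val_tail[OF adm'] val_star st' mid' mid[of y] k(3) e3 yv Qa' Qb' by simp
    moreover note gain
    ultimately show ?thesis by (simp only: algebra_simps)
  qed
  then show ?thesis using tail_subset yw by (rule lag_le_of_better[rotated 2])
qed

context tail_optimum
begin

text \<open>A third vertex exists because \<open>1 \<le> n\<close>, and its weight is positive.\<close>

lemma two_lt_one:
  assumes "i \<in> {1..n + 2}" "j \<in> {1..n + 2}" "i \<noteq> j"
  shows "x i + x j < 1"
proof -
  obtain k where k: "k \<in> {1..3}" "k \<noteq> i" "k \<noteq> j"
  proof -
    have "\<not> {1..3::nat} \<subseteq> {i, j}"
    proof
      assume "{1..3::nat} \<subseteq> {i, j}"
      then have "card {1..3::nat} \<le> card {i, j}" by (intro card_mono) auto
      also have "\<dots> \<le> 2" by (rule card_2_iff[THEN iffD2, THEN eq_refl, rotated]) (use assms in auto)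
      finally show False by simp
    qed
    then obtain k where "k \<in> {1..3}" "k \<notin> {i, j}" by blast
    then show ?thesis using that by blast
  qed
  then have k': "k \<in> {1..n + 2}" using n by auto
  have "(\<Sum>v\<in>{i, j, k}. x v) \<le> (\<Sum>v\<in>{1..n + 2}. x v)"
    using assms k' nonneg by (intro sum_mono2) auto
  then show ?thesis using assms k k' pos[of k] sum_all by simp
qed

text \<open>If transferring weight between \<open>i\<close> and \<open>j\<close> affects the value only through the product of
  the two weights, then optimal weights are equal.\<close>

lemma twins:
  assumes ij: "i \<in> {1..n + 2}" "j \<in> {1..n + 2}" "i \<noteq> j" and s: "0 < s"
    and quad: "\<And>\<delta>. val (tail n N M b) (x(i := x i + \<delta>, j := x j - \<delta>))
                 = val (tail n N M b) x + \<delta> * (x j - x i - \<delta>) * s"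
  shows "x i = x j"
proof -
  have "(x j - x i) * s = 0"
    by (rule stationary[OF ij, where \<beta> = "- s"], unfold quad)
      (simp add: algebra_simps power2_eq_square)
  then show ?thesis using s by simp
qed

lemma head_twins:
  assumes "i \<in> {1..b}" "j \<in> {1..b}"
  shows "x i = x j"
proof (cases "i = j")
  case False
  have ij: "i \<in> {1..n + 2}" "j \<in> {1..n + 2}" using assms b_le by auto
  have out: "i \<notin> {b<..n}" "j \<notin> {b<..n}" "i \<noteq> n + 1" "j \<noteq> n + 1" "i \<noteq> n + 2" "j \<noteq> n + 2"
    using assms b_le by auto
  show ?thesis
  proof (rule twins[OF ij False])
    show "0 < 1 - x i - x j" using two_lt_one[OF ij False] by simp
    fix \<delta>
    have "(\<Sum>v\<in>{b<..n}. (x(i := x i + \<delta>, j := x j - \<delta>)) v) = mid_weight"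
      using out by (intro sum.cong) auto
    then show "val (tail n N M b) (x(i := x i + \<delta>, j := x j - \<delta>))
        = val (tail n N M b) x + \<delta> * (x j - x i - \<delta>) * (1 - x i - x j)"
      using val_triples_transfer[OF finite_atLeastAtMost ij False, of x \<delta>] out
      unfolding val_tail[OF adm] sum_all val_pairs_upd[OF out(1)] val_pairs_upd[OF out(2)]
      by simp
  qed
qed simp

lemma head_weight_pos: "0 < head_weight"
  using b_ge b_le pos by (intro sum_pos) auto

lemma last_twins:
  assumes "val M x = val N x"
  shows "x (n + 1) = x (n + 2)"
  using last_two_stationary assms head_weight_pos by simp

lemma head_const: "v \<in> {1..b} \<Longrightarrow> x v = x 1"
  using head_twins[of v 1] b_ge by auto

end

text \<open>The pairs missing in the link of the last vertex form a triangle. They are replaced by a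
  star with the same number of edges, which \<open>star_step\<close> can handle. The claw is centred at
  \<open>n - 3\<close>. The vertex \<open>n + 1\<close> is adjacent to none of the four vertices because \<open>b < n - 3\<close>, so
  the trade does not affect it.\<close>

lemma triangle_step:
  assumes T: "tail_optimum n {} (last_triangle n) b x" and b: "b + 4 \<le> n"
  shows "lag (n + 2) (tail n {} (last_triangle n) b) \<le> lag (n + 2) (tail n {} (star n (n - 3)) b)"
proof -
  interpret tail_optimum n "{}" "last_triangle n" b x by (rule T)
  define i j k where "i = n - 3" and "j = n - 2" and "k = n - 1"
  have ijk: "b < i" "i < j" "j < k" "k < n" using b by (auto simp: i_def j_def k_def)
  have sets: "{n - 3..<n} = {i, j, k}" using b by (auto simp: i_def j_def k_def)
  let ?w = "x (n + 1)" and ?z = "x (n + 2)"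
  have ord: "x n \<le> x k" "x k \<le> x j" "x j \<le> x i" "?z \<le> x n" "?w \<le> x n" using dec ijk by auto
  have wz: "0 < ?w" "0 < ?z" using pos by auto
  have bw: "x i - x n \<le> ?z" using dec[of 1 i] ord ijk first_lt_last_two by simp
  obtain p q u v where pos': "0 \<le> p" "0 \<le> q" "0 \<le> u" "0 \<le> v"
    and s1: "p + q + u + v = x i + x j + x k + x n"
    and s2: "p^2 + q^2 + u^2 + v^2 = (x i)^2 + (x j)^2 + (x k)^2 + (x n)^2"
    and gain: "?z * (v * (p + q + u) - (x j * x k + x j * x n + x k * x n))
       \<le> (p^3 + q^3 + u^3 + v^3 - ((x i)^3 + (x j)^3 + (x k)^3 + (x n)^3)) / 3"
  proof (rule claw_to_triangle_weights[OF ord(1-3)])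
    show "x i \<le> x j + x k" using bw wz ord by linarith
  qed (use wz ord bw in auto)
  define y where "y = x(i := p, j := q, k := u, n := v)"
  have dist: "distinct [i, j, k, n]" "{i, j, k, n} \<subseteq> {1..n + 2}" using b_ge ijk by auto
  have yw: "y \<in> weightings {1..n + 2}"
    and e3: "val ([{1..n + 2}]\<^bsup>3\<^esup>) y = val ([{1..n + 2}]\<^bsup>3\<^esup>) x
           + (p^3 + q^3 + u^3 + v^3 - ((x i)^3 + (x j)^3 + (x k)^3 + (x n)^3)) / 3"
    unfolding y_def using four_vertex_move[OF wt dist pos' s1 s2] by auto
  have yv: "y i = p" "y j = q" "y k = u" "y n = v" "y (n + 1) = ?w" "y (n + 2) = ?z"
    using ijk by (auto simp: y_def)
  have mid: "(\<Sum>v\<in>{b<..n}. y v) = mid_weight"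
    unfolding y_def sum_upd[OF finite_greaterThanAtMost] using ijk s1 by simp
  have st: "(\<Sum>v\<in>{n - 3..<n}. y v) = p + q + u"
    unfolding sets using ijk yv by simp
  have tr: "val (last_triangle n) x = x j * x k + x j * x n + x k * x n"
    using val_last_triangle[of n x] b by (simp add: j_def k_def)
  have adm': "admissible n {} (star n (n - 3)) b"
    using admissible_star[of b "n - 3" n n] b by (simp add: star_empty)
  have "val (tail n {} (last_triangle n) b) x \<le> val (tail n {} (star n (n - 3)) b) y"
  proof -
    define E where "E = (p^3 + q^3 + u^3 + v^3 - ((x i)^3 + (x j)^3 + (x k)^3 + (x n)^3)) / 3"
    show ?thesis
      using gain unfolding val_tail[OF adm] val_tail[OF adm'] val_star mid st tr e3 yv E_def[symmetric]
      by (simp add: val_def algebra_simps)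
  qed
  then show ?thesis using tail_subset yw by (rule lag_le_of_better[rotated 2])
qed

text \<open>Both missing triples \<open>{n - 1, n, n + 1}\<close> and \<open>{n - 1, n, n + 2}\<close> are restored at the
  expense of two edges \<open>{j, n + 1, n + 2}\<close>. If this does not pay off with the same weights, the
  six weights involved are reflected about their mean.\<close>

lemma single_defect_step:
  assumes T: "tail_optimum n {{n - 1, n}} {{n - 1, n}} b x"
  shows "lag (n + 2) (tail n {{n - 1, n}} {{n - 1, n}} b) \<le> lag (n + 2) (tail n {} {} (b - 2))"
proof -
  interpret tail_optimum n "{{n - 1, n}}" "{{n - 1, n}}" b x by (rule T)
  have b: "2 \<le> b" using card_M_less by simp
  define i k where "i = b - 1" and "k = n - 1"
  have kn: "k < n" and bk: "b < k"
    using pair_bounds[of "{n - 1, n}"] b b_le by (auto simp: k_def)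
  have i: "1 \<le> i" "i < b" using b by (auto simp: i_def)
  let ?p = "x b" and ?y = "x n" and ?z = "x (n + 2)"
  have vN: "val {{n - 1, n}} g = g k * g n" for g :: "nat \<Rightarrow> real"
    using kn by (simp add: val_def k_def)
  have p: "x i = ?p" using head_twins[of i b] i by auto
  have z: "x (n + 1) = ?z" by (rule last_twins) simp
  have ik: "k \<in> {1..n + 2}" "n \<in> {1..n + 2}" "k \<noteq> n" using kn bk by auto
  have y: "x k = ?y"
  proof (rule twins[OF ik, of "1 - x k - x n - x (n + 1) - x (n + 2)"])
    have "(\<Sum>v\<in>{b, k, n, n + 1, n + 2}. x v) \<le> (\<Sum>v\<in>{1..n + 2}. x v)"
      using b bk kn nonneg by (intro sum_mono2) auto
    then have "x b + (x k + (x n + (x (n + 1) + x (n + 2)))) \<le> 1"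
      unfolding sum_all using bk kn by simp
    then show "0 < 1 - x k - x n - x (n + 1) - x (n + 2)" using pos[of b] b b_le by simp
    fix \<delta>
    show "val (tail n {{n - 1, n}} {{n - 1, n}} b) (x(k := x k + \<delta>, n := x n - \<delta>))
        = val (tail n {{n - 1, n}} {{n - 1, n}} b) x
          + \<delta> * (x n - x k - \<delta>) * (1 - x k - x n - x (n + 1) - x (n + 2))"
      using val_triples_transfer[OF finite_atLeastAtMost ik, of x \<delta>] kn bk
      unfolding val_tail[OF adm] sum_all vN sum_upd[OF finite_greaterThanAtMost]
      by (simp add: algebra_simps)
  qed
  define D where "D = (\<Sum>j\<in>{b<..<k}. x j)"
  have D: "0 \<le> D" unfolding D_def using bk kn by (auto intro!: sum_nonneg nonneg)
  have mid: "(\<Sum>j\<in>{b<..n}. g j) = (\<Sum>j\<in>{b<..<k}. g j) + g k + g n" for g :: "nat \<Rightarrow> real"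
  proof -
    have "{b<..n} = insert k (insert n {b<..<k})" using bk kn by (auto simp: k_def)
    then show ?thesis using kn by simp
  qed
  have mid': "(\<Sum>j\<in>{b - 2<..n}. g j) = g i + g b + (\<Sum>j\<in>{b<..<k}. g j) + g k + g n" for g :: "nat \<Rightarrow> real"
  proof -
    have "{b - 2<..n} = insert i (insert b {b<..n})" using b b_le by (auto simp: i_def)
    then show ?thesis using i mid[of g] by simp
  qed
  have valx: "val (tail n {{n - 1, n}} {{n - 1, n}} b) x
      = val ([{1..n + 2}]\<^bsup>3\<^esup>) x - 2 * ?z * ?y^2 - ?z^2 * (D + 2 * ?y)"
    unfolding val_tail[OF adm] vN mid D_def[symmetric] y z by (simp add: algebra_simps power2_eq_square)
  have adm': "admissible n {} {} (b - 2)" using b_le by (intro admissible_empty) simp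
  have ord: "?z \<le> ?y" "?y \<le> ?p" "?p \<le> 2 * ?z" "0 \<le> ?z"
    using dec[of n "n + 2"] dec[of b n] dec[of 1 b] first_lt_last_two z b b_le kn pos[of "n + 2"] by auto
  show ?thesis
  proof (cases "?y * ?y \<le> ?z * ?p")
    case False
    then have "?z * (?z * ?p) \<le> ?z * (?y * ?y)" using ord by (intro mult_left_mono) auto
    then have "val (tail n {{n - 1, n}} {{n - 1, n}} b) x \<le> val (tail n {} {} (b - 2)) x"
      unfolding valx val_tail[OF adm'] mid' D_def[symmetric] p y z
      by (simp add: val_def algebra_simps power2_eq_square)
    then show ?thesis using tail_subset wt by (rule lag_le_of_better[rotated 2])
  next
    case True
    define s where "s = 2 * (?p + ?y + ?z) / 3"
    note refl = clique_to_star_weights[OF ord(1,2,4,3) True, folded s_def]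
    let ?g = "x(i := s - ?z, b := s - ?z, k := s - ?y, n := s - ?y, n + 1 := s - ?p, n + 2 := s - ?p)"
    have mem: "i \<in> {1..n + 2}" "b \<in> {1..n + 2}" "k \<in> {1..n + 2}" "n \<in> {1..n + 2}"
      "n + 1 \<in> {1..n + 2}" "n + 2 \<in> {1..n + 2}"
      "i \<noteq> b" "i \<noteq> k" "i \<noteq> n" "i \<noteq> n + 1" "i \<noteq> n + 2" "b \<noteq> k" "b \<noteq> n" "b \<noteq> n + 1" "b \<noteq> n + 2"
      "k \<noteq> n" "k \<noteq> n + 1" "k \<noteq> n + 2" "n \<noteq> n + 1" "n \<noteq> n + 2" "n + 1 \<noteq> n + 2"
      using i bk kn b_le by auto
    have s3: "3 * s = 2 * (?p + ?y + ?z)" by (simp add: s_def)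
    have e1: "(\<Sum>v\<in>{1..n + 2}. ?g v) = (\<Sum>v\<in>{1..n + 2}. x v)"
      unfolding sum_upd[OF finite_atLeastAtMost] using mem p y z s3 by simp
    have "(\<Sum>v\<in>{1..n + 2}. ?g v ^ 2) = (\<Sum>v\<in>{1..n + 2}. x v ^ 2)
        + (2 * (s - ?z)^2 + 2 * (s - ?y)^2 + 2 * (s - ?p)^2 - (2 * ?p^2 + 2 * ?y^2 + 2 * ?z^2))"
      unfolding sum_upd[OF finite_atLeastAtMost] using mem p y z by simp
    then have e2: "(\<Sum>v\<in>{1..n + 2}. ?g v ^ 2) = (\<Sum>v\<in>{1..n + 2}. x v ^ 2)"
      unfolding refl(5) by simp
    have e3: "(\<Sum>v\<in>{1..n + 2}. ?g v ^ 3) = (\<Sum>v\<in>{1..n + 2}. x v ^ 3)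
        + (2 * (s - ?z)^3 + 2 * (s - ?y)^3 + 2 * (s - ?p)^3 - (2 * ?p^3 + 2 * ?y^3 + 2 * ?z^3))"
      unfolding sum_upd[OF finite_atLeastAtMost] using mem p y z by simp
    have gw: "?g \<in> weightings {1..n + 2}"
      using wt refl(1,3,4) e1 unfolding weightings_def by auto
    have gD: "(\<Sum>j\<in>{b<..<k}. ?g j) = D"
      unfolding D_def using i bk kn by (auto intro!: sum.cong)
    define E where
      "E = (2 * (s - ?z)^3 + 2 * (s - ?y)^3 + 2 * (s - ?p)^3 - (2 * ?p^3 + 2 * ?y^3 + 2 * ?z^3)) / 3"
    have triples: "val ([{1..n + 2}]\<^bsup>3\<^esup>) ?g = val ([{1..n + 2}]\<^bsup>3\<^esup>) x + E"
      unfolding triples_gain[OF finite_atLeastAtMost e1 e2] e3 E_def by simp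
    have gv: "?g i = s - ?z" "?g b = s - ?z" "?g k = s - ?y" "?g n = s - ?y" "?g (n + 1) = s - ?p"
      "?g (n + 2) = s - ?p" using mem by auto
    have valg: "val (tail n {} {} (b - 2)) ?g = val ([{1..n + 2}]\<^bsup>3\<^esup>) x + E
        - (s - ?p)^2 * (2 * (s - ?z) + D + 2 * (s - ?y))"
      unfolding val_tail[OF adm'] mid' gD triples gv by (simp add: val_def power2_eq_square)
    have "(s - ?p)^2 * D \<le> ?z^2 * D" using refl(1,2) D by (intro mult_right_mono power_mono) auto
    then have "val (tail n {{n - 1, n}} {{n - 1, n}} b) x \<le> val (tail n {} {} (b - 2)) ?g"
      using refl(6) unfolding valx valg E_def[symmetric] by (simp add: algebra_simps)
    then show ?thesis using tail_subset gw by (rule lag_le_of_better[rotated 2])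
  qed
qed

section \<open>The two exceptional configurations\<close>

context tail_optimum
begin

lemma sum_le_one: "S \<subseteq> {1..n + 2} \<Longrightarrow> (\<Sum>v\<in>S. x v) \<le> 1"
  using sum_mono2[of "{1..n + 2}" S x] nonneg sum_all by auto

end

text \<open>The case \<open>b = n - 3\<close> that \<open>triangle_step\<close> leaves open: now the pairs missing in the link
  of the last vertex are all pairs of \<open>n - 2, n - 1, n, n + 1\<close>. The move of \<open>triangle_step\<close>
  fails because \<open>n + 1\<close> is adjacent to \<open>n - 3\<close>. Instead all three pairs are restored at once. By
  symmetry only two different weights occur among the seven vertices concerned.\<close>

lemma full_triangle_step:
  assumes T: "tail_optimum n {} (last_triangle n) (n - 3) x"
  shows "lag (n + 2) (tail n {} (last_triangle n) (n - 3)) \<le> lag (n + 2) (tail n {} {} (n - 6))"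
proof -
  interpret tail_optimum n "{}" "last_triangle n" "n - 3" x by (rule T)
  have n3: "3 < n" using b_ge by simp
  have "card (last_triangle n) = 3"
  proof -
    have "n - 2 \<noteq> n - 1" "n - 2 \<noteq> n" "n - 1 \<noteq> n" using n3 by auto
    then show ?thesis by (simp add: last_triangle_def doubleton_eq_iff)
  qed
  then have n7: "7 \<le> n" using card_M_less by simp
  define h i j k l where "h = n - 5" and "i = n - 4" and "j = n - 3" and "k = n - 2" and "l = n - 1"
  note defs = h_def i_def j_def k_def l_def
  have less: "1 \<le> h" "h < i" "i < j" "j < k" "k < l" "l < n" using n7 by (auto simp: defs)
  obtain m where m: "n = m + 7" using n7 le_Suc_ex add.commute by metis
  have mid: "{n - 3<..n} = {k, l, n}" unfolding defs m by auto
  have mid': "{n - 6<..n} = {h, i, j, k, l, n}" unfolding defs m by auto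
  have valT: "val (tail n {} (last_triangle n) (n - 3)) g = val ([{1..n + 2}]\<^bsup>3\<^esup>) g
      - g (n + 2) * (g k * g l + g k * g n + g l * g n) - g (n + 1) * g (n + 2) * (g k + g l + g n)" for g
    unfolding val_tail[OF adm] mid using val_last_triangle[of n g] n7 less by (simp add: val_def k_def l_def add.assoc)
  let ?X = "x j" and ?y = "x n" and ?z = "x (n + 2)"
  have X: "x h = ?X" "x i = ?X"
    using head_twins[of h j] head_twins[of i j] less by (auto simp: j_def)
  have room: "?X + x a + x b + x c \<le> 1"
    if "{a, b, c} \<subseteq> {1..n + 2}" "j < a" "a < b" "b < c" for a b c
    using sum_le_one[of "{j, a, b, c}"] that less by simp
  have Xpos: "0 < ?X" using less by (intro pos) auto
  have mem: "h \<in> {1..n + 2}" "i \<in> {1..n + 2}" "j \<in> {1..n + 2}" "k \<in> {1..n + 2}" "l \<in> {1..n + 2}"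
    "n \<in> {1..n + 2}" "n + 1 \<in> {1..n + 2}" "n + 2 \<in> {1..n + 2}"
    using less by auto
  have kl: "x k = x l"
  proof (rule twins[OF mem(4,5)])
    show "k \<noteq> l" using less by simp
    show "0 < 1 - x k - x l - ?z" using room[of k l "n + 2"] less Xpos by simp
    fix \<delta>
    show "val (tail n {} (last_triangle n) (n - 3)) (x(k := x k + \<delta>, l := x l - \<delta>))
      = val (tail n {} (last_triangle n) (n - 3)) x + \<delta> * (x l - x k - \<delta>) * (1 - x k - x l - ?z)"
      using val_triples_transfer[OF finite_atLeastAtMost mem(4,5), of x \<delta>] less
      unfolding valT sum_all by (simp add: algebra_simps)
  qed
  have ln: "x l = x n"
  proof (rule twins[OF mem(5,6)])
    show "l \<noteq> n" using less by simp
    show "0 < 1 - x l - x n - ?z" using room[of l n "n + 2"] less Xpos by simp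
    fix \<delta>
    show "val (tail n {} (last_triangle n) (n - 3)) (x(l := x l + \<delta>, n := x n - \<delta>))
      = val (tail n {} (last_triangle n) (n - 3)) x + \<delta> * (x n - x l - \<delta>) * (1 - x l - x n - ?z)"
      using val_triples_transfer[OF finite_atLeastAtMost mem(5,6), of x \<delta>] less
      unfolding valT sum_all by (simp add: algebra_simps)
  qed
  have nw: "x n = x (n + 1)"
  proof (rule twins[OF mem(6,7)])
    show "0 < 1 - x n - x (n + 1) - ?z" using room[of n "n + 1" "n + 2"] less Xpos by simp
    fix \<delta>
    show "val (tail n {} (last_triangle n) (n - 3)) (x(n := x n + \<delta>, n + 1 := x (n + 1) - \<delta>))
      = val (tail n {} (last_triangle n) (n - 3)) x + \<delta> * (x (n + 1) - x n - \<delta>) * (1 - x n - x (n + 1) - ?z)"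
      using val_triples_transfer[OF finite_atLeastAtMost mem(6,7), of x \<delta>] less
      unfolding valT sum_all by (simp add: algebra_simps)
  qed simp
  have "(?y - ?X) * (1 - ?X - ?y) + ?z * (x k + x l + x (n + 1)) = 0"
  proof (rule stationary[OF mem(3,6), where \<beta> = "- (1 - ?X - ?y)"])
    show "j \<noteq> n" using less by simp
    fix \<delta>
    show "val (tail n {} (last_triangle n) (n - 3)) (x(j := x j + \<delta>, n := x n - \<delta>))
      = val (tail n {} (last_triangle n) (n - 3)) x
        + ((?y - ?X) * (1 - ?X - ?y) + ?z * (x k + x l + x (n + 1))) * \<delta> + - (1 - ?X - ?y) * \<delta>\<^sup>2"
      using val_triples_transfer[OF finite_atLeastAtMost mem(3,6), of x \<delta>] less
      unfolding valT sum_all by (simp add: algebra_simps power2_eq_square)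
  qed
  then have eq: "(?X - ?y) * (1 - ?X - ?y) = 3 * ?y * ?z" unfolding kl ln nw[symmetric] by (simp add: algebra_simps)
  define d where "d = ?X - ?y"
  have d: "0 \<le> d" "d \<le> ?z" "?z \<le> ?y"
    using dec[of j n] dec[of 1 j] dec[of n "n + 2"] first_lt_last_two less nw by (auto simp: d_def)
  have yz: "0 < ?y" "0 < ?z" using pos mem by auto
  note gain = link_clique_to_star_weights[of ?X ?y ?z, folded d_def, OF d(1,2) _ eq[folded d_def]]
  \<comment> \<open>The sum of the seven weights is kept.\<close>
  define q v where "q = ?y + 2 * d / 3" and "v = ?y - d"
  define g where "g = x(h := q, i := q, j := q, k := q, l := q, n := q, n + 1 := v)"
  have gv: "g h = q" "g i = q" "g j = q" "g k = q" "g l = q" "g n = q" "g (n + 1) = v" "g (n + 2) = ?z"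
    using less by (auto simp: g_def)
  have e1: "(\<Sum>v\<in>{1..n + 2}. g v) = 1"
  proof -
    have "(\<Sum>v\<in>{1..n + 2}. g v) = (\<Sum>v\<in>{1..n + 2}. x v) + (6 * q + v - (3 * ?X + 4 * ?y))"
      unfolding g_def sum_upd[OF finite_atLeastAtMost] using mem less X kl ln nw by simp
    then show ?thesis unfolding sum_all q_def v_def by (simp add: d_def field_simps)
  qed
  have e2: "(\<Sum>v\<in>{1..n + 2}. g v ^ 2) = (\<Sum>v\<in>{1..n + 2}. x v ^ 2) + (6 * q^2 + v^2 - (3 * ?X^2 + 4 * ?y^2))"
    unfolding g_def sum_upd[OF finite_atLeastAtMost] using mem less X kl ln nw by simp
  have e3: "(\<Sum>v\<in>{1..n + 2}. g v ^ 3) = (\<Sum>v\<in>{1..n + 2}. x v ^ 3) + (6 * q^3 + v^3 - (3 * ?X^3 + 4 * ?y^3))"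
    unfolding g_def sum_upd[OF finite_atLeastAtMost] using mem less X kl ln nw by simp
  define E where "E = (6 * q^3 + v^3 - (3 * ?X^3 + 4 * ?y^3)) / 3 - (6 * q^2 + v^2 - (3 * ?X^2 + 4 * ?y^2)) / 2"
  have triples: "val ([{1..n + 2}]\<^bsup>3\<^esup>) g = val ([{1..n + 2}]\<^bsup>3\<^esup>) x + E"
  proof -
    have "6 * val ([{1..n + 2}]\<^bsup>3\<^esup>) g = 6 * val ([{1..n + 2}]\<^bsup>3\<^esup>) x
        + (2 * (6 * q^3 + v^3 - (3 * ?X^3 + 4 * ?y^3)) - 3 * (6 * q^2 + v^2 - (3 * ?X^2 + 4 * ?y^2)))"
      unfolding newton_identities(3)[OF finite_atLeastAtMost] e1 e2 e3 sum_all by simp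
    then show ?thesis unfolding E_def by linarith
  qed
  have gw: "g \<in> weightings {1..n + 2}"
  proof -
    have "0 \<le> q" "0 \<le> v" using d yz by (auto simp: q_def v_def)
    then show ?thesis using wt e1 unfolding weightings_def by (auto simp: g_def)
  qed
  have adm': "admissible n {} {} (n - 6)" by (intro admissible_empty) simp
  have val_new: "val (tail n {} {} (n - 6)) g = val ([{1..n + 2}]\<^bsup>3\<^esup>) x + E - v * ?z * (6 * q)"
    unfolding val_tail[OF adm'] mid' triples using less gv by (simp add: val_def)
  have val_old: "val (tail n {} (last_triangle n) (n - 3)) x = val ([{1..n + 2}]\<^bsup>3\<^esup>) x - 6 * ?z * ?y^2"
    unfolding valT kl ln nw[symmetric] by (simp add: power2_eq_square algebra_simps)
  have "?z * (v * (6 * q) - 6 * ?y^2) \<le> E"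
    using gain yz unfolding E_def q_def v_def by simp
  then have "val (tail n {} (last_triangle n) (n - 3)) x \<le> val (tail n {} {} (n - 6)) g"
    unfolding val_new val_old by (simp add: algebra_simps)
  then show ?thesis using tail_subset gw by (rule lag_le_of_better[rotated 2])
qed

text \<open>This configuration satisfies \<open>card M < b\<close> and is close to a colex segment, but too few
  edges \<open>{j, n + 1, n + 2}\<close> are available to be traded for all four missing triples. By symmetry
  the weights are described by five numbers, which by the first order conditions satisfy the
  assumptions of \<open>no_double_defect_weights\<close> after scaling.\<close>

lemma no_double_defect:
  assumes T: "tail_optimum n (star n (n - 2)) (star n (n - 2)) 3 x" and n2: "2 \<le> n"
  shows False
proof -
  interpret tail_optimum n "star n (n - 2)" "star n (n - 2)" 3 x by (rule T)
  define j k where "j = n - 2" and "k = n - 1"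
  have n6: "6 \<le> n"
  proof -
    have "{n - 2, n} \<in> star n (n - 2)" using n2 by (auto simp: star_def)
    then have "n - 2 \<in> {3<..n}" using pair_bounds by blast
    then show ?thesis by simp
  qed
  have less: "3 < j" "j < k" "k < n" using n6 by (auto simp: j_def k_def)
  have "{n - 2..<n} = {j, k}" using n6 by (auto simp: j_def k_def)
  then have vM: "val (star n (n - 2)) g = g n * (g j + g k)" for g
    unfolding val_star using less by simp
  have mid: "(\<Sum>v\<in>{3<..n}. g v) = (\<Sum>v\<in>{3<..<j}. g v) + g j + g k + g n" for g :: "nat \<Rightarrow> real"
  proof -
    have "{3<..n} = insert j (insert k (insert n {3<..<j}))" using n6 by (auto simp: j_def k_def)
    then show ?thesis using less by simp
  qed
  define A where "A = (\<Sum>v\<in>{3<..<j}. x v)"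
  let ?X = "x 1" and ?v = "x n" and ?z = "x (n + 2)"
  have mem: "1 \<in> {1..n + 2}" "j \<in> {1..n + 2}" "k \<in> {1..n + 2}" "n \<in> {1..n + 2}" "n + 1 \<in> {1..n + 2}"
    "n + 2 \<in> {1..n + 2}" using less by auto
  have A_upd: "(\<Sum>v\<in>{3<..<j}. (x(a := c, b := e)) v) = A" if "j \<le> a" "j \<le> b" for a b c e
    unfolding A_def using that by (auto intro!: sum.cong)
  have w: "x (n + 1) = ?z" by (rule last_twins) simp
  have valT: "val (tail n (star n (n - 2)) (star n (n - 2)) 3) g = val ([{1..n + 2}]\<^bsup>3\<^esup>) g
      - (g (n + 1) + g (n + 2)) * (g n * (g j + g k))
      - g (n + 1) * g (n + 2) * ((\<Sum>v\<in>{3<..<j}. g v) + g j + g k + g n)" for g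
    unfolding val_tail[OF adm] vM mid by (simp add: algebra_simps)
  have jk: "x j = x k"
  proof (rule twins[OF mem(2,3)])
    show ne: "j \<noteq> k" using less by simp
    show "0 < 1 - x j - x k" using two_lt_one[OF mem(2,3) ne] by simp
    fix \<delta>
    show "val (tail n (star n (n - 2)) (star n (n - 2)) 3) (x(j := x j + \<delta>, k := x k - \<delta>))
      = val (tail n (star n (n - 2)) (star n (n - 2)) 3) x + \<delta> * (x k - x j - \<delta>) * (1 - x j - x k)"
      using val_triples_transfer[OF finite_atLeastAtMost mem(2,3), of x \<delta>] less
      unfolding valT sum_all by (simp add: A_upd A_def[symmetric])
  qed
  have "head_weight = 3 * ?X"
  proof -
    have "head_weight = (\<Sum>v\<in>{1..3::nat}. ?X)" by (rule sum.cong[OF refl head_const])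
    then show ?thesis by simp
  qed
  note head = this
  have total: "3 * ?X + A + 2 * x k + ?v + 2 * ?z = 1"
    using sum_split mid[of x] unfolding sum_all head A_def[symmetric] w jk by simp
  have stat_v: "(x (n + 1) - ?v) * (1 - ?v - x (n + 1) - ?z - x j - x k) + ?z * A = 0"
  proof (rule stationary[OF mem(4,5), where \<beta> = "- (1 - ?v - x (n + 1) - ?z - x j - x k)"])
    fix \<delta>
    show "val (tail n (star n (n - 2)) (star n (n - 2)) 3) (x(n := x n + \<delta>, n + 1 := x (n + 1) - \<delta>))
      = val (tail n (star n (n - 2)) (star n (n - 2)) 3) x
        + ((x (n + 1) - ?v) * (1 - ?v - x (n + 1) - ?z - x j - x k) + ?z * A) * \<delta>
        + - (1 - ?v - x (n + 1) - ?z - x j - x k) * \<delta>\<^sup>2"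
      using val_triples_transfer[OF finite_atLeastAtMost mem(4,5), of x \<delta>] less
      unfolding valT sum_all by (simp add: A_upd A_def[symmetric] algebra_simps power2_eq_square)
  qed simp
  have coeff_v: "1 - ?v - x (n + 1) - ?z - x j - x k = 3 * ?X + A" using total w jk by simp
  have eq_v: "(?v - ?z) * (3 * ?X + A) = ?z * A"
    using stat_v unfolding coeff_v unfolding w by (simp add: algebra_simps)
  have stat_y: "(?v - x k) * (1 - x k - ?v - x (n + 1) - ?z) + (x (n + 1) + ?z) * x j = 0"
  proof (rule stationary[OF mem(3,4), where \<beta> = "- (1 - x k - ?v - x (n + 1) - ?z)"])
    show "k \<noteq> n" using less by simp
    fix \<delta>
    show "val (tail n (star n (n - 2)) (star n (n - 2)) 3) (x(k := x k + \<delta>, n := x n - \<delta>))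
      = val (tail n (star n (n - 2)) (star n (n - 2)) 3) x
        + ((?v - x k) * (1 - x k - ?v - x (n + 1) - ?z) + (x (n + 1) + ?z) * x j) * \<delta>
        + - (1 - x k - ?v - x (n + 1) - ?z) * \<delta>\<^sup>2"
      using val_triples_transfer[OF finite_atLeastAtMost mem(3,4), of x \<delta>] less
      unfolding valT sum_all by (simp add: A_upd A_def[symmetric] algebra_simps power2_eq_square)
  qed
  have coeff_y: "1 - x k - ?v - x (n + 1) - ?z = 3 * ?X + A + x k" using total w by simp
  have eq_y: "(x k - ?v) * (3 * ?X + A + x k) = 2 * ?z * x k"
    using stat_y unfolding coeff_y unfolding w jk by (simp add: algebra_simps)
  have z: "0 < ?z" by (rule last_pos)
  have T: "4 * (x k * ?v) < 3 * ?X * ?z"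
  proof -
    have "?z * (4 * (x k * ?v)) < ?z * (3 * ?X * ?z)"
      using val_N_small unfolding vM head w jk by (simp add: algebra_simps power2_eq_square)
    then show ?thesis using z by simp
  qed
  have K: "(?X - ?z) * (2 * ?X + A + 2 * x k + ?v + ?z) = 2 * ?v * x k + ?z * (A + 2 * x k + ?v)"
  proof -
    have coeff: "1 - ?X - ?z = 2 * ?X + A + 2 * x k + ?v + ?z" using total by simp
    show ?thesis
      using first_stationary unfolding w coeff unfolding vM mid A_def[symmetric] jk
      by (simp add: algebra_simps)
  qed
  have A: "A = 0 \<or> ?z \<le> A"
  proof (cases "4 < j")
    case True
    have "x 4 \<le> A" unfolding A_def using True less by (intro member_le_sum) (auto intro!: nonneg)
    moreover have "?z \<le> x 4" using True less by (intro dec) auto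
    ultimately show ?thesis by simp
  next
    case False
    then have "{3<..<j} = {}" using less by auto
    then show ?thesis by (simp add: A_def)
  qed
  define X' A' y' v' where "X' = ?X / ?z" and "A' = A / ?z" and "y' = x k / ?z" and "v' = ?v / ?z"
  have sc: "?X = X' * ?z" "A = A' * ?z" "x k = y' * ?z" "?v = v' * ?z"
    using z by (auto simp: X'_def A'_def y'_def v'_def)
  have zz: "?z * ?z \<noteq> 0" using z by simp
  show False
  proof (rule no_double_defect_weights[of v' X' A' y'])
    have "(?z * ?z) * (v' * (3 * X' + A')) = (?z * ?z) * (3 * X' + 2 * A')"
      using eq_v unfolding sc by (simp add: algebra_simps)
    then show "v' * (3 * X' + A') = 3 * X' + 2 * A'" using zz mult_left_cancel by blast
    have "(?z * ?z) * ((y' - v') * (3 * X' + A' + y')) = (?z * ?z) * (2 * y')"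
      using eq_y unfolding sc by (simp add: algebra_simps)
    then show "(y' - v') * (3 * X' + A' + y') = 2 * y'" using zz mult_left_cancel by blast
    have "(?z * ?z) * (4 * (y' * v')) < (?z * ?z) * (3 * X')"
      using T unfolding sc by (simp add: algebra_simps)
    then show "4 * (y' * v') < 3 * X'" using z by (simp add: mult_less_cancel_left)
    have "(?z * ?z) * ((2 - X') * (2 * X' + A' + 2 * y' + v' + 1)) = (?z * ?z) * (1 + 2 * X' - 2 * (y' * v'))"
      using K unfolding sc by (simp add: algebra_simps)
    then show "(2 - X') * (2 * X' + A' + 2 * y' + v' + 1) = 1 + 2 * X' - 2 * (y' * v')"
      using zz mult_left_cancel by blast
    show "X' < 2" unfolding X'_def using first_lt_last_two w z by (simp add: field_simps)
    show "A' = 0 \<or> 1 \<le> A'" using A z by (auto simp: A'_def)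
    show "1 \<le> v'" using dec[of n "n + 2"] less z by (simp add: v'_def)
    show "v' \<le> y'" unfolding v'_def y'_def using dec[of k n] less z by (simp add: divide_right_mono)
    show "y' \<le> X'" unfolding X'_def y'_def using dec[of 1 k] less z by (simp add: divide_right_mono)
  qed
qed

section \<open>Tail graphs with few missing edges\<close>

lemma lag_triples_le_tail:
  "lag (n + 2) ([{1..n + 1}]\<^bsup>3\<^esup>) \<le> lag (n + 2) (tail n {} {} b)"
  by (rule lag_mono[OF triples_subset_tail tail_subset]) simp

text \<open>Repeated trades of \<open>{b, n + 1, n + 2}\<close> for \<open>{r, n, n + 2}\<close>. An optimal weighting is
  chosen anew for each intermediate graph. If an intermediate graph does not beat the clique on
  \<open>{1..n + 1}\<close>, which the target contains, then nothing is left to show; this covers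
  \<open>b < n - r\<close>, where the subtraction is truncated.\<close>

lemma lag_star_le:
  assumes "b < r" "r \<le> n"
  shows "lag (n + 2) (tail n {} (star n r) b) \<le> lag (n + 2) (tail n {} {} (b - (n - r)))"
  using assms
proof (induction "n - r" arbitrary: r b)
  case 0
  then show ?case by (simp add: star_empty)
next
  case (Suc k)
  then have r: "r < n" by simp
  have adm: "admissible n {} (star n r) b"
    using admissible_star[of b r n n] Suc.prems by (simp add: star_empty)
  show ?case
  proof (cases "lag (n + 2) ([{1..n + 1}]\<^bsup>3\<^esup>) < lag (n + 2) (tail n {} (star n r) b)")
    case True
    then obtain x where x: "tail_optimum n {} (star n r) b x"
      using tail_optimum_exists[OF adm] r by auto
    have b: "1 \<le> b" by (rule tail_optimum.b_ge[OF x])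
    have adm': "admissible n {} (star n (r + 1)) (b - 1)"
      using admissible_star[of "b - 1" "r + 1" n n] Suc.prems r by (simp add: star_empty)
    have "lag (n + 2) (tail n {} (star n r) b) \<le> lag (n + 2) (tail n {} (star n (r + 1)) (b - 1))"
      using star_step[OF x Suc.prems(1) r _ adm'] by simp
    also have "\<dots> \<le> lag (n + 2) (tail n {} {} (b - 1 - (n - (r + 1))))"
      using Suc.hyps(2) Suc.prems r b by (intro Suc.hyps(1)) auto
    also have "b - 1 - (n - (r + 1)) = b - (n - r)" using b r by simp
    finally show ?thesis .
  next
    case False
    then show ?thesis using lag_triples_le_tail[of n "b - (n - r)"] by linarith
  qed
qed

lemma lag_single_defect_le:
  assumes "b < n - 1"
  shows "lag (n + 2) (tail n (star n (n - 1)) (star n (n - 1)) b) \<le> lag (n + 2) (tail n {} {} (b - 2))"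
proof (cases "lag (n + 2) ([{1..n + 1}]\<^bsup>3\<^esup>) < lag (n + 2) (tail n (star n (n - 1)) (star n (n - 1)) b)")
  case True
  have adm: "admissible n (star n (n - 1)) (star n (n - 1)) b"
    using admissible_star[of b "n - 1" n "n - 1"] assms by simp
  have n1: "1 \<le> n" using assms by simp
  obtain x where x: "tail_optimum n (star n (n - 1)) (star n (n - 1)) b x"
    by (rule tail_optimum_exists[OF adm n1 True])
  show ?thesis using single_defect_step[of n b x] x unfolding star_last[OF n1] by simp
next
  case False
  then show ?thesis using lag_triples_le_tail[of n "b - 2"] by linarith
qed

lemma lag_single_defect_star_le:
  assumes "b < n - 2"
  shows "lag (n + 2) (tail n (star n (n - 1)) (star n (n - 2)) b) \<le> lag (n + 2) (tail n {} {} (b - 3))"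
proof (cases "lag (n + 2) ([{1..n + 1}]\<^bsup>3\<^esup>) < lag (n + 2) (tail n (star n (n - 1)) (star n (n - 2)) b)")
  case True
  have adm: "admissible n (star n (n - 1)) (star n (n - 2)) b"
    using admissible_star[of b "n - 2" n "n - 1"] assms by simp
  have n1: "1 \<le> n" using assms by simp
  obtain x where x: "tail_optimum n (star n (n - 1)) (star n (n - 2)) b x"
    by (rule tail_optimum_exists[OF adm n1 True])
  have r: "n - 2 + 1 = n - 1" using assms by simp
  have adm': "admissible n (star n (n - 1)) (star n (n - 2 + 1)) (b - 1)"
    unfolding r using admissible_star[of "b - 1" "n - 1" n "n - 1"] assms by simp
  have "lag (n + 2) (tail n (star n (n - 1)) (star n (n - 2)) b)
      \<le> lag (n + 2) (tail n (star n (n - 1)) (star n (n - 2 + 1)) (b - 1))"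
    by (rule star_step[OF x assms _ _ adm']) (use assms star_last[OF n1] in auto)
  also have "\<dots> \<le> lag (n + 2) (tail n {} {} (b - 1 - 2))"
    unfolding r using assms by (intro lag_single_defect_le) simp
  also have "b - 1 - 2 = b - 3" by simp
  finally show ?thesis .
next
  case False
  then show ?thesis using lag_triples_le_tail[of n "b - 3"] by linarith
qed

lemma lag_last_triangle_le:
  assumes "admissible n {} (last_triangle n) b" "b + 3 \<le> n"
  shows "lag (n + 2) (tail n {} (last_triangle n) b) \<le> lag (n + 2) (tail n {} {} (b - 3))"
proof (cases "lag (n + 2) ([{1..n + 1}]\<^bsup>3\<^esup>) < lag (n + 2) (tail n {} (last_triangle n) b)")
  case True
  have n1: "1 \<le> n" using assms by simp
  obtain x where x: "tail_optimum n {} (last_triangle n) b x"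
    by (rule tail_optimum_exists[OF assms(1) n1 True])
  show ?thesis
  proof (cases "b + 4 \<le> n")
    case True
    have "lag (n + 2) (tail n {} (last_triangle n) b) \<le> lag (n + 2) (tail n {} (star n (n - 3)) b)"
      by (rule triangle_step[OF x True])
    also have "\<dots> \<le> lag (n + 2) (tail n {} {} (b - (n - (n - 3))))"
      using True by (intro lag_star_le) auto
    finally show ?thesis using True by simp
  next
    case False
    then have "b = n - 3" using assms by simp
    then show ?thesis using full_triangle_step[of n x] x by simp
  qed
next
  case False
  then show ?thesis using lag_triples_le_tail[of n "b - 3"] by linarith
qed

text \<open>Raising the larger element first keeps the two elements apart.\<close>

lemma up_closed_pairs:
  assumes U: "up_closed n U" and e: "{p, q} \<in> U" "p < q" and le: "p \<le> p'" "q \<le> q'" "p' < q'" "q' \<le> n"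
  shows "{p', q'} \<in> U"
proof -
  have "{p, q'} \<in> U"
  proof (cases "q = q'")
    case False
    then have "insert q' ({p, q} - {q}) \<in> U" using U e le by (auto simp: up_closed_def)
    moreover have "insert q' ({p, q} - {q}) = {p, q'}" using e by auto
    ultimately show ?thesis by simp
  qed (use e in simp)
  show ?thesis
  proof (cases "p = p'")
    case False
    then have "insert p' ({p, q'} - {p}) \<in> U"
      using U \<open>{p, q'} \<in> U\<close> e le by (auto simp: up_closed_def)
    moreover have "insert p' ({p, q'} - {p}) = {p', q'}" using e le by auto
    ultimately show ?thesis by simp
  qed (use \<open>{p, q'} \<in> U\<close> in simp)
qed

lemma star_numeral:
  "2 \<le> n \<Longrightarrow> star n (n - 2) = {{n - 1, n}, {n - 2, n}}"
  "3 \<le> n \<Longrightarrow> star n (n - 3) = {{n - 1, n}, {n - 2, n}, {n - 3, n}}"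
proof -
  show "star n (n - 2) = {{n - 1, n}, {n - 2, n}}" if "2 \<le> n"
  proof -
    have "{n - 2..<n} = {n - 1, n - 2}" using that by auto
    then show ?thesis by (simp add: star_def)
  qed
  show "star n (n - 3) = {{n - 1, n}, {n - 2, n}, {n - 3, n}}" if "3 \<le> n"
  proof -
    have "{n - 3..<n} = {n - 1, n - 2, n - 3}" using that by auto
    then show ?thesis by (simp add: star_def)
  qed
qed

text \<open>Raising vertices turns any pair into \<open>{n - 1, n}\<close>, any other pair into \<open>{n - 2, n}\<close>, and
  any pair different from these two into \<open>{n - 3, n}\<close> or \<open>{n - 2, n - 1}\<close>.\<close>

lemma small_up_closed:
  assumes U: "up_closed n U" "U \<subseteq> [{b<..n}]\<^bsup>2\<^esup>"
  shows "card U = 1 \<Longrightarrow> U = star n (n - 1) \<and> b + 2 \<le> n"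
    and "card U = 2 \<Longrightarrow> U = star n (n - 2) \<and> b + 3 \<le> n"
    and "card U = 3 \<Longrightarrow> U = star n (n - 3) \<and> b + 4 \<le> n \<or> U = last_triangle n \<and> b + 3 \<le> n"
proof -
  have fin: "finite U"
    using U(2) finite_imp_finite_nsets[of "{b<..n}" 2] by (auto intro: finite_subset)
  have el: "\<exists>p q. f = {p, q} \<and> b < p \<and> p < q \<and> q \<le> n" if "f \<in> U" for f
  proof -
    have "card f = 2" "f \<subseteq> {b<..n}" using that U(2) by (auto simp: nsets_def)
    then obtain p q where "f = {p, q}" "p \<noteq> q" "p \<in> {b<..n}" "q \<in> {b<..n}"
      by (auto simp: card_2_iff)
    moreover have "f = {q, p}" using calculation by auto
    ultimately show ?thesis
      by (metis greaterThanAtMost_iff linorder_neqE_nat)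
  qed
  have top: "{n - 1, n} \<in> U \<and> b + 2 \<le> n" if ne: "U \<noteq> {}"
  proof -
    obtain f where "f \<in> U" using ne by blast
    then obtain p q where "{p, q} \<in> U" "b < p" "p < q" "q \<le> n" using el by blast
    then show ?thesis using up_closed_pairs[OF U(1), of p q "n - 1" n] by auto
  qed
  have second: "{n - 2, n} \<in> U \<and> b + 3 \<le> n" if ns: "\<not> U \<subseteq> {{n - 1, n}}"
  proof -
    obtain f where f: "f \<in> U" "f \<noteq> {n - 1, n}" using ns by blast
    obtain p q where pq: "f = {p, q}" "b < p" "p < q" "q \<le> n" using el[OF f(1)] by blast
    then have "p \<noteq> n - 1 \<or> q \<noteq> n" using f by blast
    then have "p + 2 \<le> n" using pq by linarith
    then show ?thesis using up_closed_pairs[OF U(1), of p q "n - 2" n] pq f by auto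
  qed
  have third: "{n - 3, n} \<in> U \<and> b + 4 \<le> n \<or> {n - 2, n - 1} \<in> U" if ns: "\<not> U \<subseteq> {{n - 1, n}, {n - 2, n}}"
  proof -
    obtain f where f: "f \<in> U" "f \<noteq> {n - 1, n}" "f \<noteq> {n - 2, n}" using ns by blast
    obtain p q where pq: "f = {p, q}" "b < p" "p < q" "q \<le> n" using el[OF f(1)] by blast
    show ?thesis
    proof (cases "q = n")
      case True
      then have "p \<noteq> n - 1" "p \<noteq> n - 2" using f pq by auto
      then have "p + 3 \<le> n" using pq True by linarith
      then show ?thesis using up_closed_pairs[OF U(1), of p q "n - 3" n] pq f by auto
    next
      case False
      then show ?thesis using up_closed_pairs[OF U(1), of p q "n - 2" "n - 1"] pq f by auto
    qed
  qed
  show "card U = 1 \<Longrightarrow> U = star n (n - 1) \<and> b + 2 \<le> n"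
  proof -
    assume c: "card U = 1"
    then have t: "{n - 1, n} \<in> U \<and> b + 2 \<le> n" using top by force
    then have "U = {{n - 1, n}}" using c by (metis card_1_singletonE singletonD)
    then show ?thesis using t star_last[of n] by auto
  qed
  have two: "{n - 1, n} \<in> U \<and> {n - 2, n} \<in> U \<and> b + 3 \<le> n" if "2 \<le> card U"
  proof -
    have "\<not> U \<subseteq> {{n - 1, n}}" using that card_mono[of "{{n - 1, n}}" U] by auto
    then show ?thesis using second top by blast
  qed
  have ne: "card {{n - 1, n}, {n - 2, n}} = 2" if "2 \<le> n"
  proof -
    have "n - 2 \<noteq> n - 1" "n - 1 \<noteq> n" "n - 2 \<noteq> n" using that by auto
    then show ?thesis by (simp add: doubleton_eq_iff)
  qed
  show "card U = 2 \<Longrightarrow> U = star n (n - 2) \<and> b + 3 \<le> n"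
  proof -
    assume c: "card U = 2"
    then have t: "{n - 1, n} \<in> U \<and> {n - 2, n} \<in> U \<and> b + 3 \<le> n" using two by simp
    then have "{{n - 1, n}, {n - 2, n}} = U" using c ne by (intro card_subset_eq[OF fin]) auto
    then show ?thesis using t star_numeral(1)[of n] by auto
  qed
  show "card U = 3 \<Longrightarrow> U = star n (n - 3) \<and> b + 4 \<le> n \<or> U = last_triangle n \<and> b + 3 \<le> n"
  proof -
    assume c: "card U = 3"
    then have t: "{n - 1, n} \<in> U \<and> {n - 2, n} \<in> U \<and> b + 3 \<le> n" using two by simp
    have "\<not> U \<subseteq> {{n - 1, n}, {n - 2, n}}"
      using c ne t card_mono[of "{{n - 1, n}, {n - 2, n}}" U] by auto
    then consider "{n - 3, n} \<in> U" "b + 4 \<le> n" | "{n - 2, n - 1} \<in> U" using third by blast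
    then show ?thesis
    proof cases
      case 1
      then have "n - 3 \<noteq> n - 1" "n - 3 \<noteq> n - 2" "n - 2 \<noteq> n - 1" "n - 1 \<noteq> n" "n - 2 \<noteq> n" "n - 3 \<noteq> n" by auto
      then have "card {{n - 1, n}, {n - 2, n}, {n - 3, n}} = 3" by (simp add: doubleton_eq_iff)
      then have "{{n - 1, n}, {n - 2, n}, {n - 3, n}} = U"
        using c 1 t by (intro card_subset_eq[OF fin]) auto
      then show ?thesis using 1 star_numeral(2)[of n] by auto
    next
      case 2
      have "n - 2 \<noteq> n - 1" "n - 1 \<noteq> n" "n - 2 \<noteq> n" using t by auto
      then have "card (last_triangle n) = 3" by (simp add: last_triangle_def doubleton_eq_iff)
      moreover have "last_triangle n \<subseteq> U" using 2 t by (simp add: last_triangle_def)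
      ultimately have "last_triangle n = U" using c by (intro card_subset_eq[OF fin]) auto
      then show ?thesis using t by simp
    qed
  qed
qed

text \<open>As \<open>N \<subseteq> M\<close>, at most one pair is in \<open>N\<close>, and \<open>M\<close> is a star with at most three edges or a
  triangle.\<close>

lemma lag_tail_le:
  assumes adm: "admissible n N M b" and n: "1 \<le> n" and c: "card N + card M \<le> 3" "card N + card M \<le> b"
  shows "lag (n + 2) (tail n N M b) \<le> lag (n + 2) (tail n {} {} (b - (card N + card M)))"
proof -
  note pairs = admissible_pairs[OF adm]
  have up: "up_closed n N" "up_closed n M" using adm by (auto simp: admissible_def)
  have "N \<subseteq> M" using adm by (simp add: admissible_def)
  then have le: "card N \<le> card M" using pairs by (intro card_mono)
  note smallM = small_up_closed[OF up(2) pairs(4)]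
  note smallN = small_up_closed[OF up(1) pairs(3)]
  consider "card N = 0" "card M = 0" | "card N = 0" "card M = 1" | "card N = 0" "card M = 2"
    | "card N = 0" "card M = 3" | "card N = 1" "card M = 1" | "card N = 1" "card M = 2"
    using le c(1) by linarith
  then show ?thesis
  proof cases
    case 1
    then show ?thesis using pairs by simp
  next
    case 2
    then have "N = {}" "M = star n (n - 1)" "b + 2 \<le> n" using smallM(1) pairs by auto
    moreover from this have sum: "card N + card M = n - (n - 1)" by (simp add: card_star)
    ultimately show ?thesis unfolding sum using lag_star_le[of b "n - 1" n] by simp
  next
    case 3
    then have "N = {}" "M = star n (n - 2)" "b + 3 \<le> n" using smallM(2) pairs by auto
    moreover from this have sum: "card N + card M = n - (n - 2)" by (simp add: card_star)
    ultimately show ?thesis unfolding sum using lag_star_le[of b "n - 2" n] by simp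
  next
    case 4
    then have N: "N = {}" using pairs by auto
    from smallM(3)[OF 4(2)] show ?thesis
    proof
      assume "M = star n (n - 3) \<and> b + 4 \<le> n"
      then have M: "M = star n (n - 3)" "b + 4 \<le> n" by auto
      then have sum: "card N + card M = n - (n - 3)" using N by (simp add: card_star)
      show ?thesis unfolding sum using N M lag_star_le[of b "n - 3" n] by simp
    next
      assume "M = last_triangle n \<and> b + 3 \<le> n"
      then have "M = last_triangle n" "b + 3 \<le> n" by auto
      then show ?thesis using N 4 lag_last_triangle_le[of n b] adm by simp
    qed
  next
    case 5
    then have eq: "N = star n (n - 1)" "M = star n (n - 1)" "b + 2 \<le> n" using smallM(1) smallN(1) by auto
    have sum: "card N + card M = 2" using 5 by simp
    show ?thesis unfolding sum using lag_single_defect_le[of b n] eq by simp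
  next
    case 6
    then have eq: "N = star n (n - 1)" "M = star n (n - 2)" "b + 3 \<le> n" using smallM(2) smallN(1) by auto
    have sum: "card N + card M = 3" using 6 by simp
    show ?thesis unfolding sum using lag_single_defect_star_le[of b n] eq by simp
  qed
qed

lemma lag_double_defect_le:
  assumes adm: "admissible n N M 3" and c: "card N = 2" "card M = 2"
  shows "lag (n + 2) (tail n N M 3) \<le> lag (n + 2) ([{1..n + 1}]\<^bsup>3\<^esup>)"
proof (rule ccontr)
  assume "\<not> ?thesis"
  then have gt: "lag (n + 2) ([{1..n + 1}]\<^bsup>3\<^esup>) < lag (n + 2) (tail n N M 3)" by simp
  note pairs = admissible_pairs[OF adm]
  have up: "up_closed n N" "up_closed n M" using adm by (auto simp: admissible_def)
  have M: "M = star n (n - 2)" "N = star n (n - 2)" "6 \<le> n"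
    using small_up_closed(2)[OF up(2) pairs(4)] small_up_closed(2)[OF up(1) pairs(3)] c by auto
  have n1: "1 \<le> n" using M by simp
  obtain x where "tail_optimum n N M 3 x" by (rule tail_optimum_exists[OF adm n1 gt])
  then show False using no_double_defect[of n x] M by simp
qed

text \<open>Membership of \<open>{j, n + 1, n + 2}\<close> is a downward closed condition on \<open>j\<close>, so these edges
  are given by their number \<open>b\<close>.\<close>

lemma shifted_is_tail:
  assumes E: "shifted E" "E \<subseteq> [{1..n + 2}]\<^bsup>3\<^esup>" "[{1..n}]\<^bsup>3\<^esup> \<subseteq> E"
  obtains N M b where "admissible n N M b" "E = tail n N M b"
proof -
  define N where "N = {f \<in> [{1..n}]\<^bsup>2\<^esup>. insert (n + 1) f \<notin> E}"
  define M where "M = {f \<in> [{1..n}]\<^bsup>2\<^esup>. insert (n + 2) f \<notin> E}"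
  define J where "J = {j \<in> {1..n}. {j, n + 1, n + 2} \<in> E}"
  define b where "b = card J"
  have sh: "insert i (e - {j}) \<in> E" if "e \<in> E" "j \<in> e" "1 \<le> i" "i < j" "i \<notin> e" for e i j
    using E(1) that by (auto simp: shifted_def)
  have down: "i \<in> J" if "j \<in> J" "1 \<le> i" "i \<le> j" for i j
  proof (cases "i = j")
    case False
    then have "insert i ({j, n + 1, n + 2} - {j}) \<in> E"
      using that by (intro sh) (auto simp: J_def)
    moreover have "insert i ({j, n + 1, n + 2} - {j}) = {i, n + 1, n + 2}"
      using that by (auto simp: J_def)
    ultimately show ?thesis using that by (simp add: J_def)
  qed (use that in simp)
  have finJ: "finite J" by (simp add: J_def)
  have J: "J = {1..b}"
  proof (cases "J = {}")
    case False
    have "{1..Max J} \<subseteq> J" using down[OF Max_in[OF finJ False]] by auto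
    moreover have "J \<subseteq> {1..Max J}" using finJ by (auto simp: J_def)
    ultimately obtain k where "J = {1..k}" by blast
    then show ?thesis by (simp add: b_def)
  qed (simp add: b_def)
  have "card J \<le> card {1..n}" by (rule card_mono) (auto simp: J_def)
  then have bn: "b \<le> n" by (simp add: b_def)
  have up: "up_closed n {f \<in> [{1..n}]\<^bsup>2\<^esup>. insert a f \<notin> E}" if "n < a" for a
    unfolding up_closed_def
  proof (intro ballI allI impI, elim conjE)
    fix f i j assume f: "f \<in> {f \<in> [{1..n}]\<^bsup>2\<^esup>. insert a f \<notin> E}" and i: "i \<in> f"
      and j: "i < j" "j \<le> n" "j \<notin> f"
    have f': "f \<subseteq> {1..n}" "finite f" "card f = 2" using f by (auto simp: nsets_def)
    let ?g = "insert j (f - {i})"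
    have "card ?g = 2" using f' i j by (simp add: card_insert_if)
    then have g: "?g \<in> [{1..n}]\<^bsup>2\<^esup>" using f' i j by (auto simp: nsets_def)
    have "insert a ?g \<notin> E"
    proof
      assume "insert a ?g \<in> E"
      moreover have "1 \<le> i" "i \<notin> insert a ?g" using f' i j that by auto
      ultimately have "insert i (insert a ?g - {j}) \<in> E" using j by (intro sh) auto
      moreover have "insert i (insert a ?g - {j}) = insert a f" using i j that by auto
      ultimately show False using f by simp
    qed
    then show "?g \<in> {f \<in> [{1..n}]\<^bsup>2\<^esup>. insert a f \<notin> E}" using g by simp
  qed
  have NM: "N \<subseteq> M"
  proof
    fix f assume f: "f \<in> N"
    then have f': "f \<subseteq> {1..n}" by (auto simp: N_def nsets_def)
    have "insert (n + 2) f \<notin> E"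
    proof
      assume "insert (n + 2) f \<in> E"
      then have "insert (n + 1) (insert (n + 2) f - {n + 2}) \<in> E" using f' by (intro sh) auto
      moreover have "insert (n + 1) (insert (n + 2) f - {n + 2}) = insert (n + 1) f" using f' by auto
      ultimately show False using f by (simp add: N_def)
    qed
    then show "f \<in> M" using f by (simp add: M_def N_def)
  qed
  have Mb: "M \<subseteq> [{b<..n}]\<^bsup>2\<^esup>"
  proof
    fix f assume f: "f \<in> M"
    then have f': "f \<subseteq> {1..n}" "card f = 2" "finite f" "insert (n + 2) f \<notin> E"
      by (auto simp: M_def nsets_def)
    have "b < p" if p: "p \<in> f" for p
    proof (rule ccontr)
      assume "\<not> b < p"
      then have "p \<in> J" using p f' J by auto
      obtain q where q: "f = {p, q}" "p \<noteq> q"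
        using f'(2) p by (metis card_2_iff insert_commute insertE singletonD)
      have "insert q ({p, n + 1, n + 2} - {n + 1}) \<in> E"
        using \<open>p \<in> J\<close> q f' by (intro sh) (auto simp: J_def)
      moreover have "insert q ({p, n + 1, n + 2} - {n + 1}) = insert (n + 2) f" using q f' by auto
      ultimately show False using f' by simp
    qed
    then show "f \<in> [{b<..n}]\<^bsup>2\<^esup>" using f' by (auto simp: nsets_def)
  qed
  have "admissible n N M b"
    using bn NM Mb up[of "n + 1"] up[of "n + 2"] by (simp add: admissible_def N_def M_def)
  moreover have "E = tail n N M b"
  proof -
    have "e \<notin> E \<longleftrightarrow> e \<in> tail_missing n N M b" if e: "e \<in> [{1..n + 2}]\<^bsup>3\<^esup>" for e
    proof -
      have e': "e \<subseteq> {1..n + 2}" "finite e" "card e = 3" using e by (auto simp: nsets_def)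
      have rest: "e - {a} \<in> [{1..n}]\<^bsup>2\<^esup>" if "a \<in> e" "e \<subseteq> insert a {1..n}" for a
        using that e' by (auto simp: nsets_def)
      show ?thesis
      proof
        assume "e \<notin> E"
        then have "\<not> e \<subseteq> {1..n}" using E(3) e' by (auto simp: nsets_def)
        then obtain v where "v \<in> e" "v \<notin> {1..n}" by blast
        then have "n + 1 \<in> e \<or> n + 2 \<in> e" using e' by (cases "v = n + 1"; cases "v = n + 2") auto
        then consider "n + 1 \<in> e" "n + 2 \<in> e" | "n + 1 \<in> e" "n + 2 \<notin> e" | "n + 1 \<notin> e" "n + 2 \<in> e"
          by blast
        then show "e \<in> tail_missing n N M b"
        proof cases
          case 1
          then have "card (e - {n + 1, n + 2}) = 1" using e' by (simp add: card_Diff_subset)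
          then obtain j where j: "e - {n + 1, n + 2} = {j}" by (rule card_1_singletonE)
          then have "e = {j, n + 1, n + 2}" using 1 by blast
          moreover have "j \<in> {1..n + 2}" "j \<noteq> n + 1" "j \<noteq> n + 2" using j e' by blast+
          then have "j \<in> {1..n}" by auto
          moreover have "j \<notin> J" using \<open>e \<notin> E\<close> calculation by (simp add: J_def)
          ultimately show ?thesis using J by (auto simp: tail_missing_def)
        next
          case 2
          have "e \<subseteq> insert (n + 1) {1..n}"
          proof
            fix v assume "v \<in> e"
            then have "v \<in> {1..n + 2}" "v \<noteq> n + 2" using e' 2 by blast+
            then show "v \<in> insert (n + 1) {1..n}" by auto
          qed
          then have "e - {n + 1} \<in> [{1..n}]\<^bsup>2\<^esup>" using 2 by (intro rest) auto
          moreover have "insert (n + 1) (e - {n + 1}) = e" using 2 by auto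
          ultimately have "e - {n + 1} \<in> N" using \<open>e \<notin> E\<close> by (simp add: N_def)
          then have "insert (n + 1) (e - {n + 1}) \<in> tail_missing n N M b"
            unfolding tail_missing_def by - (rule UnI1, rule UnI1, erule imageI)
          then show ?thesis using \<open>insert (n + 1) (e - {n + 1}) = e\<close> by simp
        next
          case 3
          have "e \<subseteq> insert (n + 2) {1..n}"
          proof
            fix v assume "v \<in> e"
            then have "v \<in> {1..n + 2}" "v \<noteq> n + 1" using e' 3 by blast+
            then show "v \<in> insert (n + 2) {1..n}" by auto
          qed
          then have "e - {n + 2} \<in> [{1..n}]\<^bsup>2\<^esup>" using 3 by (intro rest) auto
          moreover have "insert (n + 2) (e - {n + 2}) = e" using 3 by auto
          ultimately have "e - {n + 2} \<in> M" using \<open>e \<notin> E\<close> by (simp add: M_def)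
          then have "insert (n + 2) (e - {n + 2}) \<in> tail_missing n N M b"
            unfolding tail_missing_def by - (rule UnI1, rule UnI2, erule imageI)
          then show ?thesis using \<open>insert (n + 2) (e - {n + 2}) = e\<close> by simp
        qed
      next
        assume "e \<in> tail_missing n N M b"
        then consider f where "f \<in> N" "e = insert (n + 1) f" | f where "f \<in> M" "e = insert (n + 2) f"
          | j where "j \<in> {b<..n}" "e = {j, n + 1, n + 2}" by (auto simp: tail_missing_def)
        then show "e \<notin> E"
        proof cases
          case 3
          then have "j \<notin> J" unfolding J by auto
          then show ?thesis using 3 by (auto simp: J_def)
        qed (auto simp: N_def M_def)
      qed
    qed
    then show ?thesis using E(2) by (auto simp: tail_def)
  qed
  ultimately show ?thesis by (rule that)
qed

section \<open>Initial segments of the colex order\<close>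

text \<open>Colex order compares binary expansions. This makes the order linear and well-founded at
  no cost.\<close>

lemma colex_less_iff_encode:
  assumes "finite A" "finite B"
  shows "colex_less A B \<longleftrightarrow> set_encode A < set_encode B"
proof -
  have less: "set_encode A < set_encode B" if fin: "finite A" "finite B" and c: "colex_less A B" for A B
  proof -
    let ?M = "Max (sym_diff A B)"
    have ne: "A \<noteq> B" "?M \<in> B" using c by (auto simp: colex_less_def)
    have Min: "?M \<in> sym_diff A B" using fin ne by (intro Max_in) auto
    have le: "v < ?M" if "v \<in> A - B" for v
    proof -
      have "v \<le> ?M" using that fin by (intro Max_ge) auto
      moreover have "v \<noteq> ?M" using that ne by blast
      ultimately show ?thesis by simp
    qed
    have "set_encode (A - B) \<le> set_encode {..<?M}"
      unfolding set_encode_def using le fin by (intro sum_mono2) auto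
    also have "set_encode {..<?M} = 2 ^ ?M - 1"
      unfolding set_encode_def by (simp add: mask_eq_sum_exp_nat[symmetric] lessThan_def)
    also have "\<dots> < 2 ^ ?M" by simp
    also have "\<dots> \<le> set_encode (B - A)"
      unfolding set_encode_def using Min ne fin by (intro member_le_sum) auto
    finally have "set_encode (A - B) < set_encode (B - A)" .
    moreover have "set_encode A = set_encode (A \<inter> B) + set_encode (A - B)"
      unfolding set_encode_def using fin by (metis sum.Int_Diff)
    moreover have "set_encode B = set_encode (A \<inter> B) + set_encode (B - A)"
      unfolding set_encode_def using fin by (metis sum.Int_Diff Int_commute)
    ultimately show ?thesis by simp
  qed
  have "A = B \<or> colex_less A B \<or> colex_less B A"
  proof (cases "A = B")
    case False
    then have "Max (sym_diff A B) \<in> sym_diff A B" using assms by (intro Max_in) auto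
    moreover have "sym_diff A B = sym_diff B A" by blast
    ultimately show ?thesis using False by (auto simp: colex_less_def)
  qed simp
  then show ?thesis by (metis less[OF assms] less[OF assms(2,1)] less_asym less_irrefl)
qed

definition colex_initial :: "nat set set \<Rightarrow> bool" where
  "colex_initial F \<longleftrightarrow> finite F \<and> F \<subseteq> [{1..}]\<^bsup>3\<^esup> \<and>
     (\<forall>B\<in>F. \<forall>A\<in>[{1..}]\<^bsup>3\<^esup>. colex_less A B \<longrightarrow> A \<in> F)"

lemma triples_encode:
  assumes "A \<in> [{1..}]\<^bsup>3\<^esup>" "B \<in> [{1..}]\<^bsup>3\<^esup>"
  shows "colex_less A B \<longleftrightarrow> set_encode A < set_encode B"
    and "set_encode A = set_encode B \<longleftrightarrow> A = B"
  using assms by (auto simp: colex_less_iff_encode nsets_def set_encode_eq)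

text \<open>In a linear order, an initial segment consists of the elements with fewer predecessors
  than it has elements.\<close>

lemma colex_edges_card:
  assumes F: "colex_initial F"
  shows "colex_edges (card F) = F"
proof (intro equalityI subsetI)
  have fin: "finite F" and sub: "F \<subseteq> [{1..}]\<^bsup>3\<^esup>"
    and down: "\<And>A B. B \<in> F \<Longrightarrow> A \<in> [{1..}]\<^bsup>3\<^esup> \<Longrightarrow> colex_less A B \<Longrightarrow> A \<in> F"
    using F by (auto simp: colex_initial_def)
  fix B
  show "B \<in> F" if B: "B \<in> colex_edges (card F)"
  proof (rule ccontr)
    assume nB: "B \<notin> F"
    have B3: "B \<in> [{1..}]\<^bsup>3\<^esup>" using B by (simp add: colex_edges_def)
    have "F \<subseteq> {A \<in> [{1..}]\<^bsup>3\<^esup>. colex_less A B}"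
    proof
      fix A assume A: "A \<in> F"
      then have A3: "A \<in> [{1..}]\<^bsup>3\<^esup>" using sub by blast
      have "\<not> colex_less B A" using down[OF A B3] nB by blast
      moreover have "A \<noteq> B" using A nB by blast
      ultimately have "colex_less A B" using triples_encode[OF A3 B3] triples_encode(1)[OF B3 A3] by force
      then show "A \<in> {A \<in> [{1..}]\<^bsup>3\<^esup>. colex_less A B}" using A3 by simp
    qed
    then have "card F \<le> card {A \<in> [{1..}]\<^bsup>3\<^esup>. colex_less A B}"
      by (intro card_mono finite_colex_predecessors[OF B3])
    then show False using B by (simp add: colex_edges_def)
  qed
  show "B \<in> colex_edges (card F)" if B: "B \<in> F"
  proof -
    have "{A \<in> [{1..}]\<^bsup>3\<^esup>. colex_less A B} \<subseteq> F - {B}"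
      using down[OF B] by (auto simp: colex_less_def)
    then have "card {A \<in> [{1..}]\<^bsup>3\<^esup>. colex_less A B} \<le> card (F - {B})"
      using fin by (intro card_mono) auto
    also have "\<dots> < card F" using B fin by (intro psubset_card_mono) auto
    finally show ?thesis using B sub by (auto simp: colex_edges_def)
  qed
qed

lemma colex_initial_exists: "\<exists>F. colex_initial F \<and> card F = m"
proof (induction m)
  case 0
  show ?case by (rule exI[of _ "{}"]) (simp add: colex_initial_def)
next
  case (Suc m)
  then obtain F where F: "colex_initial F" "card F = m" by blast
  have fin: "finite F" using F by (simp add: colex_initial_def)
  have "\<exists>B. B \<in> [{1..}]\<^bsup>3\<^esup> - F"
  proof (rule ccontr)
    assume "\<nexists>B. B \<in> [{1..}]\<^bsup>3\<^esup> - F"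
    then have "(\<lambda>k. {1, 2, k + 3}) ` UNIV \<subseteq> F" by (auto simp: nsets_def)
    moreover have "inj (\<lambda>k::nat. {1, 2, k + 3})"
    proof (rule injI)
      fix i j :: nat assume "{1, 2, i + 3} = {1, 2, j + 3}"
      then have "i + 3 \<in> {1, 2, j + 3}" by blast
      then show "i = j" by simp
    qed
    ultimately show False using fin by (meson finite_subset finite_imageD infinite_UNIV_nat)
  qed
  then obtain B where B: "B \<in> [{1..}]\<^bsup>3\<^esup> - F"
    and Bmin: "\<And>A. A \<in> [{1..}]\<^bsup>3\<^esup> - F \<Longrightarrow> set_encode B \<le> set_encode A"
    using ex_has_least_nat[of "\<lambda>B. B \<in> [{1..}]\<^bsup>3\<^esup> - F" _ set_encode] by metis
  have "A \<in> insert B F" if "A \<in> [{1..}]\<^bsup>3\<^esup>" "colex_less A B" for A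
    using Bmin[of A] that B triples_encode(1)[of A B] by fastforce
  then have "colex_initial (insert B F)"
    using F(1) B unfolding colex_initial_def by blast
  moreover have "card (insert B F) = Suc m" using B fin F by simp
  ultimately show ?case by blast
qed

lemma colex_edges_initial: "colex_initial (colex_edges m)" "card (colex_edges m) = m"
  using colex_initial_exists[of m] colex_edges_card by auto

lemma colex_edges_mono: "m \<le> m' \<Longrightarrow> colex_edges m \<subseteq> colex_edges m'"
  by (auto simp: colex_edges_def)

text \<open>For the largest vertex \<open>t = n + 2\<close> that occurs, some edge contains \<open>t\<close>, and every triple
  below \<open>t\<close> precedes this edge.\<close>

lemma colex_graph_shape:
  assumes "0 < m"
  obtains n where "1 \<le> n" "colex_edges m \<subseteq> [{1..n + 2}]\<^bsup>3\<^esup>" "[{1..n + 1}]\<^bsup>3\<^esup> \<subseteq> colex_edges m"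
    "\<Union>(colex_edges m) = {1..n + 2}"
proof -
  let ?C = "colex_edges m"
  have C: "finite ?C" "?C \<subseteq> [{1..}]\<^bsup>3\<^esup>" "\<And>A B. B \<in> ?C \<Longrightarrow> A \<in> [{1..}]\<^bsup>3\<^esup> \<Longrightarrow> colex_less A B \<Longrightarrow> A \<in> ?C"
    using colex_edges_initial(1)[of m] by (auto simp: colex_initial_def)
  have "?C \<noteq> {}" using colex_edges_initial(2)[of m] assms by auto
  then obtain e0 where "e0 \<in> ?C" by blast
  have fin: "finite (\<Union>?C)" using C by (auto simp: nsets_def)
  define t where "t = Max (\<Union>?C)"
  have "e0 \<noteq> {}" using \<open>e0 \<in> ?C\<close> C(2) by (auto simp: nsets_def)
  then have "t \<in> \<Union>?C" unfolding t_def using fin \<open>e0 \<in> ?C\<close> by (intro Max_in) auto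
  then obtain e where e: "e \<in> ?C" "t \<in> e" by blast
  have sub: "?C \<subseteq> [{1..t}]\<^bsup>3\<^esup>"
  proof
    fix f assume f: "f \<in> ?C"
    then have "f \<subseteq> {1..}" "finite f" "card f = 3" using C(2) by (auto simp: nsets_def)
    moreover have "v \<le> t" if "v \<in> f" for v unfolding t_def using that f fin by (intro Max_ge) auto
    ultimately show "f \<in> [{1..t}]\<^bsup>3\<^esup>" by (auto simp: nsets_def)
  qed
  have e3: "e \<subseteq> {1..t}" "card e = 3" "finite e" using sub e by (auto simp: nsets_def)
  have t3: "3 \<le> t" using card_mono[OF _ e3(1)] e3 by simp
  have K: "[{1..t - 1}]\<^bsup>3\<^esup> \<subseteq> ?C"
  proof
    fix A assume A: "A \<in> [{1..t - 1}]\<^bsup>3\<^esup>"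
    then have A': "A \<subseteq> {1..t - 1}" "finite A" "card A = 3" by (auto simp: nsets_def)
    have tA: "t \<notin> A" using A' t3 by auto
    have "Max (sym_diff A e) = t"
    proof (rule Max_eqI)
      show "finite (sym_diff A e)" using A' e3 by simp
      show "t \<in> sym_diff A e" using e tA by simp
      fix v assume "v \<in> sym_diff A e"
      then have "v \<in> {1..t - 1} \<or> v \<in> {1..t}" using A' e3 by blast
      then show "v \<le> t" by auto
    qed
    then have "colex_less A e" using e tA by (auto simp: colex_less_def)
    moreover have "A \<in> [{1..}]\<^bsup>3\<^esup>" using A' by (auto simp: nsets_def)
    ultimately show "A \<in> ?C" using C(3) e by blast
  qed
  have U: "\<Union>?C = {1..t}"
  proof (intro equalityI subsetI)
    fix v assume "v \<in> \<Union>?C"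
    then obtain X where "v \<in> X" "X \<in> [{1..t}]\<^bsup>3\<^esup>" using sub by blast
    then show "v \<in> {1..t}" by (auto simp: nsets_def)
  next
    fix v assume v: "v \<in> {1..t}"
    show "v \<in> \<Union>?C"
    proof (cases "t = 3 \<or> v = t")
      case True
      then have "v \<in> e" using v e e3 card_subset_eq[of "{1..t}" e] by auto
      then show ?thesis using e by blast
    next
      case False
      then have "2 \<le> card ({1..t - 1} - {v})" using v t3 by auto
      then obtain T where T: "T \<subseteq> {1..t - 1} - {v}" "card T = 2" "finite T"
        by (rule obtain_subset_with_card_n)
      then have "insert v T \<in> [{1..t - 1}]\<^bsup>3\<^esup>" using v False by (auto simp: nsets_def card_insert_if)
      then show ?thesis using K by blast
    qed
  qed
  define n where "n = t - 2"
  have "t = n + 2" "t - 1 = n + 1" "1 \<le> n" using t3 by (auto simp: n_def)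
  then show ?thesis using that[of n] sub K U by simp
qed

lemma tail_empty_initial:
  assumes "b \<le> n"
  shows "colex_initial (tail n {} {} b)"
  unfolding colex_initial_def
proof (intro conjI ballI impI)
  show "finite (tail n {} {} b)" by (rule finite_subset[OF tail_subset finite_triples])
  show "tail n {} {} b \<subseteq> [{1..}]\<^bsup>3\<^esup>" by (auto simp: tail_def nsets_def)
  fix B A assume B: "B \<in> tail n {} {} b" and A: "A \<in> [{1..}]\<^bsup>3\<^esup>" and less: "colex_less A B"
  have B': "B \<subseteq> {1..n + 2}" "card B = 3" "finite B" using B by (auto simp: tail_def nsets_def)
  have A': "A \<subseteq> {1..}" "card A = 3" "finite A" using A by (auto simp: nsets_def)
  have "B \<in> [{1..}]\<^bsup>3\<^esup>" using B' by (auto simp: nsets_def)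
  then have "A \<subseteq> {1..Max B}" using colex_less_Max_le[OF A _ less] by simp
  moreover have "Max B \<in> B" using B' by (intro Max_in) auto
  ultimately have A2: "A \<subseteq> {1..n + 2}" using B' by fastforce
  have "A \<notin> tail_missing n {} {} b"
  proof
    assume "A \<in> tail_missing n {} {} b"
    then obtain j where j: "j \<in> {b<..n}" "A = {j, n + 1, n + 2}" by (auto simp: tail_missing_def)
    let ?M = "Max (sym_diff A B)"
    have M: "?M \<in> B" "A \<noteq> B" using less by (auto simp: colex_less_def)
    have "?M \<in> sym_diff A B" using A' B' M by (intro Max_in) auto
    then have MA: "?M \<notin> A" using M by blast
    have ge: "v \<le> ?M" if "v \<in> A - B" for v using that A' B' by (intro Max_ge) auto
    have "?M \<le> n + 2" using M B' by auto
    then have "?M \<le> n" using MA j by (cases "?M = n + 1"; cases "?M = n + 2") auto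
    then have "n + 1 \<in> B" "n + 2 \<in> B" using ge[of "n + 1"] ge[of "n + 2"] j by auto
    moreover have "?M \<noteq> n + 1" "?M \<noteq> n + 2" using \<open>?M \<le> n\<close> by auto
    ultimately have "{?M, n + 1, n + 2} = B" using M B' by (intro card_subset_eq) auto
    have "j \<noteq> ?M" using MA j by blast
    moreover have "j \<notin> B"
    proof
      assume "j \<in> B"
      then have "j \<in> {?M, n + 1, n + 2}" using \<open>{?M, n + 1, n + 2} = B\<close> by simp
      then have "j = n + 1 \<or> j = n + 2" using \<open>j \<noteq> ?M\<close> by blast
      then show False using j(1) by auto
    qed
    then have "j \<le> ?M" using j(2) by (intro ge) blast
    ultimately have "j < ?M" by linarith
    then have "B \<in> tail_missing n {} {} b"
      using \<open>{?M, n + 1, n + 2} = B\<close> \<open>?M \<le> n\<close> j by (auto simp: tail_missing_def)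
    then show False using B by (simp add: tail_def)
  qed
  then show "A \<in> tail n {} {} b" using A' A2 by (auto simp: tail_def nsets_def)
qed

section \<open>Graphs close to a colex segment\<close>

lemma edge_vertex: "E \<subseteq> [V]\<^bsup>k\<^esup> \<Longrightarrow> e \<in> E \<Longrightarrow> v \<in> e \<Longrightarrow> v \<in> V"
  by (auto simp: nsets_def)

lemma left_compressed_shifted:
  assumes G: "left_compressed G" "three_graph G" "verts G = {1..n}"
  shows "shifted (edges G)"
  unfolding shifted_def
proof (intro ballI allI impI, elim conjE)
  fix e j i assume e: "e \<in> edges G" "j \<in> e" and i: "1 \<le> i" "i < j" "i \<notin> e"
  have e3: "e \<subseteq> {1..n}" "finite e" "card e = 3" using e G by (auto simp: three_graph_def nsets_def)
  have "card (e - {j}) = 2" using e e3 by simp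
  then obtain p q where pq: "e - {j} = {p, q}" "p \<noteq> q" by (auto simp: card_2_iff)
  then have "e = {j, p, q}" using e by blast
  moreover have "insert i (e - {j}) = {i, p, q}" using pq by simp
  moreover have "{i, p, q} \<in> [verts G]\<^bsup>3\<^esup>"
  proof -
    have "i \<noteq> p" "i \<noteq> q" using pq i by auto
    moreover have "p \<in> e" "q \<in> e" using pq(1) by blast+
    then have "p \<in> {1..n}" "q \<in> {1..n}" "i \<in> {1..n}" using e3(1) e(2) i by auto
    ultimately show ?thesis using pq(2) by (simp add: G(3) nsets_def)
  qed
  moreover have "{j, p, q} \<in> edges G \<and> {i, p, q} \<in> [verts G]\<^bsup>3\<^esup> \<and> i \<le> j \<and> p \<le> p \<and> q \<le> q
      \<longrightarrow> {i, p, q} \<in> edges G"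
    using G(1) unfolding left_compressed_def
    by - (drule spec[of _ i], drule spec[of _ p], drule spec[of _ q],
          drule spec[of _ j], drule spec[of _ p], drule spec[of _ q])
  ultimately show "insert i (e - {j}) \<in> edges G" using e i by simp
qed

text \<open>If no edge contains both \<open>l - 1\<close> and \<open>l\<close>, the value is linear along the transfer of
  weight from \<open>l\<close> to \<open>l - 1\<close>, and shiftedness makes this direction favourable.\<close>

lemma weights_pushed_down:
  assumes E: "shifted E" "E \<subseteq> [{1..k}]\<^bsup>3\<^esup>"
    and unc: "\<And>l e. t < l \<Longrightarrow> e \<in> E \<Longrightarrow> \<not> (l - 1 \<in> e \<and> l \<in> e)"
    and t: "1 \<le> t" "t \<le> k" and x: "x \<in> weightings {1..k}"
  shows "\<exists>y\<in>weightings {1..k}. val E x \<le> val E y \<and> (\<forall>v\<in>{t<..k}. y v = 0)"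
  using t(2)
proof (induction t rule: inc_induct)
  case base
  show ?case using x by auto
next
  case (step l)
  then obtain y where y: "y \<in> weightings {1..k}" "val E x \<le> val E y" "\<forall>v\<in>{Suc l<..k}. y v = 0" by blast
  let ?z = "y(l := y l + y (Suc l), Suc l := 0)"
  have nn: "0 \<le> y v" if "v \<in> {1..k}" for v using y(1) that by (simp add: weightings_def)
  have l: "l \<in> {1..k}" "Suc l \<in> {1..k}" using step t by auto
  have "val E y \<le> val E ?z"
  proof (rule val_push_down_uncovered[OF E(1) nsets_finite_edges[OF E(2)]])
    show "0 \<le> y v" if "e \<in> E" "v \<in> e" for e v
      using nn edge_vertex[OF E(2) that] by simp
    show "\<not> (l \<in> e \<and> Suc l \<in> e)" if "e \<in> E" for e using unc[of "Suc l" e] that step by simp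
  qed (use l nn in auto)
  moreover have "?z \<in> weightings {1..k}"
    using l nn by (intro weightings_transfer[OF y(1)]) auto
  moreover have "\<forall>v\<in>{l<..k}. ?z v = 0" using y(3) by auto
  ultimately show ?case using y(2) by (meson order_trans)
qed

lemma lag_le_restriction:
  assumes E: "shifted E" "E \<subseteq> [{1..k}]\<^bsup>3\<^esup>" and k: "1 \<le> k"
    and unc: "\<And>l e. t < l \<Longrightarrow> e \<in> E \<Longrightarrow> \<not> (l - 1 \<in> e \<and> l \<in> e)" and t: "1 \<le> t"
  shows "lag k E \<le> lag t (E \<inter> [{1..t}]\<^bsup>3\<^esup>)"
proof -
  obtain x where x: "x \<in> weightings {1..k}" "val E x = lag k E" using lag_attained[OF E(2) k] .
  obtain y where y: "y \<in> weightings {1..k}" "val E x \<le> val E y" "\<forall>v\<in>{t<..k}. y v = 0"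
  proof (cases "t \<le> k")
    case True
    then show ?thesis using weights_pushed_down[OF E unc t _ x(1)] that by blast
  qed (use x(1) that[of x] in auto)
  define z where "z = (\<lambda>v. if v \<in> {1..k} then y v else 0)"
  have z0: "z v = 0" if "t < v \<or> v \<notin> {1..k}" for v using y(3) that by (auto simp: z_def)
  have "(\<Sum>v\<in>{1..t}. z v) = (\<Sum>v\<in>{1..k} \<inter> {1..t}. z v)"
    using z0 by (intro sum.mono_neutral_right) auto
  also have "\<dots> = (\<Sum>v\<in>{1..k}. z v)"
    using z0 by (intro sum.mono_neutral_left) auto
  also have "\<dots> = 1" using y(1) by (simp add: weightings_def z_def)
  finally have zw: "z \<in> weightings {1..t}" using y(1) by (simp add: weightings_def z_def)
  have "val E y = val E z"
    using edge_vertex[OF E(2)] by (intro val_cong) (simp add: z_def)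
  also have "\<dots> = val (E \<inter> [{1..t}]\<^bsup>3\<^esup>) z"
    unfolding val_def
  proof (rule sum.mono_neutral_right)
    show "\<forall>e\<in>E - E \<inter> [{1..t}]\<^bsup>3\<^esup>. (\<Prod>v\<in>e. z v) = 0"
    proof
      fix e assume e: "e \<in> E - E \<inter> [{1..t}]\<^bsup>3\<^esup>"
      then have "e \<in> [{1..k}]\<^bsup>3\<^esup>" "e \<notin> [{1..t}]\<^bsup>3\<^esup>" using E(2) by auto
      then have e3: "finite e" "e \<subseteq> {1..k}" "\<not> e \<subseteq> {1..t}" by (auto simp: nsets_def)
      then obtain v where "v \<in> e" "v \<notin> {1..t}" by blast
      moreover from this have "t < v" using e3 by auto
      ultimately show "(\<Prod>v\<in>e. z v) = 0" using e3 z0 by (meson prod_zero)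
    qed
  qed (use nsets_finite_edges(1)[OF E(2)] in auto)
  also have "\<dots> \<le> lag t (E \<inter> [{1..t}]\<^bsup>3\<^esup>)" by (rule val_le_lag[OF _ zw]) auto
  finally show ?thesis using x(2) y(2) by simp
qed

text \<open>A decreasing optimal weighting of \<open>E\<close> has a positive last weight, as otherwise it would
  be a weighting of the clique on \<open>{1..n + 1}\<close>. So all weights are positive, and every
  additional edge counts.\<close>

lemma lag_strict_mono:
  assumes E: "shifted E" "E \<subset> F" "F \<subseteq> [{1..n + 2}]\<^bsup>3\<^esup>"
    and beats: "lag (n + 2) ([{1..n + 1}]\<^bsup>3\<^esup>) < lag (n + 2) E"
  shows "lag (n + 2) E < lag (n + 2) F"
proof -
  have ET: "E \<subseteq> [{1..n + 2}]\<^bsup>3\<^esup>" using E by blast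
  obtain x where x: "x \<in> weightings {1..n + 2}" "val E x = lag (n + 2) E"
    "\<And>i j. 1 \<le> i \<Longrightarrow> i \<le> j \<Longrightarrow> j \<le> n + 2 \<Longrightarrow> x j \<le> x i"
    using sorted_optimum[OF ET E(1)] by auto
  have nn: "0 \<le> x v" if "v \<in> {1..n + 2}" for v using x(1) that by (simp add: weightings_def)
  have last: "0 < x (n + 2)"
  proof (rule ccontr)
    assume "\<not> 0 < x (n + 2)"
    then have 0: "x (n + 2) = 0" using nn[of "n + 2"] by simp
    have top: "{1..n + 2} = insert (n + 2) {1..n + 1}" by auto
    have "val E x \<le> val ([{1..n + 2}]\<^bsup>3\<^esup>) x"
      using nsets_nonneg[OF x(1)] by (intro val_mono[OF finite_triples ET]) auto
    also have "\<dots> = val ([{1..n + 1}]\<^bsup>3\<^esup>) x"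
      unfolding top using val_nsets_insert[of "{1..n + 1}" "n + 2" 2 x] 0 by (simp add: eval_nat_numeral)
    also have "\<dots> \<le> lag (n + 2) ([{1..n + 1}]\<^bsup>3\<^esup>)"
      by (rule val_le_lag[OF nsets_mono x(1)]) auto
    finally show False using beats x(2) by simp
  qed
  have pos: "0 < x v" if "v \<in> {1..n + 2}" for v
    using x(3)[of v "n + 2"] last that by simp
  obtain f where f: "f \<in> F" "f \<notin> E" using E(2) by blast
  have "f \<subseteq> {1..n + 2}" using f E(3) by (auto simp: nsets_def)
  then have "0 < (\<Prod>v\<in>f. x v)" using pos by (intro prod_pos) auto
  then have "val E x < val (insert f E) x"
    using f nsets_finite_edges(1)[OF ET] by (simp add: val_def)
  also have "\<dots> \<le> val F x"
    using f E nsets_nonneg[OF x(1)] finite_subset[OF E(3) finite_triples] by (intro val_mono) blast+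
  also have "\<dots> \<le> lag (n + 2) F" by (rule val_le_lag[OF E(3) x(1)])
  finally show ?thesis using x(2) by simp
qed

lemma card_differences_le:
  assumes "finite A" "finite B" "card A = card B" "card (sym_diff A B) \<le> 2 * k"
  shows "card (A - B) \<le> k" "card (B - A) \<le> k"
proof -
  have "card (A - B) = card (B - A)"
    using assms card_Diff_subset_Int[of A B] card_Diff_subset_Int[of B A] by (simp add: Int_commute)
  moreover have "card (sym_diff A B) = card (A - B) + card (B - A)"
    using assms by (intro card_Un_disjoint) auto
  ultimately show "card (A - B) \<le> k" "card (B - A) \<le> k" using assms(4) by auto
qed

theorem theorem1p12:
  fixes m n :: nat and G :: "nat hypergraph"
  assumes "0 < m"
    and "three_graph G" and "verts G = {1..n}"
    and "card (edges G) = m"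
    and "left_compressed G"
    and "extremal G"
    and "card (sym_diff (edges G) (edges (colex_graph m))) \<le> 6"
  shows "lagrangian G \<le> lagrangian (colex_graph m)"
proof (rule ccontr)
  assume "\<not> ?thesis"
  then have gt: "lagrangian (colex_graph m) < lagrangian G" by simp
  define E where "E = edges G"
  define C where "C = colex_edges m"
  obtain q where q: "1 \<le> q" and CT: "C \<subseteq> [{1..q + 2}]\<^bsup>3\<^esup>" and KC: "[{1..q + 1}]\<^bsup>3\<^esup> \<subseteq> C"
    and UC: "\<Union>C = {1..q + 2}"
    using colex_graph_shape[OF assms(1)] unfolding C_def .
  have G: "G = \<lparr>verts = {1..n}, edges = E\<rparr>" using assms(3) by (simp add: E_def)
  have colex: "lagrangian (colex_graph m) = lag (q + 2) C"
    using UC by (simp add: colex_graph_def C_def)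
  have En: "E \<subseteq> [{1..n}]\<^bsup>3\<^esup>" using assms(2,3) by (simp add: three_graph_def E_def)
  have finE: "finite E" by (rule nsets_finite_edges(1)[OF En])
  have finC: "finite C" and cardC: "card C = m"
    using colex_edges_initial[of m] by (auto simp: C_def colex_initial_def)
  have cardE: "card E = m" using assms(4) by (simp add: E_def)
  have sh: "shifted E" using left_compressed_shifted[OF assms(5,2,3)] by (simp add: E_def)
  have lc: "{a1, a2, a3} \<in> E"
    if "{b1, b2, b3} \<in> E" "{a1, a2, a3} \<in> [{1..n}]\<^bsup>3\<^esup>" "a1 \<le> b1" "a2 \<le> b2" "a3 \<le> b3" for a1 a2 a3 b1 b2 b3
    using assms(5) that unfolding left_compressed_def E_def assms(3) by blast
  have "card (sym_diff E C) \<le> 2 * 3"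
    using assms(7) by (simp add: E_def C_def colex_graph_def)
  note close = card_differences_le[OF finE finC _ this]
  have new: "card (E - C) \<le> 3" and old: "card (C - E) \<le> 3" using close cardE cardC by auto
  have beatsK: "lag (q + 2) ([{1..q + 1}]\<^bsup>3\<^esup>) < lagrangian G"
    using lag_mono[OF KC CT] gt colex by simp
  have m_le: "m \<le> (q + 2) choose 3"
    using card_mono[OF finite_triples CT] cardC by (simp add: card_nsets)
  have n1: "1 \<le> n"
  proof (rule ccontr)
    assume "\<not> 1 \<le> n"
    then have "E = {}" using En by (auto simp: nsets_def)
    then show False using cardE assms(1) by simp
  qed
  have unc: "\<not> (l - 1 \<in> e \<and> l \<in> e)" if l: "q + 2 < l" and e: "e \<in> E" for l e
  proof
    assume le: "l - 1 \<in> e \<and> l \<in> e"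
    have e3: "e \<subseteq> {1..n}" "card e = 3" "finite e" using e En by (auto simp: nsets_def)
    have "card (e - {l - 1, l}) = 1" using e3 le l by (simp add: card_Diff_subset)
    then obtain h where h: "e - {l - 1, l} = {h}" by (rule card_1_singletonE)
    then have eh: "e = {h, l - 1, l}" using le by blast
    then have h1: "1 \<le> h" "l \<le> n" using e3 by auto
    have edge: "{h, l - 1, l} \<in> E" using e eh by simp
    have all: "{1, i, j} \<in> E" if ij: "2 \<le> i" "i < j" "j \<le> q + 3" for i j
    proof (rule lc[OF edge])
      show "i \<le> l - 1" "j \<le> l" "1 \<le> h" using ij l h1 by auto
      show "{1, i, j} \<in> [{1..n}]\<^bsup>3\<^esup>" using ij l h1 by (auto simp: nsets_def)
    qed
    have "(\<lambda>i. {1, i, q + 3}) ` {2..q + 2} \<subseteq> E - C"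
    proof
      fix f assume "f \<in> (\<lambda>i. {1, i, q + 3}) ` {2..q + 2}"
      then obtain i where "2 \<le> i" "i \<le> q + 2" "f = {1, i, q + 3}" by auto
      moreover from this have "f \<notin> C" using CT by (auto simp: nsets_def)
      ultimately show "f \<in> E - C" using all by auto
    qed
    moreover have "inj_on (\<lambda>i. {1, i, q + 3}) {2..q + 2}"
    proof (rule inj_onI)
      fix i j assume ij: "i \<in> {2..q + 2}" "{1, i, q + 3} = {1, j, q + 3}"
      then have "i \<in> {1, j, q + 3}" by blast
      then show "i = j" using ij(1) by auto
    qed
    ultimately have "card {2..q + 2} \<le> card (E - C)"
      using finE by (metis card_image card_mono finite_Diff)
    then have q2: "q \<le> 2" using new by simp
    \<comment> \<open>For \<open>q \<le> 2\<close> these are more edges than a graph on \<open>q + 2\<close> vertices can have.\<close>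
    have "insert 1 ` [{2..q + 3}]\<^bsup>2\<^esup> \<subseteq> E"
    proof
      fix f assume "f \<in> insert 1 ` [{2..q + 3}]\<^bsup>2\<^esup>"
      then obtain g where g: "f = insert 1 g" "g \<subseteq> {2..q + 3}" "card g = 2" by (auto simp: nsets_def)
      then obtain i j where ij: "g = {i, j}" "i \<noteq> j" by (auto simp: card_2_iff)
      then have "{1, i, j} \<in> E \<or> {1, j, i} \<in> E" using all[of i j] all[of j i] g by (cases "i < j") auto
      then show "f \<in> E" using g ij by (auto simp: insert_commute)
    qed
    moreover have "inj_on (insert 1) ([{2..q + 3}]\<^bsup>2\<^esup>)"
    proof (rule inj_onI)
      fix f g assume "f \<in> [{2..q + 3}]\<^bsup>2\<^esup>" "g \<in> [{2..q + 3}]\<^bsup>2\<^esup>" "insert 1 f = insert 1 g"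
      moreover from this have "1 \<notin> f" "1 \<notin> g" by (auto simp: nsets_def)
      ultimately show "f = g" by (simp add: insert_ident)
    qed
    ultimately have "card ([{2..q + 3}]\<^bsup>2\<^esup>) \<le> card E"
      using finE by (metis card_image card_mono)
    then have "(q + 2) choose 2 \<le> (q + 2) choose 3" using m_le cardE by (simp add: card_nsets)
    moreover have "q = 1 \<or> q = 2" using q q2 by auto
    ultimately show False by (auto simp: numeral_eq_Suc)
  qed
  have lagG: "lagrangian G \<le> lag (q + 2) (E \<inter> [{1..q + 2}]\<^bsup>3\<^esup>)"
    unfolding G by (rule lag_le_restriction[OF sh En n1]) (use unc in auto)
  have nq: "q + 2 \<le> n"
  proof (rule ccontr)
    assume "\<not> q + 2 \<le> n"
    then have "E \<inter> [{1..q + 2}]\<^bsup>3\<^esup> \<subseteq> [{1..q + 1}]\<^bsup>3\<^esup>" using En nsets_mono[of "{1..n}" "{1..q + 1}" 3] by auto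
    then have "lag (q + 2) (E \<inter> [{1..q + 2}]\<^bsup>3\<^esup>) \<le> lag (q + 2) ([{1..q + 1}]\<^bsup>3\<^esup>)"
      by (rule lag_mono) (auto simp: nsets_def)
    then show False using lagG beatsK by simp
  qed
  have ET: "E \<subseteq> [{1..q + 2}]\<^bsup>3\<^esup>"
  proof (rule ccontr)
    assume out: "\<not> E \<subseteq> [{1..q + 2}]\<^bsup>3\<^esup>"
    \<comment> \<open>Edges outside carry no weight; replacing them by triples inside strictly increases the value.\<close>
    define E' where "E' = E \<inter> [{1..q + 2}]\<^bsup>3\<^esup>"
    have E': "E' \<subset> E" "E' \<subseteq> [{1..q + 2}]\<^bsup>3\<^esup>" "finite E'" using out finE by (auto simp: E'_def)
    have less: "card E' < m" using psubset_card_mono[OF finE E'(1)] cardE by simp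
    have "card ([{1..q + 2}]\<^bsup>3\<^esup> - E') = ((q + 2) choose 3) - card E'"
      using E' by (simp add: card_Diff_subset card_nsets)
    then obtain F where F: "F \<subseteq> [{1..q + 2}]\<^bsup>3\<^esup> - E'" "card F = m - card E'" "finite F"
      using m_le obtain_subset_with_card_n[of "m - card E'" "[{1..q + 2}]\<^bsup>3\<^esup> - E'"] by (metis diff_le_mono)
    have sh': "shifted E'"
      unfolding shifted_def
    proof (intro ballI allI impI, elim conjE)
      fix e j i assume e: "e \<in> E'" "j \<in> e" and i: "1 \<le> i" "i < j" "i \<notin> e"
      then have "insert i (e - {j}) \<in> E" using sh by (auto simp: shifted_def E'_def)
      moreover from this have "card (insert i (e - {j})) = 3" "finite (insert i (e - {j}))"
        using En by (auto simp: nsets_def)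
      moreover have "e \<subseteq> {1..q + 2}" using e by (auto simp: E'_def nsets_def)
      then have "insert i (e - {j}) \<subseteq> {1..q + 2}" using e i by auto
      ultimately show "insert i (e - {j}) \<in> E'" by (simp add: E'_def nsets_def)
    qed
    have "F \<noteq> {}" using F less by auto
    then have "lag (q + 2) E' < lag (q + 2) (E' \<union> F)"
      using F E' beatsK lagG by (intro lag_strict_mono[OF sh']) (auto simp: E'_def)
    moreover have "card (E' \<union> F) = m" using F E' less by (subst card_Un_disjoint) auto
    then have "lag (q + 2) (E' \<union> F) \<le> lagrangian G"
      using assms(6) F E' cardE unfolding extremal_def E_def[symmetric]
      by (intro conjunct2[OF assms(6)[unfolded extremal_def E_def[symmetric]], rule_format])
         (auto simp: three_graph_def)
    ultimately show False using lagG by (simp add: E'_def)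
  qed
  have lagE: "lagrangian G \<le> lag (q + 2) E" using lagG ET by (simp add: Int_absorb2)
  have KE: "[{1..q}]\<^bsup>3\<^esup> \<subseteq> E"
  proof (rule ccontr)
    assume "\<not> [{1..q}]\<^bsup>3\<^esup> \<subseteq> E"
    then obtain f where f: "f \<in> [{1..q}]\<^bsup>3\<^esup>" "f \<notin> E" by blast
    then have f3: "f \<subseteq> {1..q}" "finite f" "card f = 3" by (auto simp: nsets_def)
    define c where "c = Max f"
    define a where "a = Min f"
    have "f \<noteq> {}" using f3 by auto
    then have ac: "a \<in> f" "c \<in> f" using f3 by (auto simp: a_def c_def)
    have "a \<noteq> c"
    proof
      assume "a = c"
      then have "f \<subseteq> {a}" using f3 Min_le[OF f3(2)] Max_ge[OF f3(2)] unfolding a_def c_def by fastforce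
      then show False using f3 card_mono[of "{a}" f] by simp
    qed
    then have "card (f - {a, c}) = 1" using f3 ac by (simp add: card_Diff_subset)
    then obtain b where b: "f - {a, c} = {b}" by (rule card_1_singletonE)
    then have fabc: "f = {a, b, c}" using ac by blast
    have "b \<in> f" "b \<noteq> a" "b \<noteq> c" using b by auto
    moreover have "a \<le> b" "b \<le> c" using f3 calculation(1) by (auto simp: a_def c_def)
    ultimately have "a < b" "b < c" by auto
    moreover have "c \<le> q" using ac f3 by auto
    ultimately have abc: "a \<le> q - 2" "b \<le> q - 1" "c \<le> q" "3 \<le> q" using ac f3 by auto
    have fn: "{a, b, c} \<in> [{1..n}]\<^bsup>3\<^esup>"
      using f(1) nq nsets_mono[of "{1..q}" "{1..n}" 3] unfolding fabc by auto
    have out: "{i, j, k} \<notin> E" if "q - 2 \<le> i" "q - 1 \<le> j" "q \<le> k" for i j k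
      using lc[of i j k a b c] fn that abc f(2) fabc by auto
    \<comment> \<open>Four triples of \<open>C\<close> that dominate \<open>f\<close>, hence are missing in \<open>E\<close>.\<close>
    define D where "D = {{q - 2, q - 1, q}, {q - 2, q - 1, q + 1}, {q - 2, q, q + 1}, {q - 1, q, q + 1}}"
    have "q = q - 2 + 2" "0 < q - 2" using abc by auto
    then obtain r where r: "q = r + 2" "0 < r" by blast
    have "{q - 2, q - 1, q} \<notin> E" "{q - 2, q - 1, q + 1} \<notin> E" "{q - 2, q, q + 1} \<notin> E"
      "{q - 1, q, q + 1} \<notin> E"
      by (rule out; simp)+
    moreover have "D \<subseteq> [{1..q + 1}]\<^bsup>3\<^esup>" unfolding D_def r(1) using r(2) by (simp add: nsets_def)
    ultimately have "D \<subseteq> C - E" using KC unfolding D_def by blast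
    then have "card D \<le> 3" using old card_mono[of "C - E" D] finC by simp
    moreover have "card D = 4"
    proof -
      let ?Q = "{r, r + 1, r + 2, r + 3}"
      have "inj_on (\<lambda>v. ?Q - {v}) ?Q"
        by (rule inj_onI) blast
      then have "card ((\<lambda>v. ?Q - {v}) ` ?Q) = card ?Q" by (rule card_image)
      moreover have "(\<lambda>v. ?Q - {v}) ` ?Q = D"
      proof -
        have "?Q - {r} = {r + 1, r + 2, r + 3}" "?Q - {r + 1} = {r, r + 2, r + 3}"
          "?Q - {r + 2} = {r, r + 1, r + 3}" "?Q - {r + 3} = {r, r + 1, r + 2}" by auto
        then have "(\<lambda>v. ?Q - {v}) ` ?Q
            = {{r + 1, r + 2, r + 3}, {r, r + 2, r + 3}, {r, r + 1, r + 3}, {r, r + 1, r + 2}}"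
          by (simp only: image_insert image_empty)
        also have "\<dots> = D" unfolding D_def r(1) by (simp add: insert_commute numeral_3_eq_3)
        finally show ?thesis .
      qed
      ultimately show ?thesis by simp
    qed
    ultimately show False by simp
  qed
  obtain N M b where adm: "admissible q N M b" and E: "E = tail q N M b"
    by (rule shifted_is_tail[OF sh ET KE])
  have b: "b \<le> q" using adm by (simp add: admissible_def)
  note pairs = admissible_pairs[OF adm]
  note dec = tail_missing_decomposition[OF adm]
  have count: "m + card N + card M + (q - b) = (q + 2) choose 3"
    using card_tail[OF adm] cardE E by simp
  have NM: "N \<subseteq> M" using adm by (simp add: admissible_def)
  \<comment> \<open>In the first case \<open>C\<close> is the tail graph without missing pairs and with as many edges. In the second it lacks all
    triples \<open>{j, q + 1, q + 2}\<close>.\<close>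
  show False
  proof (cases "card N + card M \<le> b")
    case True
    define d where "d = b - (card N + card M)"
    have d: "d \<le> q" using b by (simp add: d_def)
    have "card (tail q {} {} d) = m"
      using card_tail[OF admissible_empty[OF d]] count True b by (simp add: d_def)
    then have C: "C = tail q {} {} d"
      using colex_edges_card[OF tail_empty_initial[OF d]] by (simp add: C_def)
    have "insert (q + 1) ` N \<union> insert (q + 2) ` M \<subseteq> C - E"
    proof
      fix e assume e: "e \<in> insert (q + 1) ` N \<union> insert (q + 2) ` M"
      then have "e \<in> tail_missing q N M b" by (auto simp: tail_missing_def)
      then have "e \<in> [{1..q + 2}]\<^bsup>3\<^esup>" "e \<notin> E" using dec(2) E by (auto simp: tail_def)
      moreover have "e \<notin> tail_missing q {} {} d"
      proof -
        obtain f where f: "f \<in> M" "e = insert (q + 1) f \<or> e = insert (q + 2) f" using e NM by auto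
        have "v \<le> q" if "v \<in> f" for v using edge_vertex[OF pairs(4) f(1) that] by simp
        then have "\<not> (q + 1 \<in> e \<and> q + 2 \<in> e)" using f(2) by fastforce
        then show ?thesis by (auto simp: tail_missing_def)
      qed
      ultimately show "e \<in> C - E" unfolding C by (simp add: tail_def)
    qed
    then have "card (insert (q + 1) ` N \<union> insert (q + 2) ` M) \<le> 3"
      using old card_mono[of "C - E"] finC by (meson finite_Diff order_trans)
    then have "card N + card M \<le> 3"
      using dec(4,5,6) pairs by (simp add: card_Un_disjoint card_image)
    then have "lag (q + 2) E \<le> lag (q + 2) C"
      using lag_tail_le[OF adm q _ True] unfolding E C d_def by simp
    then show False using lagE gt colex by simp
  next
    case False
    have "m \<le> card (tail q {} {} 0)"
      using card_tail[OF admissible_empty[of 0 q]] count False b by simp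
    then have C: "C \<subseteq> tail q {} {} 0"
      using colex_edges_card[OF tail_empty_initial[of 0 q]] colex_edges_mono by (metis C_def le0)
    have "(\<lambda>j. {j, q + 1, q + 2}) ` {0<..b} \<subseteq> E - C"
    proof
      fix e assume "e \<in> (\<lambda>j. {j, q + 1, q + 2}) ` {0<..b}"
      then obtain j where j: "0 < j" "j \<le> b" "e = {j, q + 1, q + 2}" by auto
      have "e \<in> tail_missing q {} {} 0" using j b by (auto simp: tail_missing_def)
      then have "e \<notin> C" using C by (auto simp: tail_def)
      moreover have "e \<notin> tail_missing q N M b"
      proof
        assume "e \<in> tail_missing q N M b"
        then consider f where "f \<in> M" "e = insert (q + 1) f \<or> e = insert (q + 2) f"
          | i where "i \<in> {b<..q}" "e = {i, q + 1, q + 2}"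
          using NM by (auto simp: tail_missing_def)
        then show False
        proof cases
          case 1
          have "f \<subseteq> {b<..q}" using edge_vertex[OF pairs(4) 1(1)] by blast
          moreover have "j \<in> e" using j by simp
          then have "j \<in> f" using 1(2) j(2) b by auto
          ultimately show False using j by auto
        next
          case 2
          then have "j \<in> {i, q + 1, q + 2}" using j by blast
          then show False using 2 j b by auto
        qed
      qed
      then have "e \<in> E" unfolding E using j b by (auto simp: tail_def nsets_def card_insert_if)
      ultimately show "e \<in> E - C" by simp
    qed
    moreover have "inj_on (\<lambda>j. {j, q + 1, q + 2}) {0<..b}"
      using tail_missing_decomposition(7)[OF admissible_empty[of 0 q]] b
      by (auto intro: inj_on_subset)
    ultimately have "card {0<..b} \<le> card (E - C)"
      using finE by (metis card_image card_mono finite_Diff)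
    then have b3: "b \<le> 3" using new by simp
    have beats: "lag (q + 2) ([{1..q + 1}]\<^bsup>3\<^esup>) < lag (q + 2) (tail q N M b)"
      using beatsK lagE E by simp
    obtain x where "tail_optimum q N M b x" by (rule tail_optimum_exists[OF adm q beats])
    then have "card M < b" by (rule tail_optimum.card_M_less)
    moreover have "card N \<le> card M" using NM pairs by (intro card_mono)
    ultimately have "card N = 2" "card M = 2" "b = 3" using False b3 by auto
    then show False using lag_double_defect_le[of q N M] adm beats by simp
  qed
qed

end
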